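(* Let $M\ge 2$ be an integer. There exists a strictly stationary sequence $\tilde X=(\tilde X_k,k\in\mathbb Z)$ of real-valued random variables with $E\tilde X_0=0$ and $E\tilde X_0^2=1/2$ such that: (A) $\tilde X$ satisfies $M$-tuplewise independence; (B) $\tilde X$ is mixing (in the ergodic-theoretic sense); (C) the random variables $|\tilde X_k|$, $k\in\mathbb Z$, are independent (and identically distributed); (D) for every infinite set $Q\subset\mathbb N$ there exist an infinite set $T\subset Q$ and a nondegenerate, non-normal probability measure $\tilde\mu$ on $(\mathbb R,\mathcal R)$ such that $S(\tilde X,n)/\sqrt n\Rightarrow\tilde\mu$ as $n\to\infty$, $n\in T$. *)

theory Defs
  imports "HOL-Probability.Probability"
begin

definition path_space :: "(int \<Rightarrow> real) measure" where
  "path_space = PiM UNIV (\<lambda>_. borel)"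

definition S_sum :: "(int \<Rightarrow> 'a \<Rightarrow> real) \<Rightarrow> nat \<Rightarrow> 'a \<Rightarrow> real" where
  "S_sum X n \<omega> = (\<Sum>k = 1..int n. X k \<omega>)"

definition strictly_stationary :: "'a measure \<Rightarrow> (int \<Rightarrow> 'a \<Rightarrow> real) \<Rightarrow> bool" where
  "strictly_stationary P X \<longleftrightarrow>
     (\<forall>h::int. distr P path_space (\<lambda>\<omega> k. X (k + h) \<omega>) = distr P path_space (\<lambda>\<omega> k. X k \<omega>))"

definition tuplewise_indep :: "nat \<Rightarrow> 'a measure \<Rightarrow> (int \<Rightarrow> 'a \<Rightarrow> real) \<Rightarrow> bool" where
  "tuplewise_indep M P X \<longleftrightarrow>
     (\<forall>S::int set. card S = M \<longrightarrow> prob_space.indep_vars P (\<lambda>_. borel) X S)"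

definition mixing :: "'a measure \<Rightarrow> (int \<Rightarrow> 'a \<Rightarrow> real) \<Rightarrow> bool" where
  "mixing P X \<longleftrightarrow>
     (\<forall>A \<in> sets path_space. \<forall>B \<in> sets path_space.
        (\<lambda>n::nat. measure P {\<omega> \<in> space P. (\<lambda>k. X k \<omega>) \<in> A \<and> (\<lambda>k. X (k + int n) \<omega>) \<in> B})
        \<longlonglongrightarrow> measure P {\<omega> \<in> space P. (\<lambda>k. X k \<omega>) \<in> A}
             * measure P {\<omega> \<in> space P. (\<lambda>k. X k \<omega>) \<in> B})"

definition nondegenerate :: "real measure \<Rightarrow> bool" where
  "nondegenerate \<mu> \<longleftrightarrow> \<not> (\<exists>c. \<mu> = return borel c)"

text \<open>Normal laws N(m, s^2) with s > 0 (degenerate laws are excluded separately).\<close>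
definition non_normal :: "real measure \<Rightarrow> bool" where
  "non_normal \<mu> \<longleftrightarrow> \<not> (\<exists>m s. s > 0 \<and> \<mu> = density lborel (normal_density m s))"

end

(* Let L = 2h > M. A block of level j + 1 is the concatenation of L blocks of level j,
   drawn with density 1 - prod_c sgn W_c relative to the product law, where W_c is the sum
   of the c-th block. Since sgn W is odd, any L - 1 of the blocks, and hence any L - 1 of the
   signs in a block, remain independent. The density pushes the L-th moment of every window
   sum strictly below its value for independent signs, by a fixed fraction of (length)^h,
   while all lower moments agree. Averaging over the position of a window in a large block
   gives a stationary sequence X of signs with the same properties.

   The sequence xi_k X_{N(k)}, with fair coins xi_k independent of X and N(k) the number of
   heads up to time k, has independent absolute values. It is mixing because the binomial
   smoothing of N(k) spreads the gap between two windows evenly over the residues modulo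
   L^i, and distinct blocks are independent. A weak limit of the normalised sums along a
   subsequence has mean 0 and variance 1/2 but, by Fatou's lemma, an L-th moment below that
   of N(0, 1/2). *)

theory Submission
  imports Defs
begin

section \<open>Mean functionals on words\<close>

text \<open>The density alters a single monomial. When (sum of W_c)^m times the product of the sgn
  W_c is expanded with m \<le> L, a term that misses some block has mean zero; so only W_1 ... W_L
  survives, at m = L, with mean L! times the product of the E|W_c|. By the second and fourth moments
  E|W_c| is of order sqrt(length), so each level creates a loss of order (length)^h, the natural
  order of the L-th moment. Losses add up and are never undone, and every long window contains an
  aligned block of comparable length; hence the loss is present for all large n, as a claim about
  every subsequence requires. Independent signs have even moments at most Gaussian, so a loss
  against them is a loss against the Gaussian.

  Without the delay, two windows of X at a fixed lag keep a fixed difference of positions modulo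
  L^i, and the estimate for the pair depends on it: this is the obstacle to mixing.

  All laws before the final extension live on finitely many words, so expectations are treated as
  positive normalised linear functionals; testing monotonicity on \<open>S\<close> alone says that
  the law is carried by \<open>S\<close>.\<close>

definition mean_on :: "'a set \<Rightarrow> (('a \<Rightarrow> real) \<Rightarrow> real) \<Rightarrow> bool" where
  "mean_on S E \<longleftrightarrow>
     (\<forall>f g. E (\<lambda>x. f x + g x) = E f + E g) \<and>
     (\<forall>c f. E (\<lambda>x. c * f x) = c * E f) \<and>
     (\<forall>f g. (\<forall>x\<in>S. f x \<le> g x) \<longrightarrow> E f \<le> E g) \<and>
     E (\<lambda>_. 1) = 1"

context
  fixes S :: "'a set" and E :: "('a \<Rightarrow> real) \<Rightarrow> real"
  assumes E: "mean_on S E"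
begin

lemma mean_add: "E (\<lambda>x. f x + g x) = E f + E g"
  using E by (simp add: mean_on_def)

lemma mean_cmult: "E (\<lambda>x. c * f x) = c * E f"
  using E by (simp add: mean_on_def)

lemma mean_multc: "E (\<lambda>x. f x * c) = E f * c"
  using mean_cmult[of c f] by (simp add: mult.commute)

lemma mean_mono: "(\<And>x. x \<in> S \<Longrightarrow> f x \<le> g x) \<Longrightarrow> E f \<le> E g"
  using E by (simp add: mean_on_def)

lemma mean_cong: "(\<And>x. x \<in> S \<Longrightarrow> f x = g x) \<Longrightarrow> E f = E g"
  by (intro antisym mean_mono) auto

lemma mean_const: "E (\<lambda>_. c) = c"
  using E mean_cmult[of c "\<lambda>_. 1"] by (simp add: mean_on_def)

lemma mean_minus: "E (\<lambda>x. - f x) = - E f"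
  using mean_cmult[of "-1" f] by simp

lemma mean_diff: "E (\<lambda>x. f x - g x) = E f - E g"
  using mean_add[of f "\<lambda>x. - g x"] by (simp add: mean_minus)

lemma mean_sum: "E (\<lambda>x. \<Sum>i\<in>I. f i x) = (\<Sum>i\<in>I. E (f i))"
  by (induction I rule: infinite_finite_induct) (simp_all add: mean_const mean_add)

lemma mean_nonneg: "(\<And>x. x \<in> S \<Longrightarrow> 0 \<le> f x) \<Longrightarrow> 0 \<le> E f"
  using mean_mono[of "\<lambda>_. 0" f] by (simp add: mean_const)

text \<open>On a finite set the functional is integration against point weights. This is what yields
  Fubini in \<open>mean_swap\<close>.\<close>

lemma mean_weights:
  assumes "finite S"
  shows "E f = (\<Sum>x\<in>S. f x * E (indicator {x}))"
proof -
  have "E f = E (\<lambda>y. \<Sum>x\<in>S. f x * indicator {x} y)"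
  proof (rule mean_cong)
    fix y assume "y \<in> S"
    then have "(\<Sum>x\<in>S. f x * indicator {x} y) = (\<Sum>x\<in>S. if x = y then f y else 0)"
      by (intro sum.cong) auto
    then show "f y = (\<Sum>x\<in>S. f x * indicator {x} y)"
      using assms \<open>y \<in> S\<close> by simp
  qed
  also have "\<dots> = (\<Sum>x\<in>S. f x * E (indicator {x}))"
    by (simp add: mean_sum mean_cmult)
  finally show ?thesis .
qed

end

lemma mean_swap:
  assumes E: "mean_on S E" and "finite S" and E': "mean_on S' E'"
  shows "E (\<lambda>x. E' (\<lambda>y. f x y)) = E' (\<lambda>y. E (\<lambda>x. f x y))"
proof -
  have "E (\<lambda>x. E' (\<lambda>y. f x y)) = (\<Sum>x\<in>S. E' (f x) * E (indicator {x}))"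
    by (rule mean_weights[OF E \<open>finite S\<close>])
  also have "\<dots> = E' (\<lambda>y. \<Sum>x\<in>S. f x y * E (indicator {x}))"
    by (simp add: mean_sum[OF E'] mean_multc[OF E'])
  also have "\<dots> = E' (\<lambda>y. E (\<lambda>x. f x y))"
    by (simp add: mean_weights[OF E \<open>finite S\<close>, of "\<lambda>x. f x _"])
  finally show ?thesis .
qed

text \<open>Expectation over \<open>n\<close> independent draws from the law \<open>E\<close>, the
  first letter being integrated last.\<close>

primrec iter :: "(('a \<Rightarrow> real) \<Rightarrow> real) \<Rightarrow> nat \<Rightarrow> ('a list \<Rightarrow> real) \<Rightarrow> real" where
  "iter E 0 f = f []"
| "iter E (Suc n) f = E (\<lambda>x. iter E n (\<lambda>xs. f (x # xs)))"

definition words :: "'a set \<Rightarrow> nat \<Rightarrow> 'a list set" where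
  "words A n = {xs. set xs \<subseteq> A \<and> length xs = n}"

lemma finite_words: "finite A \<Longrightarrow> finite (words A n)"
  unfolding words_def by (rule finite_lists_length_eq)

lemma words_0 [simp]: "words A 0 = {[]}"
  by (auto simp: words_def)

lemma words_Suc: "words A (Suc n) = (\<lambda>(x, xs). x # xs) ` (A \<times> words A n)"
  by (auto simp: words_def length_Suc_conv image_iff)

lemma sum_words_Suc:
  "(\<Sum>w\<in>words A (Suc n). f w) = (\<Sum>x\<in>A. \<Sum>w\<in>words A n. f (x # w))"
  unfolding words_Suc
  by (subst sum.reindex) (auto simp: inj_on_def sum.cartesian_product case_prod_unfold)

lemma mean_on_iter:
  assumes E: "mean_on S E"
  shows "mean_on (words S n) (iter E n)"
proof (induction n)
  case 0
  then show ?case by (auto simp: mean_on_def)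
next
  case (Suc n)
  note IH = Suc
  show ?case unfolding mean_on_def
  proof (intro conjI allI impI)
    fix f g :: "'a list \<Rightarrow> real"
    assume "\<forall>x\<in>words S (Suc n). f x \<le> g x"
    then show "iter E (Suc n) f \<le> iter E (Suc n) g"
      unfolding iter.simps
      by (intro mean_mono[OF E] mean_mono[OF IH]) (auto simp: words_def)
  qed (simp_all add: mean_add[OF E] mean_add[OF IH] mean_cmult[OF E] mean_cmult[OF IH]
         mean_const[OF E] mean_const[OF IH])
qed

lemma iter_prod:
  assumes E: "mean_on S E"
  shows "iter E n (\<lambda>xs. \<Prod>c<n. f c (xs ! c)) = (\<Prod>c<n. E (f c))"
proof (induction n arbitrary: f)
  case (Suc n)
  have "iter E (Suc n) (\<lambda>xs. \<Prod>c<Suc n. f c (xs ! c))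
      = E (\<lambda>x. iter E n (\<lambda>xs. f 0 x * (\<Prod>c<n. f (Suc c) (xs ! c))))"
    by (simp add: prod.lessThan_Suc_shift del: prod.lessThan_Suc)
  also have "\<dots> = E (f 0) * (\<Prod>c<n. E (f (Suc c)))"
    by (simp add: mean_cmult[OF mean_on_iter[OF E]] Suc[of "\<lambda>c. f (Suc c)"] mean_multc[OF E])
  finally show ?case
    by (simp add: prod.lessThan_Suc_shift del: prod.lessThan_Suc)
qed simp

text \<open>Independent draws are exchangeable and \<open>F\<close> sees only symmetric functions of
  them, so by Fubini the letter at position \<open>c\<close> may be drawn first.\<close>

lemma iter_move:
  assumes E: "mean_on S E" and "finite S" and "c \<le> n"
  shows "iter E (Suc n) (\<lambda>xs. g (xs ! c) * F (\<Sum>i\<le>n. u (xs ! i)) (\<Prod>i\<le>n. v (xs ! i)))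
       = E (\<lambda>x. g x * iter E n (\<lambda>xs. F (u x + (\<Sum>i<n. u (xs ! i))) (v x * (\<Prod>i<n. v (xs ! i)))))"
  using \<open>c \<le> n\<close>
proof (induction n arbitrary: c F)
  case 0
  then show ?case by simp
next
  case (Suc n)
  show ?case
  proof (cases c)
    case 0
    then show ?thesis
      by (simp add: sum.atMost_Suc_shift prod.atMost_Suc_shift lessThan_Suc_atMost
            mean_cmult[OF E] mean_cmult[OF mean_on_iter[OF E]]
            del: sum.atMost_Suc prod.atMost_Suc)
  next
    case (Suc c')
    with Suc.prems have "c' \<le> n" by simp
    have "iter E (Suc (Suc n)) (\<lambda>xs. g (xs ! c) * F (\<Sum>i\<le>Suc n. u (xs ! i)) (\<Prod>i\<le>Suc n. v (xs ! i)))
        = E (\<lambda>y. iter E (Suc n) (\<lambda>xs. g (xs ! c') *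
             F (u y + (\<Sum>i\<le>n. u (xs ! i))) (v y * (\<Prod>i\<le>n. v (xs ! i)))))"
      unfolding iter.simps(2)[of E "Suc n"]
      by (simp add: Suc sum.atMost_Suc_shift prod.atMost_Suc_shift
            del: sum.atMost_Suc prod.atMost_Suc iter.simps)
    also have "\<dots> = E (\<lambda>y. E (\<lambda>x. g x * iter E n (\<lambda>xs.
             F (u y + (u x + (\<Sum>i<n. u (xs ! i)))) (v y * (v x * (\<Prod>i<n. v (xs ! i)))))))"
      by (subst Suc.IH[OF \<open>c' \<le> n\<close>]) simp
    also have "\<dots> = E (\<lambda>x. g x * E (\<lambda>y. iter E n (\<lambda>xs.
             F (u y + (u x + (\<Sum>i<n. u (xs ! i)))) (v y * (v x * (\<Prod>i<n. v (xs ! i)))))))"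
      by (subst mean_swap[OF E \<open>finite S\<close> E]) (simp add: mean_cmult[OF E])
    also have "\<dots> = E (\<lambda>x. g x * iter E (Suc n) (\<lambda>xs.
             F (u x + (\<Sum>i<Suc n. u (xs ! i))) (v x * (\<Prod>i<Suc n. v (xs ! i)))))"
      by (simp add: sum.lessThan_Suc_shift prod.lessThan_Suc_shift ac_simps
            del: sum.lessThan_Suc prod.lessThan_Suc)
    finally show ?thesis .
  qed
qed

lemma iter_map:
  assumes "\<And>f. E (\<lambda>x. f (u x)) = E f"
  shows "iter E n (\<lambda>xs. f (map u xs)) = iter E n f"
proof (induction n arbitrary: f)
  case (Suc n)
  have "iter E (Suc n) (\<lambda>xs. f (map u xs)) = E (\<lambda>x. iter E n (\<lambda>xs. f (u x # xs)))"
    using Suc[of "\<lambda>xs. f (u _ # xs)"] by simp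
  also have "\<dots> = iter E (Suc n) f"
    using assms[of "\<lambda>x. iter E n (\<lambda>xs. f (x # xs))"] by simp
  finally show ?case .
qed simp

section \<open>Moments of sums of independent signs\<close>

text \<open>Expectation over a sum of \<open>n\<close> independent variables that vanish with probability
  \<open>1 - a\<close> and are a fair sign otherwise.\<close>

primrec walk :: "real \<Rightarrow> nat \<Rightarrow> (real \<Rightarrow> real) \<Rightarrow> real" where
  "walk a 0 f = f 0"
| "walk a (Suc n) f = (1 - a) * walk a n f
     + a / 2 * (walk a n (\<lambda>x. f (x + 1)) + walk a n (\<lambda>x. f (x - 1)))"

lemma walk_add: "walk a n (\<lambda>x. f x + g x) = walk a n f + walk a n g"
  by (induction n arbitrary: f g) (simp_all add: algebra_simps add_divide_distrib)

lemma walk_cmult: "walk a n (\<lambda>x. c * f x) = c * walk a n f"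
  by (induction n arbitrary: f) (simp_all add: algebra_simps)

lemma walk_zero: "walk a n (\<lambda>_. 0) = 0"
  by (induction n) simp_all

lemma walk_one: "walk a n (\<lambda>_. 1) = 1"
  by (induction n) simp_all

lemma walk_sum: "walk a n (\<lambda>x. \<Sum>i\<in>I. f i x) = (\<Sum>i\<in>I. walk a n (f i))"
  by (induction I rule: infinite_finite_induct) (simp_all add: walk_add walk_zero)

lemma walk_plus: "walk a (m + n) f = walk a m (\<lambda>x. walk a n (\<lambda>y. f (x + y)))"
proof (induction m arbitrary: f)
  case (Suc m)
  have "walk a (Suc m + n) f = (1 - a) * walk a (m + n) f
     + a / 2 * (walk a (m + n) (\<lambda>x. f (x + 1)) + walk a (m + n) (\<lambda>x. f (x - 1)))"
    by simp
  also have "\<dots> = walk a (Suc m) (\<lambda>x. walk a n (\<lambda>y. f (x + y)))"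
    unfolding Suc by (simp add: algebra_simps)
  finally show ?case .
qed simp

lemma walk_nonneg:
  assumes "0 \<le> a" "a \<le> 1" "\<And>x. 0 \<le> f x"
  shows "0 \<le> walk a n f"
  using assms(3) by (induction n arbitrary: f) (use assms(1,2) in auto)

definition walk_pow :: "real \<Rightarrow> nat \<Rightarrow> nat \<Rightarrow> real" where
  "walk_pow a m n = walk a n (\<lambda>x. x ^ m)"

lemma walk_pow_0 [simp]: "walk_pow a 0 n = 1"
  by (simp add: walk_pow_def walk_one)

lemma walk_pow_steps_0 [simp]: "walk_pow a m 0 = 0 ^ m"
  by (simp add: walk_pow_def)

lemma walk_pow_plus:
  "walk_pow a m (j + n) =
     (\<Sum>l\<le>m. real (m choose l) * walk_pow a l j * walk_pow a (m - l) n)"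
  unfolding walk_pow_def walk_plus binomial_ring
  by (simp add: walk_sum walk_cmult mult.assoc,
      simp add: mult.left_commute[of "_ ^ _"] walk_cmult mult.commute[of "_ ^ _" "walk _ _ _"],
      simp add: mult.commute[of "walk a n _" "walk a j _"])

lemma walk_pow_one: "walk_pow a m 1 = (if m = 0 then 1 else if even m then a else 0)"
  by (simp add: walk_pow_def zero_power)

lemma walk_pow_odd: "odd m \<Longrightarrow> walk_pow a m n = 0"
proof (induction n arbitrary: m)
  case (Suc n)
  have "walk_pow a m (n + 1) = 0"
    unfolding walk_pow_plus walk_pow_one
    by (intro sum.neutral ballI) (use Suc in auto)
  then show ?case by simp
qed (simp add: zero_power odd_pos)

text \<open>The quotient \<open>fact (2 * k) / (2 ^ k * fact k)\<close> is (2k-1)!!, an even moment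
  of N(0, 1); thus the even moments of one step, all equal to a, do not exceed those of N(0, a).
  Passing from k to k + 1 multiplies the right side by a (2k+1), which is at least 1 because a \<ge>
  1/2.\<close>

lemma fact_double_bound:
  assumes "1/2 \<le> a" "a \<le> 1" "k > 0"
  shows "a \<le> a ^ k * fact (2 * k) / (2 ^ k * fact k :: real)"
proof -
  have "a ^ k * fact (2 * k) / (2 ^ k * fact k :: real) \<ge> a" if "k = Suc j" for j
    unfolding that
  proof (induction j)
    case 0
    then show ?case by (simp add: numeral_2_eq_2)
  next
    case (Suc j)
    have f: "fact (2 * Suc (Suc j)) = (real (2 * j + 4)) * (real (2 * j + 3)) * fact (2 * Suc j)"
      by (simp add: algebra_simps)
    have "a ^ Suc (Suc j) * fact (2 * Suc (Suc j)) / (2 ^ Suc (Suc j) * fact (Suc (Suc j)) :: real)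
       = (a * (2 * real j + 3)) * (a ^ Suc j * fact (2 * Suc j) / (2 ^ Suc j * fact (Suc j)))"
      unfolding f by (simp add: field_simps del: of_nat_Suc fact_Suc)
         (simp add: fact_Suc[of "Suc j"] algebra_simps)
    also have "\<dots> \<ge> 1 * (a ^ Suc j * fact (2 * Suc j) / (2 ^ Suc j * fact (Suc j)))"
    proof (rule mult_right_mono)
      have "1/2 * 3 \<le> a * (2 * real j + 3)"
        using assms by (intro mult_mono) auto
      then show "1 \<le> a * (2 * real j + 3)" by simp
    qed (use assms in auto)
    finally show ?case using Suc by linarith
  qed
  then show ?thesis using assms by (metis gr0_implies_Suc)
qed

lemma sum_even_indices:
  fixes f :: "nat \<Rightarrow> real"
  assumes "\<And>l. odd l \<Longrightarrow> f l = 0"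
  shows "(\<Sum>l\<le>2 * k. f l) = (\<Sum>i\<le>k. f (2 * i))"
proof -
  have "(\<Sum>l\<le>2 * k. f l) = (\<Sum>l\<in>(\<lambda>i. 2 * i) ` {..k}. f l)"
  proof (intro sum.mono_neutral_right ballI)
    fix l assume l: "l \<in> {..2 * k} - (\<lambda>i. 2 * i) ` {..k}"
    have "odd l"
    proof
      assume "even l"
      then obtain i where "l = 2 * i" by (elim evenE)
      with l show False by auto
    qed
    then show "f l = 0" by (rule assms)
  qed auto
  then show ?thesis by (simp add: sum.reindex inj_on_def)
qed

text \<open>Each step has even moments below those of the Gaussian of the same variance.\<close>

lemma walk_pow_le:
  assumes "1/2 \<le> a" "a \<le> 1"
  shows "walk_pow a (2 * k) n \<le> (a * n) ^ k * fact (2 * k) / (2 ^ k * fact k)"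
proof (induction n arbitrary: k)
  case 0
  then show ?case by (cases "k = 0") (auto simp: zero_power)
next
  case (Suc n)
  define G :: "nat \<Rightarrow> real" where "G k = fact (2 * k) / (2 ^ k * fact k)" for k
  have "walk_pow a (2 * k) (n + 1) =
     (\<Sum>i\<le>k. real (2 * k choose (2 * i)) * walk_pow a (2 * i) n * walk_pow a (2 * k - 2 * i) 1)"
    unfolding walk_pow_plus by (subst sum_even_indices) (auto simp: walk_pow_odd)
  also have "\<dots> \<le> (\<Sum>i\<le>k. real (2 * k choose (2 * i)) * ((a * n) ^ i * G i) * (a ^ (k - i) * G (k - i)))"
  proof (intro sum_mono mult_mono)
    fix i assume "i \<in> {..k}"
    show "walk_pow a (2 * i) n \<le> (a * n) ^ i * G i"
      using Suc[of i] by (simp add: G_def)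
    show "walk_pow a (2 * k - 2 * i) 1 \<le> a ^ (k - i) * G (k - i)"
      using fact_double_bound[OF assms, of "k - i"] \<open>i \<in> {..k}\<close>
      by (cases "i = k") (auto simp: walk_pow_one G_def simp del: One_nat_def)
    show "0 \<le> walk_pow a (2 * k - 2 * i) 1"
      using assms by (auto simp: walk_pow_one simp del: One_nat_def)
    show "0 \<le> walk_pow a (2 * i) n"
      using walk_nonneg[of a "\<lambda>x. x ^ (2 * i)" n] assms by (simp add: walk_pow_def)
  qed (use assms in \<open>auto simp: G_def\<close>)
  \<comment> \<open>C(2k, 2i) (2i-1)!! (2k-2i-1)!! = (2k-1)!! C(k, i): the identity behind the
    stability of Gaussian moments under convolution.\<close>
  also have "\<dots> = (\<Sum>i\<le>k. G k * a ^ k * (real (k choose i) * real n ^ i))"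
  proof (intro sum.cong refl)
    fix i assume "i \<in> {..k}"
    then have i: "i \<le> k" by simp
    then have i': "2 * i \<le> 2 * k" "2 * k - 2 * i = 2 * (k - i)" by auto
    have p: "a ^ k = a ^ i * a ^ (k - i)" "(2::real) ^ k = 2 ^ i * 2 ^ (k - i)"
      using i by (simp_all flip: power_add)
    show "real (2 * k choose (2 * i)) * ((a * n) ^ i * G i) * (a ^ (k - i) * G (k - i))
        = G k * a ^ k * (real (k choose i) * real n ^ i)"
      unfolding binomial_fact[OF i'(1)] binomial_fact[OF i] G_def p i'(2)
      by (simp add: power_mult_distrib mult_ac)
  qed
  also have "\<dots> = G k * (a ^ k * (real n + 1) ^ k)"
    unfolding binomial_ring[of "real n" 1] by (simp add: sum_distrib_left mult.assoc)
  also have "a ^ k * (real n + 1) ^ k = (a * real (Suc n)) ^ k"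
    by (simp add: power_mult_distrib add.commute)
  finally show ?case by (simp add: G_def mult.commute)
qed

lemma walk_pow_2: "walk_pow a 2 n = a * n"
proof (induction n)
  case (Suc n)
  have "walk_pow a 2 (n + 1) = (\<Sum>l\<le>2. real (2 choose l) * walk_pow a l n * walk_pow a (2 - l) 1)"
    by (rule walk_pow_plus)
  also have "\<dots> = a * n + a"
    using walk_pow_odd[of 1] walk_pow_one[of a 2] Suc by (simp add: numeral_2_eq_2)
  finally show ?case by (simp add: algebra_simps)
qed simp

section \<open>The hierarchical law of a block\<close>

lemma (in comm_monoid_set) blocks:
  fixes g :: "nat \<Rightarrow> 'a"
  shows "F g {..<n * m} = F (\<lambda>c. F (\<lambda>r. g (c * m + r)) {..<m}) {..<n}"
proof -
  have "F g {c * m..<c * m + m} = F (\<lambda>r. g (c * m + r)) {..<m}" for c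
    using shift_bounds_nat_ivl[of g 0 "c * m" m] by (simp add: atLeast0LessThan add.commute)
  then show ?thesis by (simp add: nat_group[symmetric])
qed

lemma length_concat_words: "xs \<in> words (words A m) n \<Longrightarrow> length (concat xs) = n * m"
proof (induction xs arbitrary: n)
  case (Cons x xs)
  then obtain n' where "n = Suc n'" by (cases n) (auto simp: words_def)
  with Cons show ?case by (auto simp: words_def)
qed (auto simp: words_def)

lemma concat_words: "xs \<in> words (words A m) n \<Longrightarrow> concat xs \<in> words A (n * m)"
  using length_concat_words[of xs A m n] by (fastforce simp: words_def)

lemma nth_concat_words:
  assumes "xs \<in> words (words A m) n" "c < n" "r < m"
  shows "concat xs ! (c * m + r) = xs ! c ! r"
  using assms
proof (induction xs arbitrary: n c)
  case (Cons x xs)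
  then obtain n' where n': "n = Suc n'" "length x = m" "xs \<in> words (words A m) n'"
    by (cases n) (auto simp: words_def)
  show ?case
  proof (cases c)
    case 0
    then show ?thesis using Cons.prems n' by (simp add: nth_append)
  next
    case (Suc d)
    then show ?thesis using Cons.IH[of n' d] Cons.prems n'
      by (simp add: nth_append add.assoc)
  qed
qed (auto simp: words_def)

lemma block_index_less: "c < n \<Longrightarrow> r < m \<Longrightarrow> c * m + r < n * (m::nat)"
  by (metis add.commute add_less_cancel_left less_le_trans mult_Suc mult_le_mono1 Suc_leI)

lemma sum_list_concat: "sum_list (concat xs) = (\<Sum>c<length xs. sum_list (xs ! c :: real list))"
  by (induction xs) (simp_all add: sum.lessThan_Suc_shift del: sum.lessThan_Suc)

lemma sum_list_uminus: "sum_list (map uminus x) = - sum_list (x :: real list)"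
  by (induction x) auto

abbreviation signs :: "real set" where "signs \<equiv> {-1, 1}"

text \<open>The factor lies between 0 and 2. Since \<open>sgn 0 = 0\<close>, it equals 1 as soon as
  one of the blocks has sum zero.\<close>

primrec block_mean :: "nat \<Rightarrow> nat \<Rightarrow> (real list \<Rightarrow> real) \<Rightarrow> real" where
  "block_mean L 0 f = (f [1] + f [-1]) / 2"
| "block_mean L (Suc j) f =
     iter (block_mean L j) L (\<lambda>xs. f (concat xs) * (1 - (\<Prod>c<L. sgn (sum_list (xs ! c)))))"

text \<open>As L is even, L-th powers are nonnegative and the sign product survives a global change
  of sign. The condition h \<ge> 3 places the fourth moment below order L, where it agrees with that
  of independent signs.\<close>

locale hierarchy =
  fixes L :: nat and h :: nat
  assumes L: "L = 2 * h" and h: "h \<ge> 3"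
begin

abbreviation E :: "nat \<Rightarrow> (real list \<Rightarrow> real) \<Rightarrow> real" where "E \<equiv> block_mean L"
abbreviation Wd :: "nat \<Rightarrow> real list set" where "Wd j \<equiv> words signs (L ^ j)"

lemma L_pos: "L > 0" using L h by simp

abbreviation sg :: "real list \<Rightarrow> real" where "sg x \<equiv> sgn (sum_list x)"

lemma sg_abs_prod_le: "\<bar>\<Prod>c<n. sg (xs ! c)\<bar> \<le> 1"
  unfolding abs_prod by (intro prod_le_1) (auto simp: sgn_if)

text \<open>The two claims need a joint induction: total mass 1 at level j + 1 requires
  \<open>sg\<close> to have mean zero at level j, which follows from the symmetry there; the
  symmetry moves up because an even number of signs is reversed.\<close>

lemma mean_and_flip: "mean_on (Wd j) (E j) \<and> (\<forall>f. E j (\<lambda>x. f (map uminus x)) = E j f)"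
proof (induction j)
  case 0
  have "[1] \<in> Wd 0" "[-1] \<in> Wd 0" by (auto simp: words_def)
  then show ?case
    by (auto simp: mean_on_def add_divide_distrib[symmetric] algebra_simps
             intro!: divide_right_mono add_mono)
next
  case (Suc j)
  then have m: "mean_on (Wd j) (E j)" and flip: "\<And>f. E j (\<lambda>x. f (map uminus x)) = E j f"
    by auto
  note it = mean_on_iter[OF m, of L]
  have "E j sg = - E j sg"
    using flip[of sg] by (simp add: sum_list_uminus sgn_minus mean_minus[OF m])
  then have sg0: "E j sg = 0" by simp
  have "mean_on (Wd (Suc j)) (E (Suc j))"
    unfolding mean_on_def
  proof (intro conjI allI impI)
    fix f g :: "real list \<Rightarrow> real"
    assume "\<forall>x\<in>Wd (Suc j). f x \<le> g x"
    then show "E (Suc j) f \<le> E (Suc j) g"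
      unfolding block_mean.simps
      by (intro mean_mono[OF it] mult_right_mono)
         (use concat_words[of _ signs "L ^ j" L] sg_abs_prod_le[of _ L] in \<open>auto simp: abs_le_iff\<close>)
  next
    show "E (Suc j) (\<lambda>_. 1) = 1"
      using iter_prod[OF m, of L "\<lambda>_. sg"] L_pos
      by (simp add: mean_diff[OF it] mean_const[OF it] sg0)
  qed (simp_all add: distrib_right mean_add[OF it] mult.assoc mean_cmult[OF it])
  moreover have "E (Suc j) (\<lambda>x. f (map uminus x)) = E (Suc j) f" for f
  proof -
    define G where "G xs = f (concat xs) * (1 - (\<Prod>c<L. sg (xs ! c)))" for xs
    have "E (Suc j) (\<lambda>x. f (map uminus x)) = iter (E j) L (\<lambda>xs. G (map (map uminus) xs))"
      unfolding block_mean.simps G_def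
    proof (rule mean_cong[OF it])
      fix xs :: "real list list" assume "xs \<in> words (Wd j) L"
      then have len: "length xs = L" by (simp add: words_def)
      have "(\<Prod>c<L. sg (map (map uminus) xs ! c)) = (\<Prod>c<L. - sg (xs ! c))"
        by (intro prod.cong refl) (simp add: len sum_list_uminus sgn_minus)
      also have "\<dots> = (\<Prod>c<L. (-1) * sg (xs ! c))" by simp
      also have "\<dots> = (\<Prod>c<L. sg (xs ! c))"
        unfolding prod.distrib by (simp add: L)
      finally show "f (map uminus (concat xs)) * (1 - (\<Prod>c<L. sg (xs ! c)))
          = f (concat (map (map uminus) xs)) * (1 - (\<Prod>c<L. sg (map (map uminus) xs ! c)))"
        by (simp add: map_concat)
    qed
    also have "\<dots> = iter (E j) L G" by (rule iter_map[OF flip])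
    finally show ?thesis by (simp add: G_def[abs_def])
  qed
  ultimately show ?case by blast
qed

lemma mean_E: "mean_on (Wd j) (E j)"
  and E_flip: "E j (\<lambda>x. f (map uminus x)) = E j f"
  using mean_and_flip by auto

lemma mean_children: "mean_on (words (Wd j) n) (iter (E j) n)"
  by (rule mean_on_iter[OF mean_E])

lemma E_sg: "E j sg = 0"
  using E_flip[of j sg] by (simp add: sum_list_uminus sgn_minus mean_minus[OF mean_E])

lemma finite_Wd: "finite (Wd j)"
  by (simp add: finite_words)

lemma sum_list_Wd: "x \<in> Wd j \<Longrightarrow> sum_list x = (\<Sum>i<L ^ j. x ! i)"
  by (simp add: words_def sum_list_sum_nth atLeast0LessThan)

text \<open>The density splits into 1, which gives independent blocks, and the sign product, which
  carries all the dependence. The later computations treat the two parts separately.\<close>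

lemma E_Suc_concat:
  assumes "\<And>xs. xs \<in> words (Wd j) L \<Longrightarrow> f (concat xs) = g xs"
  shows "E (Suc j) f = iter (E j) L g - iter (E j) L (\<lambda>xs. g xs * (\<Prod>c<L. sg (xs ! c)))"
  unfolding block_mean.simps mean_diff[OF mean_children, symmetric]
  by (rule mean_cong[OF mean_children]) (simp add: assms algebra_simps)

lemma E_Suc_prod:
  assumes "\<And>xs. xs \<in> words (Wd j) L \<Longrightarrow> f (concat xs) = (\<Prod>c<L. g c (xs ! c))"
  shows "E (Suc j) f = (\<Prod>c<L. E j (g c)) - (\<Prod>c<L. E j (\<lambda>x. g c x * sg x))"
  using E_Suc_concat[of j f "\<lambda>xs. \<Prod>c<L. g c (xs ! c)", OF assms]
    iter_prod[OF mean_E, of j L "\<lambda>c x. g c x * sg x"]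
  by (simp add: iter_prod[OF mean_E] prod.distrib)

text \<open>The blocks are symmetric under a transitive group of permutations of the
  coordinates, so no coordinate is preferred by a function of the block sum.\<close>

lemma E_coordinate:
  assumes "r < L ^ j"
  shows "E j (\<lambda>x. x ! r * K (sum_list x)) = E j (\<lambda>x. x ! 0 * K (sum_list x))"
  using assms
proof (induction j arbitrary: r K)
  case (Suc j)
  obtain n where n: "L = Suc n" using L_pos by (cases L) auto
  \<comment> \<open>Averaging over the other n blocks leaves a function of the sum of the block that
    holds the coordinate; hence the induction has to run over all \<open>K\<close>.\<close>
  define K' where "K' s = iter (E j) n (\<lambda>xs. K (s + (\<Sum>i<n. sum_list (xs ! i)))
      * (1 - sgn s * (\<Prod>i<n. sg (xs ! i))))" for s
  have *: "E (Suc j) (\<lambda>x. x ! (c * L ^ j + r) * K (sum_list x)) = E j (\<lambda>x. x ! r * K' (sum_list x))"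
    if "c < L" "r < L ^ j" for c r
  proof -
    have "E (Suc j) (\<lambda>x. x ! (c * L ^ j + r) * K (sum_list x))
      = iter (E j) (Suc n) (\<lambda>xs. xs ! c ! r * (K (\<Sum>i\<le>n. sum_list (xs ! i)) * (1 - (\<Prod>i\<le>n. sg (xs ! i)))))"
      unfolding block_mean.simps n[symmetric]
    proof (rule mean_cong[OF mean_children])
      fix xs assume xs: "xs \<in> words (Wd j) L"
      then have "length xs = L" by (simp add: words_def)
      with xs that show "concat xs ! (c * L ^ j + r) * K (sum_list (concat xs)) * (1 - (\<Prod>c<L. sg (xs ! c)))
         = xs ! c ! r * (K (\<Sum>i\<le>n. sum_list (xs ! i)) * (1 - (\<Prod>i\<le>n. sg (xs ! i))))"
        by (simp add: nth_concat_words sum_list_concat n lessThan_Suc_atMost)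
    qed
    also have "\<dots> = E j (\<lambda>x. x ! r * K' (sum_list x))"
      using that n
      by (subst iter_move[OF mean_E finite_Wd, where F = "\<lambda>a b. K a * (1 - b)"]) (simp_all add: K'_def)
    finally show ?thesis .
  qed
  define c where "c = r div L ^ j"
  have r: "c * L ^ j + r mod L ^ j = r" "c < L" "r mod L ^ j < L ^ j"
    using Suc.prems L_pos by (auto simp: c_def less_mult_imp_div_less div_mult_mod_eq)
  have "E (Suc j) (\<lambda>x. x ! r * K (sum_list x)) = E j (\<lambda>x. x ! (r mod L ^ j) * K' (sum_list x))"
    using *[OF r(2,3)] by (simp add: r(1))
  also have "\<dots> = E j (\<lambda>x. x ! 0 * K' (sum_list x))"
    by (rule Suc.IH) (rule r(3))
  also have "\<dots> = E (Suc j) (\<lambda>x. x ! 0 * K (sum_list x))"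
    using *[of 0 0] L_pos by simp
  finally show ?case .
qed simp

text \<open>Write |W| as the sum of the x_r sgn W; by \<open>E_coordinate\<close> all L ^ j terms
  have the same mean.\<close>

lemma E_coordinate_sg:
  assumes "r < L ^ j"
  shows "E j (\<lambda>x. x ! r * sg x) = E j (\<lambda>x. \<bar>sum_list x\<bar>) / L ^ j"
proof -
  have "E j (\<lambda>x. \<bar>sum_list x\<bar>) = E j (\<lambda>x. \<Sum>r<L ^ j. x ! r * sg x)"
    by (rule mean_cong[OF mean_E])
       (simp add: sum_list_Wd abs_sgn flip: sum_distrib_right)
  also have "\<dots> = L ^ j * E j (\<lambda>x. x ! 0 * sg x)"
    using E_coordinate[of _ j sgn] by (simp add: mean_sum[OF mean_E])
  also have "E j (\<lambda>x. x ! 0 * sg x) = E j (\<lambda>x. x ! r * sg x)"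
    using E_coordinate[OF assms, of sgn] by simp
  finally show ?thesis using L_pos by simp
qed

end

section \<open>Moments of block sums and the loss in the L-th moment\<close>

lemma iter_Suc_binomial:
  assumes E: "mean_on S E"
  shows "iter E (Suc n) (\<lambda>xs. (\<Sum>c<Suc n. s c (xs ! c)) ^ m * (\<Prod>c<Suc n. v (xs ! c))) =
    (\<Sum>l\<le>m. real (m choose l) * E (\<lambda>x. s 0 x ^ l * v x) *
      iter E n (\<lambda>xs. (\<Sum>c<n. s (Suc c) (xs ! c)) ^ (m - l) * (\<Prod>c<n. v (xs ! c))))"
proof -
  note it = mean_on_iter[OF E, of n]
  have "iter E (Suc n) (\<lambda>xs. (\<Sum>c<Suc n. s c (xs ! c)) ^ m * (\<Prod>c<Suc n. v (xs ! c)))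
     = E (\<lambda>x. iter E n (\<lambda>xs. \<Sum>l\<le>m. (real (m choose l) * (s 0 x ^ l * v x)) *
      ((\<Sum>c<n. s (Suc c) (xs ! c)) ^ (m - l) * (\<Prod>c<n. v (xs ! c)))))"
    unfolding iter.simps(2)
    by (simp add: sum.lessThan_Suc_shift prod.lessThan_Suc_shift binomial_ring sum_distrib_right sum_distrib_left mult_ac
        del: sum.lessThan_Suc prod.lessThan_Suc)
  also have "\<dots> = (\<Sum>l\<le>m. real (m choose l) * E (\<lambda>x. s 0 x ^ l * v x) *
      iter E n (\<lambda>xs. (\<Sum>c<n. s (Suc c) (xs ! c)) ^ (m - l) * (\<Prod>c<n. v (xs ! c))))"
    by (simp add: mean_sum[OF it] mean_sum[OF E] mean_cmult[OF it] mean_multc[OF E] mean_cmult[OF E])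
  finally show ?thesis .
qed

lemma iter_power_sum:
  assumes E: "mean_on S E"
    and "\<And>c l. c < n \<Longrightarrow> l \<le> m \<Longrightarrow> E (\<lambda>x. s c x ^ l) = walk_pow a l (k c)"
  shows "iter E n (\<lambda>xs. (\<Sum>c<n. s c (xs ! c)) ^ m) = walk_pow a m (\<Sum>c<n. k c)"
  using assms(2)
proof (induction n arbitrary: s k m)
  case (Suc n)
  have "iter E (Suc n) (\<lambda>xs. (\<Sum>c<Suc n. s c (xs ! c)) ^ m) =
    (\<Sum>l\<le>m. real (m choose l) * E (\<lambda>x. s 0 x ^ l) *
      iter E n (\<lambda>xs. (\<Sum>c<n. s (Suc c) (xs ! c)) ^ (m - l)))"
    using iter_Suc_binomial[OF E, of n s m "\<lambda>_. 1"] by simp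
  also have "\<dots> = (\<Sum>l\<le>m. real (m choose l) * walk_pow a l (k 0) *
      walk_pow a (m - l) (\<Sum>c<n. k (Suc c)))"
    by (intro sum.cong refl arg_cong2[where f = "(*)"] Suc.IH) (simp_all add: Suc.prems)
  also have "\<dots> = walk_pow a m (\<Sum>c<Suc n. k c)"
    unfolding walk_pow_plus[symmetric] by (simp add: sum.lessThan_Suc_shift del: sum.lessThan_Suc)
  finally show ?case .
qed simp

text \<open>In the binomial expansion of the m-th moment of an independent sum, the m-th moments of
  the summands enter linearly with coefficient 1, so the deviations \<open>d c\<close> simply
  add.\<close>

lemma iter_power_sum_defect:
  assumes E: "mean_on S E" and "m > 0"
    and "\<And>c l. c < n \<Longrightarrow> l < m \<Longrightarrow> E (\<lambda>x. s c x ^ l) = walk_pow a l (k c)"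
    and "\<And>c. c < n \<Longrightarrow> E (\<lambda>x. s c x ^ m) = walk_pow a m (k c) - d c"
  shows "iter E n (\<lambda>xs. (\<Sum>c<n. s c (xs ! c)) ^ m) = walk_pow a m (\<Sum>c<n. k c) - (\<Sum>c<n. d c)"
  using assms(3,4)
proof (induction n arbitrary: s k d)
  case (Suc n)
  define K where "K = (\<Sum>c<n. k (Suc c))"
  have *: "iter E n (\<lambda>xs. (\<Sum>c<n. s (Suc c) (xs ! c)) ^ (m - l)) =
      walk_pow a (m - l) K - (if l = 0 then \<Sum>c<n. d (Suc c) else 0)" if "l \<le> m" for l
  proof (cases "l = 0")
    case True
    have "iter E n (\<lambda>xs. (\<Sum>c<n. s (Suc c) (xs ! c)) ^ m) = walk_pow a m K - (\<Sum>c<n. d (Suc c))"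
      unfolding K_def by (rule Suc.IH) (simp_all add: Suc.prems)
    with True show ?thesis by simp
  next
    case False
    then have "m - l < m" using \<open>m > 0\<close> by simp
    then show ?thesis unfolding K_def
      using False by (subst iter_power_sum[OF E, where k = "\<lambda>c. k (Suc c)" and a = a])
        (auto intro!: Suc.prems(1))
  qed
  have e0: "E (\<lambda>x. s 0 x ^ l) = walk_pow a l (k 0) - (if l = m then d 0 else 0)" if "l \<le> m" for l
    using that Suc.prems by (cases "l = m") auto
  have "iter E (Suc n) (\<lambda>xs. (\<Sum>c<Suc n. s c (xs ! c)) ^ m) =
    (\<Sum>l\<le>m. real (m choose l) * E (\<lambda>x. s 0 x ^ l) *
      iter E n (\<lambda>xs. (\<Sum>c<n. s (Suc c) (xs ! c)) ^ (m - l)))"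
    using iter_Suc_binomial[OF E, of n s m "\<lambda>_. 1"] by simp
  also have "\<dots> = (\<Sum>l\<le>m. real (m choose l) * walk_pow a l (k 0) * walk_pow a (m - l) K
      - ((if l = 0 then \<Sum>c<n. d (Suc c) else 0) + (if l = m then d 0 else 0)))"
  proof (intro sum.cong refl)
    fix l assume l: "l \<in> {..m}"
    consider "l = 0" | "l = m" | "0 < l" "l < m" using l by fastforce
    then show "real (m choose l) * E (\<lambda>x. s 0 x ^ l) *
      iter E n (\<lambda>xs. (\<Sum>c<n. s (Suc c) (xs ! c)) ^ (m - l)) =
      real (m choose l) * walk_pow a l (k 0) * walk_pow a (m - l) K
      - ((if l = 0 then \<Sum>c<n. d (Suc c) else 0) + (if l = m then d 0 else 0))"
      using *[of l] e0[of l] l \<open>m > 0\<close> by cases simp_all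
  qed
  also have "\<dots> = walk_pow a m (k 0 + K) - ((\<Sum>c<n. d (Suc c)) + d 0)"
    unfolding walk_pow_plus sum_subtractf by (simp add: sum.distrib)
  also have "\<dots> = walk_pow a m (\<Sum>c<Suc n. k c) - (\<Sum>c<Suc n. d c)"
    by (simp add: sum.lessThan_Suc_shift K_def del: sum.lessThan_Suc)
  finally show ?case .
qed (use \<open>m > 0\<close> in simp)

text \<open>A monomial that misses some c contains the factor \<open>E v\<close> = 0. With m \<le> n
  factors, each c can be hit only when m = n and every exponent is 1; this monomial has coefficient
  n!.\<close>

lemma iter_power_sum_sgn:
  assumes E: "mean_on S E" and "E v = 0" and "m \<le> n"
  shows "iter E n (\<lambda>xs. (\<Sum>c<n. s c (xs ! c)) ^ m * (\<Prod>c<n. v (xs ! c)))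
     = (if m = n then fact n * (\<Prod>c<n. E (\<lambda>x. s c x * v x)) else 0)"
  using \<open>m \<le> n\<close>
proof (induction n arbitrary: s m)
  case (Suc n)
  have "iter E (Suc n) (\<lambda>xs. (\<Sum>c<Suc n. s c (xs ! c)) ^ m * (\<Prod>c<Suc n. v (xs ! c))) =
    (\<Sum>l\<le>m. real (m choose l) * E (\<lambda>x. s 0 x ^ l * v x) *
      iter E n (\<lambda>xs. (\<Sum>c<n. s (Suc c) (xs ! c)) ^ (m - l) * (\<Prod>c<n. v (xs ! c))))"
    by (rule iter_Suc_binomial[OF E])
  also have "\<dots> = (\<Sum>l\<le>m. if l = 1 \<and> m = Suc n then
      real m * E (\<lambda>x. s 0 x * v x) * (fact n * (\<Prod>c<n. E (\<lambda>x. s (Suc c) x * v x))) else 0)"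
  proof (intro sum.cong refl)
    fix l assume "l \<in> {..m}"
    then show "real (m choose l) * E (\<lambda>x. s 0 x ^ l * v x) *
      iter E n (\<lambda>xs. (\<Sum>c<n. s (Suc c) (xs ! c)) ^ (m - l) * (\<Prod>c<n. v (xs ! c)))
      = (if l = 1 \<and> m = Suc n then
      real m * E (\<lambda>x. s 0 x * v x) * (fact n * (\<Prod>c<n. E (\<lambda>x. s (Suc c) x * v x))) else 0)"
    proof (cases "l = 0")
      case False
      have "m - l \<le> n" using False Suc.prems by simp
      from Suc.IH[OF this, of "\<lambda>c. s (Suc c)"]
      have "iter E n (\<lambda>xs. (\<Sum>c<n. s (Suc c) (xs ! c)) ^ (m - l) * (\<Prod>c<n. v (xs ! c)))
          = (if m - l = n then fact n * (\<Prod>c<n. E (\<lambda>x. s (Suc c) x * v x)) else 0)" .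
      moreover have "m - l = n \<longleftrightarrow> l = 1 \<and> m = Suc n"
        using False Suc.prems \<open>l \<in> {..m}\<close> by auto
      ultimately show ?thesis by auto
    qed (simp add: \<open>E v = 0\<close>)
  qed
  also have "\<dots> = (if m = Suc n then fact (Suc n) * (\<Prod>c<Suc n. E (\<lambda>x. s c x * v x)) else 0)"
    by (simp add: prod.lessThan_Suc_shift mult_ac del: prod.lessThan_Suc)
  finally show ?case .
qed simp

definition dsum :: "nat set \<Rightarrow> real list \<Rightarrow> real" where
  "dsum D x = (\<Sum>i\<in>D. x ! i)"

definition slice :: "nat \<Rightarrow> nat set \<Rightarrow> nat \<Rightarrow> nat set" where
  "slice m D c = {r. r < m \<and> c * m + r \<in> D}"

lemma slice_subset [simp]: "slice m D c \<subseteq> {..<m}"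
  by (auto simp: slice_def)

lemma sum_slices:
  fixes f :: "nat \<Rightarrow> 'a::semiring_1"
  assumes "D \<subseteq> {..<n * m}"
  shows "(\<Sum>i\<in>D. f i) = (\<Sum>c<n. \<Sum>r\<in>slice m D c. f (c * m + r))"
proof -
  have "(\<Sum>i\<in>D. f i) = (\<Sum>i<n * m. if i \<in> D then f i else 0)"
    using assms by (simp add: sum.If_cases Int_absorb1)
  also have "\<dots> = (\<Sum>c<n. \<Sum>r<m. if c * m + r \<in> D then f (c * m + r) else 0)"
    by (rule sum.blocks)
  also have "\<dots> = (\<Sum>c<n. \<Sum>r\<in>slice m D c. f (c * m + r))"
  proof (rule sum.cong[OF refl])
    fix c
    show "(\<Sum>r<m. if c * m + r \<in> D then f (c * m + r) else 0)
        = (\<Sum>r\<in>slice m D c. f (c * m + r))"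
      using sum.inter_filter[of "{..<m}" "\<lambda>r. f (c * m + r)" "\<lambda>r. c * m + r \<in> D"]
      by (simp add: slice_def)
  qed
  finally show ?thesis .
qed

lemma card_slices:
  assumes "D \<subseteq> {..<n * m}"
  shows "card D = (\<Sum>c<n. card (slice m D c))"
  using sum_slices[OF assms, of "\<lambda>_. 1 :: nat"] by simp

context hierarchy
begin

lemma even_L: "even L"
  by (simp add: L)

lemma L_gt_1: "1 < L"
  using L h by simp

lemma dsum_concat:
  assumes "xs \<in> words (Wd j) L" "D \<subseteq> {..<L * L ^ j}"
  shows "dsum D (concat xs) = (\<Sum>c<L. dsum (slice (L ^ j) D c) (xs ! c))"
  unfolding dsum_def sum_slices[OF assms(2)]
  by (intro sum.cong refl) (use assms(1) nth_concat_words in \<open>auto simp: slice_def\<close>)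

lemma E_dsum_power_Suc:
  assumes "D \<subseteq> {..<L ^ Suc j}"
  shows "E (Suc j) (\<lambda>x. dsum D x ^ m) =
    iter (E j) L (\<lambda>xs. (\<Sum>c<L. dsum (slice (L ^ j) D c) (xs ! c)) ^ m) -
    iter (E j) L (\<lambda>xs. (\<Sum>c<L. dsum (slice (L ^ j) D c) (xs ! c)) ^ m * (\<Prod>c<L. sg (xs ! c)))"
  by (rule E_Suc_concat) (use dsum_concat assms in auto)

lemma children_sg:
  assumes "m \<le> L"
  shows "iter (E j) L (\<lambda>xs. (\<Sum>c<L. s c (xs ! c)) ^ m * (\<Prod>c<L. sg (xs ! c)))
     = (if m = L then fact L * (\<Prod>c<L. E j (\<lambda>x. s c x * sg x)) else 0)"
  using iter_power_sum_sgn[of "Wd j" "E j" sg m L s] mean_E E_sg assms by blast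

text \<open>Below order L the sign product contributes nothing, so the moments of independent signs
  are inherited from level to level.\<close>

lemma E_dsum_power:
  assumes "m < L" "D \<subseteq> {..<L ^ j}"
  shows "E j (\<lambda>x. dsum D x ^ m) = walk_pow 1 m (card D)"
  using assms
proof (induction j arbitrary: m D)
  case 0
  then consider "D = {}" | "D = {0}" by force
  then show ?case
    using walk_pow_one[of 1 m] by cases (auto simp: dsum_def uminus_power_if zero_power)
next
  case (Suc j)
  have "iter (E j) L (\<lambda>xs. (\<Sum>c<L. dsum (slice (L ^ j) D c) (xs ! c)) ^ m) = walk_pow 1 m (card D)"
    unfolding card_slices[of D L "L ^ j", OF Suc.prems(2)[unfolded power_Suc]]
  proof (rule iter_power_sum[OF mean_E])
    fix c l assume "c < L" "l \<le> m"
    then have "l < L" using Suc.prems by simp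
    then show "E j (\<lambda>x. dsum (slice (L ^ j) D c) x ^ l)
        = walk_pow 1 l (card (slice (L ^ j) D c))"
      by (rule Suc.IH) simp
  qed
  moreover have "iter (E j) L (\<lambda>xs. (\<Sum>c<L. dsum (slice (L ^ j) D c) (xs ! c)) ^ m
      * (\<Prod>c<L. sg (xs ! c))) = 0"
    using children_sg[of m j "\<lambda>c. dsum (slice (L ^ j) D c)"] Suc.prems(1) by simp
  ultimately show ?case by (simp only: E_dsum_power_Suc[OF Suc.prems(2)])
qed

definition abs_mean :: "nat \<Rightarrow> real" where
  "abs_mean j = E j (\<lambda>x. \<bar>sum_list x\<bar>)"

lemma abs_mean_nonneg: "abs_mean j \<ge> 0"
  unfolding abs_mean_def by (rule mean_nonneg[OF mean_E]) simp

lemma dsum_full: "x \<in> Wd j \<Longrightarrow> dsum {..<L ^ j} x = sum_list x"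
  by (simp add: dsum_def sum_list_Wd)

lemma E_dsum_sg:
  assumes "D \<subseteq> {..<L ^ j}"
  shows "E j (\<lambda>x. dsum D x * sg x) = card D * abs_mean j / L ^ j"
proof -
  have "E j (\<lambda>x. dsum D x * sg x) = (\<Sum>r\<in>D. E j (\<lambda>x. x ! r * sg x))"
    unfolding dsum_def sum_distrib_right by (rule mean_sum[OF mean_E])
  also have "\<dots> = (\<Sum>r\<in>D. abs_mean j / L ^ j)"
    using assms by (intro sum.cong refl) (auto simp: E_coordinate_sg abs_mean_def)
  finally show ?thesis by simp
qed

text \<open>Index sets, not just whole blocks, are needed because a window cuts the blocks at its
  two ends.\<close>

definition defect :: "nat \<Rightarrow> nat set \<Rightarrow> real" where
  "defect j D = walk_pow 1 L (card D) - E j (\<lambda>x. dsum D x ^ L)"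

lemma defect_0: "D \<subseteq> {..<1} \<Longrightarrow> defect 0 D = 0"
proof -
  assume "D \<subseteq> {..<1}"
  then consider "D = {}" | "D = {0}" by force
  then show ?thesis
    using walk_pow_one[of 1 L] L_pos even_L by cases (auto simp: defect_def dsum_def)
qed

text \<open>The losses of the children add, and the sign product contributes the multilinear term,
  in which a child met in t coordinates has the factor t E|W| / L ^ j. Both contributions are
  nonnegative, so a loss once created persists.\<close>

lemma defect_Suc:
  assumes "D \<subseteq> {..<L ^ Suc j}"
  shows "defect (Suc j) D = (\<Sum>c<L. defect j (slice (L ^ j) D c))
     + fact L * (\<Prod>c<L. card (slice (L ^ j) D c) * abs_mean j / L ^ j)"
proof -
  have D: "D \<subseteq> {..<L * L ^ j}" using assms by simp
  have "iter (E j) L (\<lambda>xs. (\<Sum>c<L. dsum (slice (L ^ j) D c) (xs ! c)) ^ L) =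
      walk_pow 1 L (card D) - (\<Sum>c<L. defect j (slice (L ^ j) D c))"
    unfolding card_slices[OF D]
  proof (rule iter_power_sum_defect[OF mean_E L_pos])
    fix c l assume "l < L"
    then show "E j (\<lambda>x. dsum (slice (L ^ j) D c) x ^ l)
        = walk_pow 1 l (card (slice (L ^ j) D c))"
      by (rule E_dsum_power) simp
  qed (simp add: defect_def)
  moreover have "iter (E j) L (\<lambda>xs. (\<Sum>c<L. dsum (slice (L ^ j) D c) (xs ! c)) ^ L
      * (\<Prod>c<L. sg (xs ! c))) = fact L * (\<Prod>c<L. card (slice (L ^ j) D c) * abs_mean j / L ^ j)"
    using children_sg[of L j "\<lambda>c. dsum (slice (L ^ j) D c)"] by (simp add: E_dsum_sg)
  ultimately show ?thesis
    unfolding defect_def[of "Suc j"] E_dsum_power_Suc[OF assms] by simp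
qed

lemma defect_nonneg: "D \<subseteq> {..<L ^ j} \<Longrightarrow> defect j D \<ge> 0"
proof (induction j arbitrary: D)
  case (Suc j)
  show ?case unfolding defect_Suc[OF Suc.prems]
    by (intro add_nonneg_nonneg sum_nonneg mult_nonneg_nonneg prod_nonneg ballI Suc.IH slice_subset)
       (auto simp: abs_mean_nonneg)
qed (use defect_0 in auto)

text \<open>The second moment is N = L ^ j and the fourth is at most 3 N^2, as for independent
  signs; a variable with such moments cannot have a small first absolute moment.\<close>

lemma abs_mean_ge: "sqrt (L ^ j) / 8 \<le> abs_mean j"
proof -
  define N :: real where "N = L ^ j"
  have N: "N > 0" using L_pos by (simp add: N_def)
  \<comment> \<open>With T^2 = 4 N the fourth-moment term of \<open>pw\<close> costs at most 3 N /
    4, which leaves N / 4 \<le> 2 sqrt(N) E|W|.\<close>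
  define T where "T = 2 * sqrt N"
  have T: "T > 0" "T\<^sup>2 = 4 * N" using N by (simp_all add: T_def power_mult_distrib)
  have pw: "w\<^sup>2 \<le> T * \<bar>w\<bar> + (1 / T\<^sup>2) * w ^ 4" for w :: real
  proof (cases "\<bar>w\<bar> \<le> T")
    case True
    then have "w\<^sup>2 \<le> T * \<bar>w\<bar>"
      using mult_right_mono[of "\<bar>w\<bar>" T "\<bar>w\<bar>"] by (simp add: power2_eq_square)
    moreover have "0 \<le> (1 / T\<^sup>2) * w ^ 4" by simp
    ultimately show ?thesis by linarith
  next
    case False
    then have "T\<^sup>2 \<le> w\<^sup>2" using T power_mono[of T "\<bar>w\<bar>" 2] by simp
    then have "w\<^sup>2 * T\<^sup>2 \<le> w\<^sup>2 * w\<^sup>2" by (intro mult_left_mono) auto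
    also have "w\<^sup>2 * w\<^sup>2 = w ^ 4" using power_add[of w 2 2] by simp
    finally have "w\<^sup>2 * T\<^sup>2 \<le> w ^ 4" .
    then have "w\<^sup>2 \<le> w ^ 4 / T\<^sup>2" by (rule mult_imp_le_div_pos[rotated]) (use T N in simp)
    then have "w\<^sup>2 \<le> (1 / T\<^sup>2) * w ^ 4" by simp
    moreover have "0 \<le> T * \<bar>w\<bar>" using T by simp
    ultimately show ?thesis by linarith
  qed
  have "E j (\<lambda>x. sum_list x ^ m) = walk_pow 1 m (L ^ j)" if "m < L" for m
  proof -
    have "E j (\<lambda>x. sum_list x ^ m) = E j (\<lambda>x. dsum {..<L ^ j} x ^ m)"
      by (rule mean_cong[OF mean_E]) (simp only: dsum_full)
    also have "\<dots> = walk_pow 1 m (L ^ j)"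
      using E_dsum_power[OF that, of "{..<L ^ j}" j] by simp
    finally show ?thesis .
  qed
  moreover have "walk_pow 1 4 (L ^ j) \<le> 3 * N\<^sup>2"
    using walk_pow_le[of 1 2 "L ^ j"] by (simp add: N_def fact_numeral)
  moreover have "(2::nat) < L" "4 < L" using h L by auto
  ultimately have m2: "E j (\<lambda>x. (sum_list x)\<^sup>2) = N" and m4: "E j (\<lambda>x. sum_list x ^ 4) \<le> 3 * N\<^sup>2"
    by (simp_all only: walk_pow_2) (simp add: N_def)
  have "N \<le> E j (\<lambda>x. T * \<bar>sum_list x\<bar> + (1 / T\<^sup>2) * sum_list x ^ 4)"
    unfolding m2[symmetric] by (rule mean_mono[OF mean_E]) (rule pw)
  also have "\<dots> = T * abs_mean j + (1 / T\<^sup>2) * E j (\<lambda>x. sum_list x ^ 4)"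
    unfolding abs_mean_def mean_add[OF mean_E] mean_cmult[OF mean_E] ..
  also have "\<dots> \<le> T * abs_mean j + (1 / T\<^sup>2) * (3 * N\<^sup>2)"
    using m4 T N by (intro add_left_mono mult_left_mono) auto
  also have "(1 / T\<^sup>2) * (3 * N\<^sup>2) = 3 / 4 * N" 
    unfolding T(2) using N by (simp add: power2_eq_square)
  finally have "N \<le> sqrt N * (8 * abs_mean j)" by (simp add: T_def)
  then have "sqrt N * sqrt N \<le> sqrt N * (8 * abs_mean j)" using N by simp
  then have "sqrt N \<le> 8 * abs_mean j" using N by (simp only: mult_le_cancel_left_pos real_sqrt_gt_0_iff)
  then show ?thesis by (simp add: N_def)
qed

text \<open>Only the newest term of \<open>defect_Suc\<close> is kept, with L! lowered to 1; the 64
  is the square of the 8 in \<open>abs_mean_ge\<close>.\<close>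

lemma defect_full: "defect (Suc i) {..<L ^ Suc i} \<ge> (L ^ i / 64) ^ h"
proof -
  have sec: "slice (L ^ i) {..<L ^ Suc i} c = {..<L ^ i}" if "c < L" for c
    using block_index_less[OF that, of _ "L ^ i"] by (auto simp: slice_def)
  have "(L ^ i / 64) ^ h = (sqrt (L ^ i) / 8) ^ L"
    by (simp add: L power_mult power_divide)
  also have "\<dots> \<le> abs_mean i ^ L" using abs_mean_ge[of i] by (intro power_mono) auto
  also have "\<dots> \<le> fact L * abs_mean i ^ L"
    using mult_right_mono[of 1 "fact L" "abs_mean i ^ L"] abs_mean_nonneg[of i] by simp
  also have "\<dots> = fact L * (\<Prod>c<L. card (slice (L ^ i) {..<L ^ Suc i} c) * abs_mean i / L ^ i)"
    using L_pos by (simp add: sec del: power_Suc)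
  also have "\<dots> \<le> defect (Suc i) {..<L ^ Suc i}"
    unfolding defect_Suc[OF order_refl]
    by (simp add: sum_nonneg defect_nonneg slice_subset)
  finally show ?thesis .
qed

text \<open>All terms of \<open>defect_Suc\<close> are nonnegative, so descending through the tree
  to an aligned block inside \<open>D\<close> keeps the whole loss of that block.\<close>

lemma defect_block:
  assumes "D \<subseteq> {..<L ^ j}" "{b * L ^ Suc i..<b * L ^ Suc i + L ^ Suc i} \<subseteq> D"
  shows "defect j D \<ge> (L ^ i / 64) ^ h"
  using assms
proof (induction j arbitrary: b D)
  case 0
  have "{b * L ^ Suc i..<b * L ^ Suc i + L ^ Suc i} \<subseteq> {..<1}" using 0 by auto
  then have "card {b * L ^ Suc i..<b * L ^ Suc i + L ^ Suc i} \<le> card {..<1::nat}" by (rule card_mono[rotated]) simp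
  then have "L ^ Suc i \<le> 1" by simp
  moreover have "L ^ 1 \<le> L ^ Suc i" using L_pos by (intro power_increasing) auto
  ultimately have "L \<le> 1" by (simp del: power_Suc)
  then show ?case using L_gt_1 by simp
next
  case (Suc j)
  let ?B = "\<lambda>b. {b * L ^ Suc i..<b * L ^ Suc i + L ^ Suc i}"
  have B: "?B b \<subseteq> {..<L ^ Suc j}" using Suc.prems by blast
  have "card (?B b) \<le> card {..<L ^ Suc j}" using B by (intro card_mono) auto
  then have "L ^ Suc i \<le> L ^ Suc j" by simp
  then have ij: "i \<le> j" using power_increasing_iff[of L "Suc i" "Suc j"] L_gt_1 by simp
  show ?case
  proof (cases "i = j")
    case True
    define m where "m = L ^ Suc i"
    have "m > 0" using L_pos by (simp add: m_def)
    then have "b * m + m - 1 \<in> {b * m..<b * m + m}" by auto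
    with B have "b * m + m - 1 < m" using True unfolding m_def by blast
    then have "b = 0" using \<open>m > 0\<close> by (cases b) auto
    then have "{..<L ^ Suc i} \<subseteq> D" using Suc.prems by (auto simp: subset_eq)
    then have "D = {..<L ^ Suc i}" using Suc.prems True by auto
    then show ?thesis using defect_full[of i] True by simp
  next
    case False
    then have ij: "Suc i \<le> j" using ij by simp
    \<comment> \<open>A child contains \<open>q\<close> blocks of level i + 1; the given block is
      number \<open>b'\<close> in child \<open>c\<close>.\<close>
    define q where "q = L ^ (j - Suc i)"
    define c where "c = b div q"
    define b' where "b' = b mod q"
    have q: "L ^ j = q * L ^ Suc i" "q > 0"
      using ij L_pos power_add[of L "j - Suc i" "Suc i"] by (simp_all add: q_def)
    have bq: "b = c * q + b'" "b' < q" using q by (simp_all add: c_def b'_def)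
    have in_child: "b' * L ^ Suc i + t < L ^ j" if "t < L ^ Suc i" for t
      unfolding q by (rule block_index_less) (use bq that in auto)
    have idx: "b * L ^ Suc i + t = c * L ^ j + (b' * L ^ Suc i + t)" for t
      unfolding q bq(1) by (simp add: algebra_simps)
    have "L ^ Suc i > 0" using L_pos by simp
    then have "b * L ^ Suc i \<in> ?B b" by simp
    with B have less: "b * L ^ Suc i < L ^ Suc j" by blast
    have "c * L ^ j \<le> b * L ^ Suc i" using idx[of 0] by linarith
    then have "c * L ^ j < L ^ Suc j" using less by (rule le_less_trans)
    then have "c < L" by simp
    have sub: "?B b' \<subseteq> slice (L ^ j) D c"
    proof
      fix x assume "x \<in> ?B b'"
      then obtain t where t: "x = b' * L ^ Suc i + t" "t < L ^ Suc i"
        using that[of "x - b' * L ^ Suc i"] by auto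
      then have "c * L ^ j + x \<in> ?B b" using idx[of t] by auto
      then show "x \<in> slice (L ^ j) D c"
        using Suc.prems in_child t by (auto simp: slice_def)
    qed
    have "(L ^ i / 64) ^ h \<le> defect j (slice (L ^ j) D c)"
      by (rule Suc.IH[OF slice_subset sub])
    also have "\<dots> \<le> (\<Sum>c<L. defect j (slice (L ^ j) D c))"
      by (rule member_le_sum) (use \<open>c < L\<close> in \<open>auto simp: defect_nonneg slice_subset\<close>)
    also have "\<dots> \<le> defect (Suc j) D"
      unfolding defect_Suc[OF Suc.prems(1)]
      by (simp add: prod_nonneg abs_mean_nonneg)
    finally show ?thesis .
  qed
qed

text \<open>Wherever it starts, a window of length at least 2 L ^ i contains an aligned block of
  length L ^ i. The largest such power is smaller than k by a bounded factor only, so the loss has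
  order k ^ h uniformly in the position.\<close>

lemma defect_window:
  assumes "{P..<P + k} \<subseteq> {..<L ^ j}" "k \<ge> 2 * L"
  shows "defect j {P..<P + k} \<ge> (k / (128 * L\<^sup>2)) ^ h"
proof -
  \<comment> \<open>Maximality gives k < 2 L ^ (i + 1). The defect of a block of level i is bounded
    in terms of L ^ (i - 1), whence the factors L^2 and 128 = 2 * 64.\<close>
  define i where "i = (GREATEST i. 2 * L ^ i \<le> k)"
  have bnd: "i \<le> k" if "2 * L ^ i \<le> k" for i
  proof -
    have "i < L ^ i" using L_gt_1 by (intro power_gt_expt) simp
    then show ?thesis using that by linarith
  qed
  have i: "2 * L ^ i \<le> k" unfolding i_def by (rule GreatestI_nat[of _ 1 k]) (use assms bnd in auto)
  have i1: "1 \<le> i" unfolding i_def by (rule Greatest_le_nat[of _ _ k]) (use assms bnd in auto)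
  have up: "k < 2 * L ^ Suc i"
  proof (rule ccontr)
    assume "\<not> ?thesis"
    then have "Suc i \<le> i" unfolding i_def by (intro Greatest_le_nat[of _ _ k]) (use bnd in auto)
    then show False by simp
  qed
  obtain i' where i': "i = Suc i'" using i1 by (cases i) auto
  define m where "m = L ^ Suc i'"
  have m: "m > 0" "2 * m \<le> k" using L_pos i i' by (auto simp: m_def)
  \<comment> \<open>P / m rounded up: the first aligned block that starts at or after P.\<close>
  define b where "b = (P + m - 1) div m"
  have "P + m - 1 = b * m + (P + m - 1) mod m" by (simp add: b_def)
  moreover have "(P + m - 1) mod m < m" using m by simp
  ultimately have b: "P \<le> b * m" "b * m + m \<le> P + k" using m by linarith+
  have "(k / (128 * L\<^sup>2)) ^ h \<le> (L ^ i' / 64) ^ h"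
  proof (rule power_mono)
    have "real k \<le> real (2 * L ^ Suc i)" using up by linarith
    then show "k / (128 * L\<^sup>2) \<le> L ^ i' / 64"
      using L_pos by (simp add: i' field_simps power2_eq_square)
  qed simp
  also have "\<dots> \<le> defect j {P..<P + k}"
    by (rule defect_block[OF assms(1), of b]) (use b in \<open>auto simp: m_def\<close>)
  finally show ?thesis .
qed

end

section \<open>Windows, small sets of coordinates, and distinct blocks\<close>

definition window :: "nat \<Rightarrow> nat \<Rightarrow> 'a list \<Rightarrow> 'a list" where
  "window p k x = take k (drop p x)"

lemma window_words: "x \<in> words A n \<Longrightarrow> p + k \<le> n \<Longrightarrow> window p k x \<in> words A k"
  by (auto simp: window_def words_def dest!: in_set_takeD in_set_dropD)

lemma window_window: "r + k \<le> m \<Longrightarrow> window r k (window p m x) = window (p + r) k x"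
  by (simp add: window_def drop_take take_take drop_drop add.commute min_def)

lemma nth_words: "xs \<in> words A n \<Longrightarrow> c < n \<Longrightarrow> xs ! c \<in> A"
  by (auto simp: words_def)

lemma window_concat:
  assumes "xs \<in> words (words A m) n" "c < n" "r + k \<le> m"
  shows "window (c * m + r) k (concat xs) = window r k (xs ! c)"
proof -
  have len: "length (concat xs) = n * m" by (rule length_concat_words[OF assms(1)])
  have lc: "length (xs ! c) = m" using nth_words[OF assms(1,2)] by (simp add: words_def)
  have "Suc c * m \<le> n * m" using assms(2) by (intro mult_le_mono1) simp
  then have le: "c * m + r + k \<le> n * m" using assms(3) by simp
  show ?thesis
  proof (rule nth_equalityI)
    fix t assume "t < length (window (c * m + r) k (concat xs))"
    then have t: "t < k" by (simp add: window_def)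
    have "concat xs ! (c * m + (r + t)) = xs ! c ! (r + t)"
      by (rule nth_concat_words[OF assms(1,2)]) (use t assms(3) in simp)
    then show "window (c * m + r) k (concat xs) ! t = window r k (xs ! c) ! t"
      using t le assms(3) len lc by (simp add: window_def add.assoc)
  qed (use len le lc assms(3) in \<open>simp add: window_def\<close>)
qed

declare block_mean.simps(2) [simp del]

context hierarchy
begin

text \<open>A child on which the function is constant contributes the mean of its sign, which is
  zero. The correction vanishes and the children behave as independent.\<close>

lemma E_Suc_prod_free:
  assumes "\<And>xs. xs \<in> words (Wd j) L \<Longrightarrow> f (concat xs) = (\<Prod>c<L. g c (xs ! c))"
    and "c0 < L" "\<And>x. x \<in> Wd j \<Longrightarrow> g c0 x = a"
  shows "E (Suc j) f = (\<Prod>c<L. E j (g c))"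
proof -
  have "E j (\<lambda>x. g c0 x * sg x) = E j (\<lambda>x. a * sg x)"
    by (rule mean_cong[OF mean_E]) (simp add: assms(3))
  then have "E j (\<lambda>x. g c0 x * sg x) = 0"
    by (simp add: mean_cmult[OF mean_E] E_sg)
  then have "(\<Prod>c<L. E j (\<lambda>x. g c x * sg x)) = 0"
    using \<open>c0 < L\<close> by (intro prod_zero) auto
  then show ?thesis using E_Suc_prod[of j f g] assms(1) by simp
qed

text \<open>Fewer than L sign-sensitive coordinates leave some child without any, so the children
  factorise and the induction applies to each. Counting sensitive coordinates instead of all
  coordinates lets the statement cover functions of the absolute values as well.\<close>

lemma E_product:
  assumes "card {i \<in> {..<L ^ j}. g i 1 \<noteq> g i (-1)} < L"
  shows "E j (\<lambda>x. \<Prod>i<L ^ j. g i (x ! i)) = (\<Prod>i<L ^ j. (g i 1 + g i (-1)) / 2)"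
  using assms
proof (induction j arbitrary: g)
  case (Suc j)
  define m where "m = L ^ j"
  define bad where "bad c = {i. i < m \<and> g (c * m + i) 1 \<noteq> g (c * m + i) (-1)}" for c
  have sec: "bad c = slice m {i \<in> {..<L * m}. g i 1 \<noteq> g i (-1)} c" if "c < L" for c
    using block_index_less[OF that, of _ m] by (auto simp: slice_def bad_def)
  have "card {i \<in> {..<L * m}. g i 1 \<noteq> g i (-1)} = (\<Sum>c<L. card (bad c))"
    using card_slices[of "{i \<in> {..<L * m}. g i 1 \<noteq> g i (-1)}" L m] by (auto simp: sec)
  then have few: "(\<Sum>c<L. card (bad c)) < L" using Suc.prems by (simp add: m_def)
  have small: "card (bad c) < L" if "c < L" for c
    using member_le_sum[of c "{..<L}" "\<lambda>c. card (bad c)"] few that by simp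
  have "\<exists>c0<L. card (bad c0) = 0"
  proof (rule ccontr)
    assume "\<not> ?thesis"
    then have "\<And>c. c < L \<Longrightarrow> 1 \<le> card (bad c)" by (simp add: Suc_le_eq)
    then have "(\<Sum>c<L. 1) \<le> (\<Sum>c<L. card (bad c))" by (intro sum_mono) simp
    then show False using few by simp
  qed
  then obtain c0 where c0: "c0 < L" "card (bad c0) = 0" by auto
  have "finite (bad c0)" by (simp add: bad_def)
  then have "bad c0 = {}" using c0(2) by (simp only: card_0_eq)
  then have g0: "g (c0 * m + r) s = g (c0 * m + r) 1" if "r < m" "s \<in> signs" for r s
  proof -
    have "r \<notin> bad c0" using \<open>bad c0 = {}\<close> by simp
    then have "g (c0 * m + r) 1 = g (c0 * m + r) (-1)" using that(1) by (simp add: bad_def)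
    then show ?thesis using that(2) by auto
  qed
  have "E (Suc j) (\<lambda>x. \<Prod>i<L ^ Suc j. g i (x ! i)) = (\<Prod>c<L. E j (\<lambda>x. \<Prod>r<m. g (c * m + r) (x ! r)))"
  proof (rule E_Suc_prod_free[OF _ \<open>c0 < L\<close>])
    fix xs assume xs: "xs \<in> words (Wd j) L"
    show "(\<Prod>i<L ^ Suc j. g i (concat xs ! i)) = (\<Prod>c<L. \<Prod>r<m. g (c * m + r) (xs ! c ! r))"
      using nth_concat_words[OF xs] by (simp add: prod.blocks m_def)
  next
    fix x assume "x \<in> Wd j"
    then have "x ! r \<in> signs" if "r < m" for r
      using that unfolding m_def by (rule nth_words)
    then show "(\<Prod>r<m. g (c0 * m + r) (x ! r)) = (\<Prod>r<m. g (c0 * m + r) 1)"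
      by (intro prod.cong refl g0) auto
  qed
  also have "\<dots> = (\<Prod>c<L. \<Prod>r<m. (g (c * m + r) 1 + g (c * m + r) (-1)) / 2)"
  proof (rule prod.cong[OF refl])
    fix c assume "c \<in> {..<L}"
    then have "card {i \<in> {..<L ^ j}. g (c * m + i) 1 \<noteq> g (c * m + i) (-1)} < L"
      using small[of c] by (simp add: bad_def m_def)
    then show "E j (\<lambda>x. \<Prod>r<m. g (c * m + r) (x ! r)) = (\<Prod>r<m. (g (c * m + r) 1 + g (c * m + r) (-1)) / 2)"
      unfolding m_def by (rule Suc.IH)
  qed
  also have "\<dots> = (\<Prod>i<L ^ Suc j. (g i 1 + g i (-1)) / 2)"
    by (simp add: prod.blocks m_def)
  finally show ?case .
qed simp

text \<open>As L exceeds 2, a third child is free of both functions.\<close>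

lemma E_child_pair:
  assumes "c < L" "c' < L" "c \<noteq> c'"
  shows "E (Suc j) (\<lambda>x. f (window (c * L ^ j) (L ^ j) x) * g (window (c' * L ^ j) (L ^ j) x)) = E j f * E j g"
proof -
  have "card {c, c'} < card {..<L}" using assms(3) L h by simp
  then obtain c0 where c0: "c0 < L" "c0 \<noteq> c" "c0 \<noteq> c'"
    using card_mono[of "{c, c'}" "{..<L}"] by fastforce
  let ?G = "\<lambda>d. if d = c then f else if d = c' then g else (\<lambda>_. 1)"
  have pr: "(\<Prod>d<L. F d) = F c * F c'" if "\<And>d. d \<noteq> c \<Longrightarrow> d \<noteq> c' \<Longrightarrow> F d = 1" for F :: "nat \<Rightarrow> real"
  proof -
    have "(\<Prod>d<L. F d) = (\<Prod>d\<in>{c, c'}. F d)"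
      by (rule prod.mono_neutral_right) (use assms that in auto)
    then show ?thesis using assms(3) by simp
  qed
  have "E (Suc j) (\<lambda>x. f (window (c * L ^ j) (L ^ j) x) * g (window (c' * L ^ j) (L ^ j) x)) = (\<Prod>d<L. E j (?G d))"
  proof (rule E_Suc_prod_free[OF _ c0(1)])
    fix xs assume xs: "xs \<in> words (Wd j) L"
    have blk: "window (d * L ^ j) (L ^ j) (concat xs) = xs ! d" if "d < L" for d
      using window_concat[OF xs that, of 0 "L ^ j"] xs that
      by (simp add: words_def subset_iff window_def)
    show "f (window (c * L ^ j) (L ^ j) (concat xs)) * g (window (c' * L ^ j) (L ^ j) (concat xs))
        = (\<Prod>d<L. ?G d (xs ! d))"
      using assms by (subst pr) (auto simp: blk)
  next
    show "?G c0 x = 1" for x using c0 by simp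
  qed
  also have "\<dots> = E j f * E j g"
    using assms by (subst pr) (auto simp: mean_const[OF mean_E])
  finally show ?thesis .
qed

lemma E_child:
  assumes "c < L"
  shows "E (Suc j) (\<lambda>x. f (window (c * L ^ j) (L ^ j) x)) = E j f"
proof -
  obtain c' where "c' < L" "c \<noteq> c'" using assms L_gt_1 that[of 0] that[of 1] by (cases "c = 0") auto
  then show ?thesis using E_child_pair[OF assms, of c' j f "\<lambda>_. 1"] by (simp add: mean_const[OF mean_E])
qed

definition subblock :: "nat \<Rightarrow> nat \<Rightarrow> real list \<Rightarrow> real list" where
  "subblock i b x = window (b * L ^ i) (L ^ i) x"

lemma subblock_child:
  assumes "b < L ^ t"
  shows "subblock i (c * L ^ t + b) x = subblock i b (window (c * L ^ (i + t)) (L ^ (i + t)) x)"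
proof -
  have "b * L ^ i + L ^ i \<le> L ^ (i + t)"
    using mult_le_mono1[of "Suc b" "L ^ t" "L ^ i"] assms by (simp add: power_add mult.commute)
  then show ?thesis
    by (simp add: subblock_def window_window power_add algebra_simps)
qed

lemma E_subblock: "b < L ^ t \<Longrightarrow> E (i + t) (\<lambda>x. f (subblock i b x)) = E i f"
proof (induction t arbitrary: b)
  case 0
  have "E i (\<lambda>x. f (subblock i b x)) = E i f"
    by (rule mean_cong[OF mean_E]) (use 0 in \<open>auto simp: subblock_def window_def words_def\<close>)
  then show ?case by simp
next
  case (Suc t)
  define c where "c = b div L ^ t"
  have b: "b = c * L ^ t + b mod L ^ t" "b mod L ^ t < L ^ t" "c < L"
    using Suc.prems L_pos by (auto simp: c_def less_mult_imp_div_less div_mult_mod_eq)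
  have "E (Suc (i + t)) (\<lambda>x. f (subblock i b x)) =
      E (Suc (i + t)) (\<lambda>x. f (subblock i (b mod L ^ t) (window (c * L ^ (i + t)) (L ^ (i + t)) x)))"
    by (subst b(1), subst subblock_child[OF b(2)]) simp
  also have "\<dots> = E (i + t) (\<lambda>x. f (subblock i (b mod L ^ t) x))"
    by (rule E_child[OF b(3)])
  finally show ?case using Suc.IH[OF b(2)] by simp
qed

text \<open>Below their smallest common ancestor the two blocks lie in different children and are
  independent by \<open>E_child_pair\<close>; each higher level merely restricts to one
  child.\<close>

lemma E_subblock_pair:
  assumes "b < L ^ t" "b' < L ^ t" "b \<noteq> b'"
  shows "E (i + t) (\<lambda>x. f (subblock i b x) * g (subblock i b' x)) = E i f * E i g"
  using assms
proof (induction t arbitrary: b b')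
  case (Suc t)
  have split: "a = (a div L ^ t) * L ^ t + a mod L ^ t \<and> a mod L ^ t < L ^ t \<and> a div L ^ t < L"
    if "a < L ^ Suc t" for a
    using that L_pos by (auto simp: less_mult_imp_div_less div_mult_mod_eq)
  define c c' d d' where "c = b div L ^ t" and "c' = b' div L ^ t" and "d = b mod L ^ t" and "d' = b' mod L ^ t"
  have b: "b = c * L ^ t + d" "d < L ^ t" "c < L" and b': "b' = c' * L ^ t + d'" "d' < L ^ t" "c' < L"
    using split[OF Suc.prems(1)] split[OF Suc.prems(2)] by (auto simp: c_def c'_def d_def d'_def)
  let ?w = "\<lambda>c. window (c * L ^ (i + t)) (L ^ (i + t))"
  have eq: "E (Suc (i + t)) (\<lambda>x. f (subblock i b x) * g (subblock i b' x)) =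
      E (Suc (i + t)) (\<lambda>x. f (subblock i d (?w c x)) * g (subblock i d' (?w c' x)))"
    unfolding b(1) b'(1) subblock_child[OF b(2)] subblock_child[OF b'(2)] ..
  show ?case
  proof (cases "c = c'")
    case True
    then have "d \<noteq> d'" using Suc.prems(3) b b' by auto
    have "E (Suc (i + t)) (\<lambda>x. f (subblock i d (?w c x)) * g (subblock i d' (?w c' x)))
        = E (i + t) (\<lambda>x. f (subblock i d x) * g (subblock i d' x))"
      unfolding True[symmetric] by (rule E_child[OF b(3)])
    then show ?thesis using eq Suc.IH[OF b(2) b'(2) \<open>d \<noteq> d'\<close>] by simp
  next
    case False
    show ?thesis
      using eq E_child_pair[OF b(3) b'(3) False, of "i + t" "\<lambda>y. f (subblock i d y)" "\<lambda>y. g (subblock i d' y)"]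
        E_subblock[OF b(2), of i f] E_subblock[OF b'(2), of i g] by simp
  qed
qed simp

end

section \<open>Word frequencies\<close>

lemma sum_words_snoc:
  "(\<Sum>w\<in>words A (Suc n). f w) = (\<Sum>w\<in>words A n. \<Sum>x\<in>A. f (w @ [x]))"
proof (induction n arbitrary: f)
  case (Suc n)
  have "(\<Sum>w\<in>words A (Suc (Suc n)). f w) = (\<Sum>y\<in>A. \<Sum>w\<in>words A n. \<Sum>x\<in>A. f (y # w @ [x]))"
    unfolding sum_words_Suc[of f A "Suc n"] Suc ..
  then show ?case by (simp add: sum_words_Suc)
qed (simp add: sum_words_Suc)

lemma sum_words_append:
  "(\<Sum>w\<in>words A (m + n). f w) = (\<Sum>u\<in>words A m. \<Sum>v\<in>words A n. f (u @ v))"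
  by (induction m arbitrary: f) (simp_all add: sum_words_Suc)

context hierarchy
begin

text \<open>Dividing by L ^ j and not by the number of positions makes the average of a nonnegative
  function increase with j: windows across the joints of blocks are just missing at the lower
  level.\<close>

definition scan :: "nat \<Rightarrow> nat \<Rightarrow> (real list \<Rightarrow> real) \<Rightarrow> real" where
  "scan j k f = (\<Sum>p<L ^ j - k. E j (\<lambda>x. f (window p k x))) / L ^ j"

lemma scan_sum_cmult:
  "scan j k (\<lambda>w. \<Sum>u\<in>I. f u w * c u) = (\<Sum>u\<in>I. scan j k (f u) * c u)"
proof -
  have "scan j k (\<lambda>w. \<Sum>u\<in>I. f u w * c u)
      = (\<Sum>p<L ^ j - k. \<Sum>u\<in>I. E j (\<lambda>x. f u (window p k x)) * c u) / L ^ j"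
    by (simp add: scan_def mean_sum[OF mean_E] mean_multc[OF mean_E])
  also have "\<dots> = (\<Sum>u\<in>I. scan j k (f u) * c u)"
    by (subst sum.swap) (simp add: scan_def sum_divide_distrib sum_distrib_right)
  finally show ?thesis .
qed

lemma window_Wd: "x \<in> Wd j \<Longrightarrow> p < L ^ j - k \<Longrightarrow> window p k x \<in> words signs k"
  by (rule window_words) auto

lemma scan_mono:
  assumes "\<And>w. w \<in> words signs k \<Longrightarrow> f w \<le> g w"
  shows "scan j k f \<le> scan j k g"
  unfolding scan_def
  by (intro divide_right_mono sum_mono mean_mono[OF mean_E] assms window_Wd) auto

lemma scan_cong:
  assumes "\<And>w. w \<in> words signs k \<Longrightarrow> f w = g w"
  shows "scan j k f = scan j k g"
  by (intro antisym scan_mono) (simp_all add: assms)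

lemma scan_nonneg: "(\<And>w. w \<in> words signs k \<Longrightarrow> 0 \<le> f w) \<Longrightarrow> 0 \<le> scan j k f"
  using scan_mono[of k "\<lambda>_. 0" f j] by (simp add: scan_def mean_const[OF mean_E])

lemma scan_one_le: "scan j k (\<lambda>_. 1) \<le> 1"
  using L_pos by (simp add: scan_def mean_const[OF mean_E])

text \<open>Windows inside a child reproduce the average of level j by \<open>E_child\<close>; the
  windows across joints add nonnegative terms.\<close>

lemma scan_Suc_ge:
  assumes "\<And>w. 0 \<le> f w"
  shows "scan j k f \<le> scan (Suc j) k f"
proof -
  define m where "m = L ^ j"
  define e where "e p = E (Suc j) (\<lambda>x. f (window p k x))" for p
  have e0: "0 \<le> e p" for p
    unfolding e_def by (rule mean_nonneg[OF mean_E]) (rule assms)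
  have ec: "e (c * m + r) = E j (\<lambda>x. f (window r k x))" if "c < L" "r + k < m" for c r
    using E_child[OF that(1), of j "\<lambda>x. f (window r k x)"] that
    by (simp add: e_def m_def window_window)
  have sums: "(\<Sum>p<N - k. g p) = (\<Sum>p<N. if p + k < N then g p else 0)" for N and g :: "nat \<Rightarrow> real"
    by (rule sum.mono_neutral_cong_left) auto
  have m: "real m > 0" using L_pos by (simp add: m_def)
  have "L * (\<Sum>r<m - k. E j (\<lambda>x. f (window r k x)))
      = (\<Sum>c<L. \<Sum>r<m. if r + k < m then e (c * m + r) else 0)"
  proof -
    have "(\<Sum>r<m - k. E j (\<lambda>x. f (window r k x))) = (\<Sum>r<m. if r + k < m then e (c * m + r) else 0)"
      if "c < L" for c
      unfolding sums by (intro sum.cong refl) (simp add: ec[OF that])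
    then have "(\<Sum>c<L. \<Sum>r<m - k. E j (\<lambda>x. f (window r k x)))
        = (\<Sum>c<L. \<Sum>r<m. if r + k < m then e (c * m + r) else 0)"
      by (rule sum.cong[OF refl]) simp
    then show ?thesis by simp
  qed
  also have "\<dots> \<le> (\<Sum>c<L. \<Sum>r<m. if c * m + r + k < L * m then e (c * m + r) else 0)"
  proof (intro sum_mono)
    fix c r assume "c \<in> {..<L}"
    then have "c * m + r + k < L * m" if "r + k < m"
      using block_index_less[OF _ that, of c L] by (simp add: add.assoc)
    then show "(if r + k < m then e (c * m + r) else 0)
        \<le> (if c * m + r + k < L * m then e (c * m + r) else 0)"
      using e0 by auto
  qed
  also have "\<dots> = (\<Sum>p<L * m. if p + k < L * m then e p else 0)"
    by (simp add: sum.blocks)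
  also have "\<dots> = (\<Sum>p<L * m - k. e p)" by (simp add: sums)
  finally have "L * (\<Sum>r<m - k. E j (\<lambda>x. f (window r k x))) / (L * m) \<le> (\<Sum>p<L * m - k. e p) / (L * m)"
    by (rule divide_right_mono) simp
  then show ?thesis
    using L_pos by (simp add: scan_def m_def e_def)
qed

definition freq :: "nat \<Rightarrow> real list \<Rightarrow> real" where
  "freq j u = scan j (length u) (indicator {u})"

lemma scan_freq: "scan j k f = (\<Sum>u\<in>words signs k. freq j u * f u)"
proof -
  have "scan j k f = scan j k (\<lambda>w. \<Sum>u\<in>words signs k. indicator {u} w * f u)"
  proof (rule scan_cong)
    fix w :: "real list" assume "w \<in> words signs k"
    then show "f w = (\<Sum>u\<in>words signs k. indicator {u} w * f u)"
      by (simp add: indicator_def finite_words sum.delta if_distrib cong: if_cong)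
  qed
  also have "\<dots> = (\<Sum>u\<in>words signs k. freq j u * f u)"
    unfolding scan_sum_cmult freq_def by (intro sum.cong) (auto simp: words_def)
  finally show ?thesis .
qed

lemma incseq_freq: "incseq (\<lambda>j. freq j u)"
  unfolding incseq_Suc_iff freq_def by (intro allI scan_Suc_ge) simp

lemma freq_nonneg: "0 \<le> freq j u"
  unfolding freq_def by (rule scan_nonneg) simp

lemma freq_le_1: "freq j u \<le> 1"
  unfolding freq_def
  by (rule order_trans[OF scan_mono scan_one_le[of j "length u"]]) (simp add: indicator_def)

text \<open>Frequencies are increasing in j and bounded by 1, so the limit exists without passing to
  a subsequence.\<close>

definition q :: "real list \<Rightarrow> real" where
  "q u = lim (\<lambda>j. freq j u)"

lemma freq_tendsto: "(\<lambda>j. freq j u) \<longlonglongrightarrow> q u"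
proof -
  have "convergent (\<lambda>j. freq j u)"
    using incseq_convergent[OF incseq_freq] freq_le_1 by (metis convergentI)
  then show ?thesis by (simp add: q_def convergent_LIMSEQ_iff)
qed

lemma q_nonneg: "0 \<le> q u"
  by (rule LIMSEQ_le_const[OF freq_tendsto]) (use freq_nonneg in auto)

text \<open>Expectation over k consecutive letters of the stationary sequence with word
  probabilities \<open>q\<close>.\<close>

definition Q :: "nat \<Rightarrow> (real list \<Rightarrow> real) \<Rightarrow> real" where
  "Q k f = (\<Sum>u\<in>words signs k. q u * f u)"

lemma scan_tendsto: "(\<lambda>j. scan j k f) \<longlonglongrightarrow> Q k f"
  unfolding scan_freq Q_def by (intro tendsto_intros freq_tendsto)

lemma over_L_power_tendsto: "(\<lambda>j. c / real (L ^ j)) \<longlonglongrightarrow> 0"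
  using LIMSEQ_divide_realpow_zero[of "real L" c] L_gt_1 by simp

lemma ev_L_power_ge: "eventually (\<lambda>j. k \<le> L ^ j) sequentially"
  using eventually_ge_at_top[of k]
proof eventually_elim
  case (elim j)
  have "j < L ^ j" using L_gt_1 by (intro power_gt_expt) simp
  with elim show ?case by simp
qed

lemma window_count_tendsto: "(\<lambda>j. (real (L ^ j) - real k) / real (L ^ j)) \<longlonglongrightarrow> 1"
proof -
  have "(\<lambda>j. 1 - real k / real (L ^ j)) \<longlonglongrightarrow> 1 - 0"
    by (intro tendsto_intros over_L_power_tendsto)
  then show ?thesis using L_pos by (simp add: diff_divide_distrib)
qed

text \<open>A bound that holds at every position passes to the limit, since the share of positions
  omitted by \<open>scan\<close> tends to 0.\<close>

lemma Q_window_leI: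
  assumes "\<And>j p. p + k \<le> L ^ j \<Longrightarrow> E j (\<lambda>x. f (window p k x)) \<le> c"
  shows "Q k f \<le> c"
proof (rule tendsto_le[OF _ _ scan_tendsto])
  show "(\<lambda>j. c * ((real (L ^ j) - real k) / real (L ^ j))) \<longlonglongrightarrow> c"
    using tendsto_mult[OF tendsto_const window_count_tendsto, of c k] by simp
  show "\<forall>\<^sub>F j in sequentially. scan j k f \<le> c * ((real (L ^ j) - real k) / real (L ^ j))"
    using ev_L_power_ge[of k]
  proof eventually_elim
    case (elim j)
    have "(\<Sum>p<L ^ j - k. E j (\<lambda>x. f (window p k x))) \<le> (\<Sum>p<L ^ j - k. c)"
      by (intro sum_mono assms) simp
    also have "\<dots> = c * (real (L ^ j) - real k)" using elim by (simp add: of_nat_diff)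
    finally show ?case
      unfolding scan_def by (simp add: divide_right_mono)
  qed
qed simp

lemma Q_window_eqI:
  assumes "\<And>j p. p + k \<le> L ^ j \<Longrightarrow> E j (\<lambda>x. f (window p k x)) = c"
  shows "Q k f = c"
proof (rule antisym)
  show "Q k f \<le> c" by (rule Q_window_leI) (simp add: assms)
  have "Q k (\<lambda>w. - f w) \<le> - c"
    by (rule Q_window_leI) (simp add: assms mean_minus[OF mean_E])
  then show "c \<le> Q k f" by (simp add: Q_def sum_negf)
qed

lemma q_Nil: "q [] = 1"
  using Q_window_eqI[of 0 "\<lambda>_. 1" 1] by (simp add: Q_def mean_const[OF mean_E])

text \<open>Averages over windows of lengths k and k + 1 differ by one window at an end of the
  block, hence by at most 1 / L ^ j. Dropping the last or the first letter gives consistency and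
  stationarity of \<open>q\<close>.\<close>

lemma Q_dropI:
  assumes f: "\<And>w. 0 \<le> f w" "\<And>w. f w \<le> 1"
    and diff: "\<And>j. Suc k \<le> L ^ j \<Longrightarrow> scan j k f - scan j (Suc k) g = E j (\<lambda>x. f (u j x)) / L ^ j"
  shows "Q (Suc k) g = Q k f"
proof (rule LIMSEQ_unique[OF scan_tendsto])
  have "(\<lambda>j. scan j k f - scan j (Suc k) g) \<longlonglongrightarrow> 0"
  proof (rule Lim_null_comparison[OF _ over_L_power_tendsto[of 1]])
    show "\<forall>\<^sub>F j in sequentially. norm (scan j k f - scan j (Suc k) g) \<le> 1 / real (L ^ j)"
      using ev_L_power_ge[of "Suc k"]
    proof eventually_elim
      case (elim j)
      have "0 \<le> E j (\<lambda>x. f (u j x))" "E j (\<lambda>x. f (u j x)) \<le> 1"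
        using mean_nonneg[OF mean_E, of j "\<lambda>x. f (u j x)"]
          mean_mono[OF mean_E, of j "\<lambda>x. f (u j x)" "\<lambda>_. 1"] f
        by (simp_all add: mean_const[OF mean_E])
      then show ?case by (simp add: diff[OF elim] divide_right_mono)
    qed
  qed
  then show "(\<lambda>j. scan j (Suc k) g) \<longlonglongrightarrow> Q k f"
    using tendsto_diff[OF scan_tendsto[of k f]] by fastforce
qed

lemma Q_right:
  assumes "\<And>w. 0 \<le> f w" "\<And>w. f w \<le> 1"
  shows "Q (Suc k) (\<lambda>w. f (window 0 k w)) = Q k f"
proof (rule Q_dropI[OF assms])
  fix j assume "Suc k \<le> L ^ j"
  then have N: "L ^ j - k = Suc (L ^ j - Suc k)" by simp
  show "scan j k f - scan j (Suc k) (\<lambda>w. f (window 0 k w)) = E j (\<lambda>x. f (window (L ^ j - Suc k) k x)) / L ^ j"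
    unfolding scan_def N by (simp add: window_window add_divide_distrib)
qed

lemma Q_left:
  assumes "\<And>w. 0 \<le> f w" "\<And>w. f w \<le> 1"
  shows "Q (Suc k) (\<lambda>w. f (window 1 k w)) = Q k f"
proof (rule Q_dropI[OF assms])
  fix j assume "Suc k \<le> L ^ j"
  then have N: "L ^ j - k = Suc (L ^ j - Suc k)" by simp
  show "scan j k f - scan j (Suc k) (\<lambda>w. f (window 1 k w)) = E j (\<lambda>x. f (window 0 k x)) / L ^ j"
    unfolding scan_def N sum.lessThan_Suc_shift by (simp add: window_window add_divide_distrib)
qed

lemma Q_indicator: "u \<in> words signs k \<Longrightarrow> Q k (indicator {u}) = q u"
  by (simp add: Q_def indicator_def finite_words if_distrib cong: if_cong)

lemma q_snoc:
  assumes u: "u \<in> words signs k"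
  shows "(\<Sum>s\<in>signs. q (u @ [s])) = q u"
proof -
  have "q u = Q (Suc k) (\<lambda>w. indicator {u} (window 0 k w))"
    unfolding Q_indicator[OF u, symmetric] by (rule Q_right[symmetric]) (auto simp: indicator_def)
  also have "\<dots> = (\<Sum>w\<in>words signs k. \<Sum>s\<in>signs. q (w @ [s]) * indicator {u} w)"
    unfolding Q_def sum_words_snoc
    by (intro sum.cong refl) (simp add: window_def words_def)
  also have "\<dots> = (\<Sum>w\<in>words signs k. if w = u then \<Sum>s\<in>signs. q (w @ [s]) else 0)"
    by (intro sum.cong refl) (simp add: indicator_def)
  also have "\<dots> = (\<Sum>s\<in>signs. q (u @ [s]))"
    using u by (simp add: finite_words)
  finally show ?thesis ..
qed

lemma q_Cons:
  assumes u: "u \<in> words signs k"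
  shows "(\<Sum>s\<in>signs. q (s # u)) = q u"
proof -
  have "q u = Q (Suc k) (\<lambda>w. indicator {u} (window 1 k w))"
    unfolding Q_indicator[OF u, symmetric] by (rule Q_left[symmetric]) (auto simp: indicator_def)
  also have "\<dots> = (\<Sum>s\<in>signs. \<Sum>w\<in>words signs k. q (s # w) * indicator {u} w)"
    unfolding Q_def sum_words_Suc
    by (intro sum.cong refl) (simp add: window_def words_def)
  also have "\<dots> = (\<Sum>s\<in>signs. \<Sum>w\<in>words signs k. if w = u then q (s # w) else 0)"
    by (intro sum.cong refl) (simp add: indicator_def)
  also have "\<dots> = (\<Sum>s\<in>signs. q (s # u))"
    using u by (simp add: finite_words)
  finally show ?thesis ..
qed

lemma sum_list_window:
  assumes "x \<in> Wd j" "p + k \<le> L ^ j"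
  shows "sum_list (window p k x) = dsum {p..<p + k} x"
proof -
  have "sum_list (window p k x) = (\<Sum>i<k. x ! (p + i))"
    using assms by (auto simp: sum_list_sum_nth window_def words_def atLeast0LessThan)
  also have "\<dots> = dsum {p..<p + k} x"
    unfolding dsum_def using sum.shift_bounds_nat_ivl[of "\<lambda>i. x ! i" 0 p k]
    by (simp add: atLeast0LessThan add.commute)
  finally show ?thesis .
qed

lemma E_window_power:
  "p + k \<le> L ^ j \<Longrightarrow> E j (\<lambda>x. sum_list (window p k x) ^ m) = E j (\<lambda>x. dsum {p..<p + k} x ^ m)"
  by (rule mean_cong[OF mean_E]) (simp add: sum_list_window)

lemma Q_moment:
  assumes "m < L"
  shows "Q k (\<lambda>u. sum_list u ^ m) = walk_pow 1 m k"
proof (rule Q_window_eqI)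
  fix j p assume "p + k \<le> L ^ j"
  moreover from this have "{p..<p + k} \<subseteq> {..<L ^ j}" by auto
  ultimately show "E j (\<lambda>x. sum_list (window p k x) ^ m) = walk_pow 1 m k"
    using E_dsum_power[OF assms] by (simp add: E_window_power)
qed

text \<open>The subtracted \<open>real (2 * L) ^ h\<close> makes the bound hold for short windows
  too, where the loss is only known to be nonnegative.\<close>

lemma Q_moment_L:
  "Q k (\<lambda>u. sum_list u ^ L) \<le> walk_pow 1 L k - (1 / (128 * L\<^sup>2)) ^ h * (real k ^ h - real (2 * L) ^ h)"
proof (rule Q_window_leI)
  fix j p assume pk: "p + k \<le> L ^ j"
  have sub: "{p..<p + k} \<subseteq> {..<L ^ j}" using pk by auto
  have "E j (\<lambda>x. sum_list (window p k x) ^ L) = walk_pow 1 L k - defect j {p..<p + k}"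
    using pk by (simp add: E_window_power defect_def)
  moreover have "(1 / (128 * L\<^sup>2)) ^ h * (real k ^ h - real (2 * L) ^ h) \<le> defect j {p..<p + k}"
  proof (cases "2 * L \<le> k")
    case True
    have "(1 / (128 * L\<^sup>2)) ^ h * (real k ^ h - real (2 * L) ^ h) \<le> (1 / (128 * L\<^sup>2)) ^ h * real k ^ h"
      by (intro mult_left_mono) auto
    also have "\<dots> = (k / (128 * L\<^sup>2)) ^ h" by (simp add: power_divide)
    also have "\<dots> \<le> defect j {p..<p + k}" by (rule defect_window[OF sub True])
    finally show ?thesis .
  next
    case False
    then have "real k ^ h \<le> real (2 * L) ^ h" by (intro power_mono) auto
    then have "(1 / (128 * L\<^sup>2)) ^ h * (real k ^ h - real (2 * L) ^ h) \<le> 0"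
      by (intro mult_nonneg_nonpos) auto
    then show ?thesis using defect_nonneg[OF sub] by linarith
  qed
  ultimately show "E j (\<lambda>x. sum_list (window p k x) ^ L)
      \<le> walk_pow 1 L k - (1 / (128 * L\<^sup>2)) ^ h * (real k ^ h - real (2 * L) ^ h)"
    by linarith
qed

lemma Q_product:
  assumes "card {i \<in> {..<k}. g i 1 \<noteq> g i (-1)} < L"
  shows "Q k (\<lambda>u. \<Prod>i<k. g i (u ! i)) = (\<Prod>i<k. (g i 1 + g i (-1)) / 2)"
proof (rule Q_window_eqI)
  fix j p assume pk: "p + k \<le> L ^ j"
  \<comment> \<open>Padding by the constant 1 outside the window adds no sensitive coordinate, so
    \<open>E_product\<close> applies to the whole block.\<close>
  define G where "G i = (if p \<le> i \<and> i < p + k then g (i - p) else (\<lambda>_. 1))" for i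
  have pr: "(\<Prod>i<L ^ j. F i) = (\<Prod>i<k. F (p + i))" if "\<And>i. \<not> (p \<le> i \<and> i < p + k) \<Longrightarrow> F i = 1" for F :: "nat \<Rightarrow> real"
  proof -
    have "(\<Prod>i<L ^ j. F i) = (\<Prod>i\<in>{p..<p + k}. F i)"
      by (rule prod.mono_neutral_right) (use pk that in auto)
    also have "\<dots> = (\<Prod>i<k. F (p + i))"
      using prod.shift_bounds_nat_ivl[of F 0 p k] by (simp add: atLeast0LessThan add.commute)
    finally show ?thesis .
  qed
  have "{i \<in> {..<L ^ j}. G i 1 \<noteq> G i (-1)} \<subseteq> (\<lambda>i. p + i) ` {i \<in> {..<k}. g i 1 \<noteq> g i (-1)}"
  proof
    fix i assume "i \<in> {i \<in> {..<L ^ j}. G i 1 \<noteq> G i (-1)}"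
    then have "p \<le> i" "i - p \<in> {i \<in> {..<k}. g i 1 \<noteq> g i (-1)}"
      by (auto simp: G_def split: if_splits)
    then show "i \<in> (\<lambda>i. p + i) ` {i \<in> {..<k}. g i 1 \<noteq> g i (-1)}"
      by (intro image_eqI[of _ _ "i - p"]) auto
  qed
  then have "card {i \<in> {..<L ^ j}. G i 1 \<noteq> G i (-1)} \<le> card {i \<in> {..<k}. g i 1 \<noteq> g i (-1)}"
    by (intro surj_card_le) auto
  then have few: "card {i \<in> {..<L ^ j}. G i 1 \<noteq> G i (-1)} < L" using assms by simp
  have "E j (\<lambda>x. \<Prod>i<k. g i (window p k x ! i)) = E j (\<lambda>x. \<Prod>i<L ^ j. G i (x ! i))"
  proof (rule mean_cong[OF mean_E])
    fix x :: "real list" assume "x \<in> Wd j"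
    then show "(\<Prod>i<k. g i (window p k x ! i)) = (\<Prod>i<L ^ j. G i (x ! i))"
      using pk by (subst pr) (auto simp: G_def window_def words_def)
  qed
  also have "\<dots> = (\<Prod>i<L ^ j. (G i 1 + G i (-1)) / 2)" by (rule E_product[OF few])
  also have "\<dots> = (\<Prod>i<k. (g i 1 + g i (-1)) / 2)"
    by (subst pr) (auto simp: G_def)
  finally show "E j (\<lambda>x. \<Prod>i<k. g i (window p k x ! i)) = (\<Prod>i<k. (g i 1 + g i (-1)) / 2)" .
qed

end

section \<open>Limits from one-sided bounds, and binomial averages\<close>

text \<open>The totals agree, so if no entry can fall below its target, no entry can exceed it in
  the limit. Mixing thereby needs lower bounds only.\<close>

lemma limits_of_lower_bounds:
  fixes x :: "nat \<Rightarrow> 'i \<Rightarrow> real"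
  assumes "finite I" "\<And>n. (\<Sum>i\<in>I. x n i) = S" "(\<Sum>i\<in>I. c i) = S"
    and low: "\<And>i e. i \<in> I \<Longrightarrow> e > 0 \<Longrightarrow> eventually (\<lambda>n. x n i \<ge> c i - e) sequentially"
    and "i \<in> I"
  shows "(\<lambda>n. x n i) \<longlonglongrightarrow> c i"
proof (rule LIMSEQ_I)
  fix e :: real assume "e > 0"
  \<comment> \<open>The surplus of one entry is at most the sum of the deficits of the others, so
    each deficit receives a share of \<open>e\<close>.\<close>
  define d where "d = e / (real (card I) + 1)"
  have d: "d > 0" using \<open>e > 0\<close> by (simp add: d_def)
  have "d * (real (card I) + 1) = e" by (simp add: d_def)
  then have de: "d * real (card I) < e" using d by (simp add: algebra_simps)
  have "eventually (\<lambda>n. \<forall>k\<in>I. x n k \<ge> c k - d) sequentially"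
    using low d by (intro eventually_ball_finite \<open>finite I\<close>) auto
  then obtain N where N: "\<And>n k. n \<ge> N \<Longrightarrow> k \<in> I \<Longrightarrow> x n k \<ge> c k - d"
    by (auto simp: eventually_sequentially)
  have "norm (x n i - c i) < e" if "n \<ge> N" for n
  proof -
    have "(\<Sum>k\<in>I - {i}. c k - d) \<le> (\<Sum>k\<in>I - {i}. x n k)"
      using N[OF that] by (intro sum_mono) auto
    moreover have "(\<Sum>k\<in>I - {i}. c k - d) = S - c i - d * real (card (I - {i}))"
      using assms(3) sum.remove[OF \<open>finite I\<close> \<open>i \<in> I\<close>, of c] by (simp add: sum_subtractf)
    moreover have "(\<Sum>k\<in>I - {i}. x n k) = S - x n i"
      using assms(2)[of n] sum.remove[OF \<open>finite I\<close> \<open>i \<in> I\<close>, of "x n"] by simp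
    moreover have "d * real (card (I - {i})) \<le> d * real (card I)"
      using d \<open>finite I\<close> by (intro mult_left_mono) (auto intro: card_mono)
    moreover have "c i - d \<le> x n i" using N[OF that \<open>i \<in> I\<close>] .
    moreover have "d * 1 \<le> d * real (card I)"
      using d \<open>finite I\<close> \<open>i \<in> I\<close> by (intro mult_left_mono) (auto simp: Suc_le_eq card_gt_0_iff)
    ultimately show ?thesis using de by (simp add: abs_less_iff)
  qed
  then show "\<exists>N. \<forall>n\<ge>N. norm (x n i - c i) < e" by blast
qed

text \<open>Expectation of \<open>g\<close> at the number of heads among n fair coins.\<close>

primrec bin_mean :: "nat \<Rightarrow> (nat \<Rightarrow> real) \<Rightarrow> real" where
  "bin_mean 0 g = g 0"
| "bin_mean (Suc n) g = (bin_mean n g + bin_mean n (\<lambda>k. g (Suc k))) / 2"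

lemma mean_bin: "mean_on UNIV (bin_mean n)"
  unfolding mean_on_def
proof (intro conjI allI impI)
  fix f g :: "nat \<Rightarrow> real"
  show "bin_mean n (\<lambda>x. f x + g x) = bin_mean n f + bin_mean n g"
    by (induction n arbitrary: f g) (simp_all add: add_divide_distrib)
  show "bin_mean n f \<le> bin_mean n g" if "\<forall>x\<in>UNIV. f x \<le> g x"
    using that by (induction n arbitrary: f g) (auto intro!: divide_right_mono add_mono)
next
  fix c and f :: "nat \<Rightarrow> real"
  show "bin_mean n (\<lambda>x. c * f x) = c * bin_mean n f"
    by (induction n arbitrary: f) (simp_all add: algebra_simps)
  show "bin_mean n (\<lambda>_. 1) = 1"
    by (induction n) simp_all
qed

text \<open>Taking a sign step only at heads is the lazy walk that moves with probability
  1/2.\<close>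

lemma bin_mean_walk: "bin_mean n (\<lambda>k. walk 1 k f) = walk (1/2) n f"
proof (induction n arbitrary: f)
  case (Suc n)
  note B = mean_bin[of n]
  have "bin_mean n (\<lambda>k. walk 1 (Suc k) f)
     = (walk (1/2) n (\<lambda>x. f (x + 1)) + walk (1/2) n (\<lambda>x. f (x - 1))) / 2"
    using mean_multc[OF B, of "\<lambda>k. walk 1 k (\<lambda>x. f (x + 1)) + walk 1 k (\<lambda>x. f (x - 1))" "1/2"]
    by (simp add: mean_add[OF B] Suc)
  then show ?case using Suc by (simp add: field_simps)
qed simp

lemma bin_mean_id: "bin_mean n real = n / 2"
proof (induction n)
  case (Suc n)
  have "bin_mean n (\<lambda>k. real (Suc k)) = n / 2 + 1"
    using mean_add[OF mean_bin[of n], of real "\<lambda>_. 1"] Suc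
    by (simp add: mean_const[OF mean_bin] add.commute)
  then show ?case using Suc by (simp add: field_simps)
qed simp

text \<open>Convexity of x^h on the nonnegative reals, in the form that Jensen's inequality
  consumes.\<close>

lemma power_above_tangent:
  fixes a x :: real
  assumes "0 \<le> a" "0 \<le> x"
  shows "a ^ h + h * a ^ (h - 1) * (x - a) \<le> x ^ h"
proof (induction h)
  case (Suc h)
  show ?case
  proof (cases h)
    case (Suc l)
    have "a ^ Suc h + Suc h * a ^ h * (x - a) \<le> x * (a ^ h + h * a ^ (h - 1) * (x - a))"
    proof -
      have "x * (a ^ h + h * a ^ (h - 1) * (x - a)) - (a ^ Suc h + Suc h * a ^ h * (x - a))
          = h * a ^ (h - 1) * (x - a)\<^sup>2"
        by (simp add: Suc algebra_simps power2_eq_square)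
      also have "\<dots> \<ge> 0" using assms by simp
      finally show ?thesis by linarith
    qed
    also have "\<dots> \<le> x * x ^ h" using assms Suc.IH by (intro mult_left_mono) auto
    finally show ?thesis by simp
  qed simp
qed simp

text \<open>Jensen's inequality: the tangent is taken at the mean n / 2, so its linear term averages
  to zero.\<close>

lemma bin_mean_power_ge: "(n / 2) ^ h \<le> bin_mean n (\<lambda>k. real k ^ h)"
proof -
  note B = mean_bin[of n]
  define a where "a = real n / 2"
  have "(n / 2) ^ h = bin_mean n (\<lambda>k. a ^ h + h * a ^ (h - 1) * (real k - a))"
    by (simp add: mean_add[OF B] mean_const[OF B] mean_cmult[OF B] mean_diff[OF B] bin_mean_id a_def)
  also have "\<dots> \<le> bin_mean n (\<lambda>k. real k ^ h)"
  proof (rule mean_mono[OF B])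
    show "a ^ h + h * a ^ (h - 1) * (real k - a) \<le> real k ^ h" for k
      by (rule power_above_tangent) (simp_all add: a_def)
  qed
  finally show ?thesis .
qed

lemma bin_mean_plus:
  "bin_mean (m + n) g = bin_mean m (\<lambda>j. bin_mean n (\<lambda>k. g (j + k)))"
  by (induction m arbitrary: g) simp_all

lemma bin_mean_ge_point:
  assumes "j \<le> m" "\<And>k. 0 \<le> g k"
  shows "g j / 2 ^ m \<le> bin_mean m g"
  using assms
proof (induction m arbitrary: j g)
  case (Suc m)
  have nn: "0 \<le> bin_mean m g" "0 \<le> bin_mean m (\<lambda>k. g (Suc k))"
    using Suc.prems by (auto intro: mean_nonneg[OF mean_bin])
  show ?case
  proof (cases j)
    case 0
    then show ?thesis using Suc.IH[of 0 g] Suc.prems nn by simp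
  next
    case (Suc i)
    then show ?thesis using Suc.IH[of i "\<lambda>k. g (Suc k)"] Suc.prems nn by simp
  qed
qed simp

text \<open>An exponential Markov bound: the indicator is at most 2^K (1/2)^k, and (1/2)^k has
  binomial mean (3/4)^n.\<close>

lemma bin_mean_small_tendsto:
  "(\<lambda>n. bin_mean n (indicator {..<K})) \<longlonglongrightarrow> 0"
proof (rule Lim_null_comparison)
  have pow: "bin_mean n (\<lambda>k. (1/2) ^ k) = (3/4) ^ n" for n
  proof (induction n)
    case (Suc n)
    then show ?case
      using mean_cmult[OF mean_bin[of n], of "1/2" "\<lambda>k. (1/2) ^ k"] by simp
  qed simp
  show "(\<lambda>n. 2 ^ K * (3/4 :: real) ^ n) \<longlonglongrightarrow> 0"
    by (intro tendsto_mult_right_zero LIMSEQ_realpow_zero) auto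
  show "\<forall>\<^sub>F n in sequentially. norm (bin_mean n (indicator {..<K})) \<le> 2 ^ K * (3/4) ^ n"
  proof (intro always_eventually allI)
    fix n
    note B = mean_bin[of n]
    have "bin_mean n (indicator {..<K}) \<le> bin_mean n (\<lambda>k. 2 ^ K * (1/2) ^ k)"
    proof (rule mean_mono[OF B])
      fix k :: nat
      show "(indicator {..<K} k :: real) \<le> 2 ^ K * (1/2) ^ k"
      proof (cases "k < K")
        case True
        then have "(2::real) ^ k \<le> 2 ^ K" by (intro power_increasing) auto
        then show ?thesis by (simp add: power_divide True)
      qed simp
    qed
    also have "\<dots> = 2 ^ K * (3/4) ^ n" by (simp add: mean_cmult[OF B] pow)
    finally show "norm (bin_mean n (indicator {..<K})) \<le> 2 ^ K * (3/4) ^ n"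
      using mean_nonneg[OF B, of "indicator {..<K}"] by simp
  qed
qed

lemma periodic_mod:
  fixes F :: "nat \<Rightarrow> 'a"
  assumes "\<And>k. F (k + m) = F k"
  shows "F (k mod m) = F k"
proof -
  have "F (s + i * m) = F s" for s i
    by (induction i) (use assms[of "s + _ * m"] in \<open>simp_all add: ac_simps\<close>)
  from this[of "k mod m" "k div m"] show ?thesis by simp
qed

lemma sum_periodic_shift:
  fixes F :: "nat \<Rightarrow> real"
  assumes "m > 0" "\<And>k. F (k + m) = F k"
  shows "(\<Sum>s<m. F (s + k)) = (\<Sum>s<m. F s)"
proof (induction k)
  case (Suc k)
  obtain l where l: "m = Suc l" using \<open>m > 0\<close> by (cases m) auto
  have "(\<Sum>s<m. F (s + Suc k)) = (\<Sum>s<l. F (Suc s + k)) + F (0 + k)"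
    using assms(2)[of k] by (simp add: l add.commute)
  also have "\<dots> = (\<Sum>s<m. F (s + k))"
    by (simp add: l sum.lessThan_Suc_shift add.commute del: sum.lessThan_Suc)
  finally show ?case using Suc by simp
qed simp

text \<open>Doeblin's argument: \<open>m\<close> further steps reach every residue with probability at
  least \<open>2^-m\<close>, which contracts the oscillation of a function of period \<open>m\<close>.\<close>

lemma bin_mean_periodic:
  fixes F :: "nat \<Rightarrow> real"
  assumes m: "m > 0" and per: "\<And>k. F (k + m) = F k"
  shows "(\<lambda>n. bin_mean n F) \<longlonglongrightarrow> (\<Sum>s<m. F s) / m"
proof -
  define G where "G n t = bin_mean n (\<lambda>k. F (t + k))" for n t
  define r :: real where "r = 1 - 1 / 2 ^ m"
  have r: "0 \<le> r" "r < 1" by (simp_all add: r_def)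
  have Gper: "G n (t + m) = G n t" for n t
    unfolding G_def using per[of "t + _"] by (simp add: ac_simps)
  have Gmod: "G n t = G n (t mod m)" for n t
    by (rule periodic_mod[of "G n", symmetric]) (rule Gper)
  \<comment> \<open>Binomial averaging preserves the mean over a period, which identifies the
    constant that remains once the oscillation has died out.\<close>
  have avg: "(\<Sum>s<m. G n s) = (\<Sum>s<m. F s)" for n
    unfolding G_def mean_sum[OF mean_bin, symmetric] sum_periodic_shift[of m F, OF m per]
    by (simp add: mean_const[OF mean_bin])
  define osc where "osc n c \<longleftrightarrow> (\<exists>a. \<forall>t. a \<le> G n t \<and> G n t \<le> a + c)" for n c
  have G_plus: "G (m' + n) t = bin_mean m' (\<lambda>j. G n (t + j))" for m' n t
    by (simp add: G_def bin_mean_plus add.assoc)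
  have osc_mono: "osc (m' + n) c" if "osc n c" for m' n c
  proof -
    from that obtain a where a: "\<And>t. a \<le> G n t" "\<And>t. G n t \<le> a + c" unfolding osc_def by blast
    note B = mean_bin[of m']
    have "a \<le> G (m' + n) t \<and> G (m' + n) t \<le> a + c" for t
      using mean_mono[OF B, of "\<lambda>_. a" "\<lambda>j. G n (t + j)"] mean_mono[OF B, of "\<lambda>j. G n (t + j)" "\<lambda>_. a + c"] a
      by (simp add: G_plus mean_const[OF B])
    then show ?thesis unfolding osc_def by blast
  qed
  have osc_contract: "osc (m + n) (r * c)" if "osc n c" for n c
  proof -
    from that obtain a where a: "\<And>t. a \<le> G n t" "\<And>t. G n t \<le> a + c" unfolding osc_def by blast
    define M where "M = Max (G n ` {..<m})"
    have "M \<in> G n ` {..<m}" unfolding M_def using m by (intro Max_in) auto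
    then obtain s where s: "s < m" "M = G n s" by auto
    have le_M: "G n t \<le> M" for t
      unfolding M_def Gmod[of n t] using m by (intro Max_ge) auto
    note B = mean_bin[of m]
    have up: "G (m + n) t \<le> M" for t
      using mean_mono[OF B, of "\<lambda>j. G n (t + j)" "\<lambda>_. M"] le_M by (simp add: G_plus mean_const[OF B])
    have lo: "a + (M - a) / 2 ^ m \<le> G (m + n) t" for t
    proof -
      \<comment> \<open>The number of heads, at most m, that carries t into the residue class of the
        maximiser s; the added m keeps the natural subtraction exact.\<close>
      define j where "j = (s + m - t mod m) mod m"
      have "(t + j) mod m = (t mod m + (s + m - t mod m)) mod m"
        by (simp add: j_def mod_simps)
      also have "t mod m + (s + m - t mod m) = s + m"
        using m mod_less_divisor[of m t] by (simp add: less_imp_le trans_le_add2)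
      finally have "G n (t + j) = M" using Gmod[of n "t + j"] s by simp
      moreover have "j \<le> m" using m by (simp add: j_def less_imp_le)
      ultimately have "(M - a) / 2 ^ m \<le> bin_mean m (\<lambda>j. G n (t + j) - a)"
        using bin_mean_ge_point[of j m "\<lambda>j. G n (t + j) - a"] a by simp
      then show ?thesis by (simp add: mean_diff[OF B] mean_const[OF B] G_plus)
    qed
    have "M - a \<le> c" using a(2)[of s] s by simp
    then have "r * (M - a) \<le> r * c" using r by (intro mult_left_mono) auto
    then have "M \<le> a + (M - a) / 2 ^ m + r * c" by (simp add: r_def algebra_simps)
    then show ?thesis unfolding osc_def using up lo by (meson order_trans)
  qed
  define c0 where "c0 = Max (F ` {..<m}) - Min (F ` {..<m})"
  have "osc 0 c0"
  proof -
    have "Min (F ` {..<m}) \<le> G 0 t \<and> G 0 t \<le> Max (F ` {..<m})" for t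
      using m Gmod[of 0 t] by (simp add: G_def)
    then show ?thesis unfolding osc_def c0_def by (intro exI[of _ "Min (F ` {..<m})"]) simp
  qed
  then have osc_i: "osc (i * m) (r ^ i * c0)" for i
    by (induction i) (use osc_contract in \<open>auto simp: mult.assoc\<close>)
  have osc_n: "osc n (r ^ (n div m) * c0)" for n
    using osc_mono[OF osc_i[of "n div m"], of "n mod m"] by simp
  have bound: "\<bar>bin_mean n F - (\<Sum>s<m. F s) / m\<bar> \<le> r ^ (n div m) * c0" for n
  proof -
    obtain a where a: "\<And>t. a \<le> G n t" "\<And>t. G n t \<le> a + r ^ (n div m) * c0"
      using osc_n[of n] unfolding osc_def by blast
    have "(\<Sum>s<m. a) \<le> (\<Sum>s<m. F s)" "(\<Sum>s<m. F s) \<le> (\<Sum>s<m. a + r ^ (n div m) * c0)"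
      unfolding avg[of n, symmetric] by (intro sum_mono a)+
    then have "a \<le> (\<Sum>s<m. F s) / m" "(\<Sum>s<m. F s) / m \<le> a + r ^ (n div m) * c0"
      using m by (simp_all add: field_simps)
    moreover have "bin_mean n F = G n 0" by (simp add: G_def)
    ultimately show ?thesis using a(1)[of 0] a(2)[of 0] by linarith
  qed
  have "(\<lambda>n. r ^ (n div m)) \<longlonglongrightarrow> 0"
  proof (rule filterlim_compose[OF LIMSEQ_realpow_zero[OF r]])
    show "filterlim (\<lambda>n. n div m) at_top sequentially"
      unfolding filterlim_at_top
    proof
      fix Z
      show "\<forall>\<^sub>F n in sequentially. Z \<le> n div m"
        using eventually_ge_at_top[of "Z * m"]
        by eventually_elim (use m in \<open>simp add: less_eq_div_iff_mult_less_eq\<close>)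
    qed
  qed
  then have "(\<lambda>n. r ^ (n div m) * c0) \<longlonglongrightarrow> 0"
    by (rule tendsto_mult_left_zero)
  then have "(\<lambda>n. bin_mean n F - (\<Sum>s<m. F s) / m) \<longlonglongrightarrow> 0"
    by (rule Lim_null_comparison[rotated]) (use bound in simp)
  then show ?thesis by (simp add: LIM_zero_iff)
qed

section \<open>Randomly delayed words\<close>

lemma prod_list_nth: "(\<Prod>x\<leftarrow>xs. f x) = (\<Prod>i<length xs. f (xs ! i))"
  by (induction xs) (simp_all add: prod.lessThan_Suc_shift del: prod.lessThan_Suc)

context hierarchy
begin

text \<open>The value 0 for windows that do not fit is harmless because only lower bounds are
  sought. The strict inequality selects exactly the positions counted by
  \<open>scan\<close>.\<close>

definition placed :: "nat \<Rightarrow> nat \<Rightarrow> (real list \<Rightarrow> real) \<Rightarrow> nat \<Rightarrow> real" where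
  "placed i a f s = (if s + a < L ^ i then E i (\<lambda>x. f (window s a x)) else 0)"

lemma sum_placed: "(\<Sum>s<L ^ i. placed i a f s) / L ^ i = scan i a f"
proof -
  have "(\<Sum>s<L ^ i. placed i a f s) = (\<Sum>s<L ^ i - a. E i (\<lambda>x. f (window s a x)))"
    by (rule sum.mono_neutral_cong_right) (auto simp: placed_def)
  then show ?thesis by (simp add: scan_def)
qed

lemma placed_nonneg: "(\<And>w. 0 \<le> f w) \<Longrightarrow> 0 \<le> placed i a f s"
  by (simp add: placed_def mean_nonneg[OF mean_E])

text \<open>The windows at distance \<open>d\<close> are counted only when both lie inside blocks of level \<open>i\<close>;
  these blocks are distinct, hence independent.\<close>

lemma Q_mixed:
  assumes f: "\<And>w. 0 \<le> f w" and g: "\<And>w. 0 \<le> g w" and d: "L ^ i \<le> d" "a \<le> d"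
  shows "(\<Sum>s<L ^ i. placed i a f s * placed i b g ((s + d) mod L ^ i)) / L ^ i
    \<le> Q (d + b) (\<lambda>w. f (window 0 a w) * g (window d b w))"
proof -
  define n where "n = L ^ i"
  have n: "n > 0" using L_pos by (simp add: n_def)
  \<comment> \<open>The lower bound for a pair of windows depends on the position of the first one
    only through its residue s modulo the block length n.\<close>
  define \<psi> where "\<psi> s = placed i a f s * placed i b g ((s + d) mod n)" for s
  define \<Phi> where "\<Phi> = (\<Sum>s<n. \<psi> s)"
  define K where "K = d + b"
  define F where "F w = f (window 0 a w) * g (window d b w)" for w
  have \<psi>0: "0 \<le> \<psi> s" for s
    unfolding \<psi>_def by (intro mult_nonneg_nonneg placed_nonneg f g)
  have \<psi>_le: "\<psi> (P mod n) \<le> \<Phi>" for P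
    unfolding \<Phi>_def using n \<psi>0 by (intro member_le_sum) auto
  have \<Phi>0: "0 \<le> \<Phi>" unfolding \<Phi>_def by (intro sum_nonneg \<psi>0)
  have low: "\<psi> (P mod n) \<le> E (i + t) (\<lambda>x. F (window P K x))" if P: "P < L ^ (i + t) - K" for P t
  proof -
    have F_eq: "F (window P K x) = f (window P a x) * g (window (P + d) b x)" for x
      using d by (simp add: F_def K_def window_window)
    have F0: "0 \<le> E (i + t) (\<lambda>x. F (window P K x))"
      unfolding F_eq by (intro mean_nonneg[OF mean_E] mult_nonneg_nonneg f g)
    define s s' B B' where "s = P mod n" and "s' = (P + d) mod n" and "B = P div n" and "B' = (P + d) div n"
    have dec: "P = B * n + s" "P + d = B' * n + s'"
      by (simp_all add: s_def s'_def B_def B'_def div_mult_mod_eq)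
    have \<psi>_eq: "\<psi> (P mod n) = placed i a f s * placed i b g s'"
      by (simp add: \<psi>_def s_def s'_def mod_simps)
    show ?thesis
    proof (cases "s + a < n \<and> s' + b < n")
      case False
      then have "\<psi> (P mod n) = 0" unfolding \<psi>_eq by (auto simp: placed_def n_def)
      then show ?thesis using F0 by simp
    next
      case True
      have N: "L ^ (i + t) = L ^ t * n" by (simp add: n_def power_add)
      have "P + d < L ^ t * n" using P by (simp add: N K_def)
      then have lt: "B' < L ^ t" by (simp add: B'_def less_mult_imp_div_less)
      \<comment> \<open>The lag is at least a full block, so the second window starts in a later
        block than the first.\<close>
      have "(P + n) div n \<le> B'" unfolding B'_def using d by (intro div_le_mono) (simp add: n_def)
      then have "B < B'" using n by (simp add: B_def)
      with lt have B: "B < L ^ t" "B' < L ^ t" "B \<noteq> B'" by auto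
      have "E (i + t) (\<lambda>x. F (window P K x)) =
          E (i + t) (\<lambda>x. f (window s a (subblock i B x)) * g (window s' b (subblock i B' x)))"
        unfolding F_eq subblock_def n_def[symmetric]
        using True dec by (simp add: window_window)
      also have "\<dots> = E i (\<lambda>x. f (window s a x)) * E i (\<lambda>x. g (window s' b x))"
        by (rule E_subblock_pair[OF B])
      also have "\<dots> = \<psi> (P mod n)"
        unfolding \<psi>_eq using True by (simp add: placed_def n_def)
      finally show ?thesis by simp
    qed
  qed
  \<comment> \<open>The residues repeat L ^ t times along the large block; the at most K positions
    lost at its end cost K \<Phi>, which is negligible as t grows.\<close>
  have "\<Phi> / n - \<Phi> * real K / L ^ (i + t) \<le> scan (i + t) K F" for t
  proof -
    define N where "N = L ^ (i + t)"
    have N: "N = L ^ t * n" "N > 0" using L_pos by (simp_all add: N_def n_def power_add)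
    have "(\<Sum>P<N. \<psi> (P mod n)) = real (L ^ t) * \<Phi>"
      unfolding N(1) sum.blocks \<Phi>_def by simp
    moreover have "(\<Sum>P<N. \<psi> (P mod n)) = (\<Sum>P<N - K. \<psi> (P mod n)) + (\<Sum>P\<in>{N - K..<N}. \<psi> (P mod n))"
      by (subst sum.union_disjoint[symmetric]) (auto intro!: sum.cong)
    moreover have "(\<Sum>P\<in>{N - K..<N}. \<psi> (P mod n)) \<le> (\<Sum>P\<in>{N - K..<N}. \<Phi>)"
      by (intro sum_mono \<psi>_le)
    moreover have "(\<Sum>P\<in>{N - K..<N}. \<Phi>) \<le> real K * \<Phi>"
      using \<Phi>0 by (simp add: mult_right_mono)
    moreover have "(\<Sum>P<N - K. \<psi> (P mod n)) \<le> (\<Sum>P<N - K. E (i + t) (\<lambda>x. F (window P K x)))"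
      using low by (intro sum_mono) (simp add: N_def)
    ultimately have "real (L ^ t) * \<Phi> - real K * \<Phi> \<le> (\<Sum>P<N - K. E (i + t) (\<lambda>x. F (window P K x)))"
      by linarith
    then have "(real (L ^ t) * \<Phi> - real K * \<Phi>) / N \<le> scan (i + t) K F"
      unfolding scan_def N_def by (rule divide_right_mono) simp
    moreover have "(real (L ^ t) * \<Phi> - real K * \<Phi>) / N = \<Phi> / n - \<Phi> * real K / N"
      using L_pos by (simp add: N(1) diff_divide_distrib mult.commute)
    ultimately show ?thesis by (simp add: N_def)
  qed
  moreover have "(\<lambda>t. scan (i + t) K F) \<longlonglongrightarrow> Q K F"
    using LIMSEQ_ignore_initial_segment[OF scan_tendsto[of K F], of i] by (simp add: add.commute)
  moreover have "(\<lambda>t. \<Phi> / n - \<Phi> * real K / L ^ (i + t)) \<longlonglongrightarrow> \<Phi> / n - 0"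
    using LIMSEQ_ignore_initial_segment[OF over_L_power_tendsto, of "\<Phi> * real K" i]
    by (intro tendsto_intros) (simp add: add.commute)
  ultimately have "\<Phi> / n \<le> Q K F"
    by (intro tendsto_le[OF _ \<open>(\<lambda>t. scan (i + t) K F) \<longlonglongrightarrow> Q K F\<close>]) (auto simp: eventually_sequentially)
  then show ?thesis by (simp add: \<Phi>_def \<psi>_def n_def K_def F_def[abs_def])
qed

lemma Q_one: "Q k (\<lambda>_. 1) = 1"
  by (rule Q_window_eqI) (rule mean_const[OF mean_E])

abbreviation tri :: "real set" where "tri \<equiv> {-1, 0, 1}"

text \<open>The stretch of X that is read while w is produced: a zero stands for tails, where
  nothing is read.\<close>

definition thin :: "real list \<Rightarrow> real list" where
  "thin w = filter (\<lambda>x. x \<noteq> 0) w"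

lemma thin_simps [simp]:
  "thin [] = []" "thin (x # w) = (if x = 0 then thin w else x # thin w)" "thin (u @ v) = thin u @ thin v"
  by (simp_all add: thin_def)

lemma thin_words: "w \<in> words tri n \<Longrightarrow> thin w \<in> words signs (length (thin w))"
  by (auto simp: words_def thin_def)

lemma sum_list_thin: "sum_list (thin w) = sum_list w"
  by (induction w) auto

text \<open>A word over \<open>tri\<close> is a choice of the places of its nonzero letters together
  with a word of signs for these places, and the number of places is binomial under fair
  coins.\<close>

lemma sum_thin_words:
  "(\<Sum>w\<in>words tri n. H (thin w)) / 2 ^ n = bin_mean n (\<lambda>k. \<Sum>u\<in>words signs k. H u)"
proof (induction n arbitrary: H)
  case (Suc n)
  have "(\<Sum>w\<in>words tri (Suc n). H (thin w)) =
      (\<Sum>w\<in>words tri n. H (thin w)) + (\<Sum>w\<in>words tri n. H (-1 # thin w)) + (\<Sum>w\<in>words tri n. H (1 # thin w))"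
    by (simp add: sum_words_Suc)
  then have "(\<Sum>w\<in>words tri (Suc n). H (thin w)) / 2 ^ Suc n =
      (bin_mean n (\<lambda>k. \<Sum>u\<in>words signs k. H u) +
        (bin_mean n (\<lambda>k. \<Sum>u\<in>words signs k. H (-1 # u)) +
         bin_mean n (\<lambda>k. \<Sum>u\<in>words signs k. H (1 # u)))) / 2"
    unfolding Suc[symmetric] by (simp add: add_divide_distrib)
  also have "\<dots> = bin_mean (Suc n) (\<lambda>k. \<Sum>u\<in>words signs k. H u)"
    by (simp add: sum_words_Suc mean_add[OF mean_bin])
  finally show ?case .
qed simp

text \<open>The law of the first \<open>n\<close> values of \<open>\<xi>\<^sub>k X\<^bsub>N(k)\<^esub>\<close>, where \<open>X\<close> has word probabilities \<open>q\<close>, the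
  \<open>\<xi>\<^sub>k\<close> are fair coins independent of \<open>X\<close>, and \<open>N(k)\<close> counts the heads up to time \<open>k\<close>.\<close>

definition p :: "real list \<Rightarrow> real" where
  "p w = q (thin w) / 2 ^ length w"

lemma p_nonneg: "0 \<le> p w"
  by (simp add: p_def q_nonneg)

lemma sum_p:
  "(\<Sum>w\<in>words tri n. p w * f (thin w)) = bin_mean n (\<lambda>k. Q k f)"
proof -
  have "(\<Sum>w\<in>words tri n. p w * f (thin w)) = (\<Sum>w\<in>words tri n. q (thin w) * f (thin w)) / 2 ^ n"
    unfolding sum_divide_distrib by (intro sum.cong refl) (auto simp: p_def words_def)
  also have "\<dots> = bin_mean n (\<lambda>k. Q k f)"
    unfolding Q_def by (rule sum_thin_words)
  finally show ?thesis .
qed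

lemma sum_p_1: "(\<Sum>w\<in>words tri n. p w) = 1"
  using sum_p[of "\<lambda>_. 1" n] by (simp add: Q_one mean_const[OF mean_bin])

lemma p_snoc:
  assumes "w \<in> words tri n"
  shows "(\<Sum>s\<in>tri. p (w @ [s])) = p w"
  using q_snoc[OF thin_words[OF assms]] by (simp add: p_def field_simps)

lemma p_Cons:
  assumes "w \<in> words tri n"
  shows "(\<Sum>s\<in>tri. p (s # w)) = p w"
  using q_Cons[OF thin_words[OF assms]] by (simp add: p_def field_simps)

lemma p_moment: "m < L \<Longrightarrow> (\<Sum>w\<in>words tri n. p w * sum_list w ^ m) = walk_pow (1/2) m n"
  using sum_p[of "\<lambda>w. sum_list w ^ m" n]
  by (simp add: sum_list_thin Q_moment walk_pow_def bin_mean_walk)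

text \<open>Averaging over the number of heads turns the sign walk into the lazy walk, whose moment
  \<open>walk_pow_le\<close> bounds by that of N(0, n/2). Jensen's inequality bounds the averaged
  loss from below.\<close>

lemma p_moment_L:
  "(\<Sum>w\<in>words tri n. p w * sum_list w ^ L) \<le>
     (n / 2) ^ h * (fact L / (2 ^ h * fact h)) - (1 / (128 * L\<^sup>2)) ^ h * ((n / 2) ^ h - real (2 * L) ^ h)"
proof -
  note B = mean_bin[of n]
  define c :: real where "c = (1 / (128 * L\<^sup>2)) ^ h"
  have c: "c \<ge> 0" by (simp add: c_def)
  have "(\<Sum>w\<in>words tri n. p w * sum_list w ^ L) = bin_mean n (\<lambda>k. Q k (\<lambda>u. sum_list u ^ L))"
    using sum_p[of "\<lambda>w. sum_list w ^ L" n] by (simp add: sum_list_thin)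
  also have "\<dots> \<le> bin_mean n (\<lambda>k. walk_pow 1 L k - c * (real k ^ h - real (2 * L) ^ h))"
    unfolding c_def by (intro mean_mono[OF B] Q_moment_L)
  also have "\<dots> = walk_pow (1/2) L n - c * (bin_mean n (\<lambda>k. real k ^ h) - real (2 * L) ^ h)"
    by (simp add: mean_diff[OF B] mean_cmult[OF B] mean_const[OF B] walk_pow_def bin_mean_walk)
  also have "\<dots> \<le> (1 / 2 * n) ^ h * fact (2 * h) / (2 ^ h * fact h) - c * ((n / 2) ^ h - real (2 * L) ^ h)"
    using walk_pow_le[of "1/2" h n] bin_mean_power_ge[of n h] c
    by (intro diff_mono mult_left_mono) (simp_all flip: L)
  finally show ?thesis by (simp add: c_def L)
qed

abbreviation sign_avg :: "(real \<Rightarrow> real) \<Rightarrow> real" where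
  "sign_avg g \<equiv> (g 1 + g (-1)) / 2"

abbreviation tri_avg :: "(real \<Rightarrow> real) \<Rightarrow> real" where
  "tri_avg g \<equiv> g 0 / 2 + (g 1 + g (-1)) / 4"

text \<open>Induction along the coin tosses. The list \<open>hs\<close> holds the factors already
  attached to letters of X, \<open>gs\<close> those still to come: tails evaluates the next factor
  at 0, heads moves it to the end of \<open>hs\<close>. The number of sign-sensitive factors never
  grows.\<close>

lemma sum_p_product_prefix:
  assumes "length (filter (\<lambda>g. g 1 \<noteq> g (-1)) (hs @ gs)) < L"
  shows "(\<Sum>u\<in>words signs (length hs). \<Sum>w\<in>words tri (length gs).
      q (u @ thin w) / 2 ^ length gs * ((\<Prod>i<length hs. (hs ! i) (u ! i)) * (\<Prod>i<length gs. (gs ! i) (w ! i))))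
    = (\<Prod>g\<leftarrow>hs. sign_avg g) * (\<Prod>g\<leftarrow>gs. tri_avg g)"
  using assms
proof (induction gs arbitrary: hs)
  case Nil
  have "card {i \<in> {..<length hs}. (hs ! i) 1 \<noteq> (hs ! i) (-1)} < L"
    using Nil by (simp add: length_filter_conv_card)
  then have "Q (length hs) (\<lambda>u. \<Prod>i<length hs. (hs ! i) (u ! i)) = (\<Prod>i<length hs. ((hs ! i) 1 + (hs ! i) (-1)) / 2)"
    by (rule Q_product)
  also have "\<dots> = (\<Prod>g\<leftarrow>hs. sign_avg g)"
    by (simp add: prod_list_nth)
  finally show ?case by (simp add: Q_def)
next
  case (Cons g gs)
  define A where "A u = (\<Prod>i<length hs. (hs ! i) (u ! i))" for u
  define C where "C w = (\<Prod>i<length gs. (gs ! i) (w ! i))" for w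
  define k where "k = length gs"
  have g_in: "length (filter (\<lambda>g. g 1 \<noteq> g (-1)) ((hs @ [g]) @ gs)) < L"
    "length (filter (\<lambda>g. g 1 \<noteq> g (-1)) (hs @ gs)) < L"
    using Cons.prems by (auto split: if_splits)
  have A: "(\<Prod>i<length (hs @ [g]). ((hs @ [g]) ! i) ((u @ [s]) ! i)) = A u * g s"
    if "u \<in> words signs (length hs)" for u s
    using that by (auto simp: A_def words_def nth_append intro!: prod.cong)
  have C: "(\<Prod>i<length (g # gs). ((g # gs) ! i) ((s # w) ! i)) = g s * C w" for s w
    by (simp add: C_def prod.lessThan_Suc_shift del: prod.lessThan_Suc)
  have ih0: "(\<Sum>u\<in>words signs (length hs). \<Sum>w\<in>words tri k. q (u @ thin w) / 2 ^ k * (A u * C w))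
      = (\<Prod>g\<leftarrow>hs. sign_avg g) * (\<Prod>g\<leftarrow>gs. tri_avg g)"
    using Cons.IH[OF g_in(2)] by (simp add: A_def C_def k_def)
  have "(\<Sum>u\<in>words signs (length hs). \<Sum>s\<in>signs. \<Sum>w\<in>words tri k. q (u @ s # thin w) / 2 ^ k * (A u * g s * C w))
      = (\<Sum>u\<in>words signs (Suc (length hs)). \<Sum>w\<in>words tri k.
      q (u @ thin w) / 2 ^ k * ((\<Prod>i<length (hs @ [g]). ((hs @ [g]) ! i) (u ! i)) * C w))"
    unfolding sum_words_snoc by (intro sum.cong refl) (simp add: A del: length_append)
  also have "\<dots> = (\<Prod>g\<leftarrow>hs. sign_avg g) * sign_avg g * (\<Prod>g\<leftarrow>gs. tri_avg g)"
    using Cons.IH[OF g_in(1)] by (simp add: C_def k_def)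
  finally have ih1: "(\<Sum>u\<in>words signs (length hs). \<Sum>s\<in>signs. \<Sum>w\<in>words tri k. q (u @ s # thin w) / 2 ^ k * (A u * g s * C w))
      = (\<Prod>g\<leftarrow>hs. sign_avg g) * sign_avg g * (\<Prod>g\<leftarrow>gs. tri_avg g)" .
  have step: "(\<Sum>w\<in>words tri (Suc k). q (u @ thin w) / 2 ^ Suc k * (A u * (\<Prod>i<length (g # gs). ((g # gs) ! i) (w ! i))))
      = g 0 / 2 * (\<Sum>w\<in>words tri k. q (u @ thin w) / 2 ^ k * (A u * C w))
       + (\<Sum>s\<in>signs. \<Sum>w\<in>words tri k. q (u @ s # thin w) / 2 ^ k * (A u * g s * C w)) / 2" for u
    unfolding sum_words_Suc C
    by (simp add: sum_distrib_left sum_divide_distrib mult_ac add_ac flip: add_divide_distrib sum.distrib)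
  have "(\<Sum>u\<in>words signs (length hs). \<Sum>w\<in>words tri (Suc k). q (u @ thin w) / 2 ^ Suc k *
        (A u * (\<Prod>i<length (g # gs). ((g # gs) ! i) (w ! i))))
      = (\<Prod>g\<leftarrow>hs. sign_avg g) * (\<Prod>g\<leftarrow>(g # gs). tri_avg g)"
    unfolding step sum.distrib sum_distrib_left[symmetric] sum_divide_distrib[symmetric] ih0 ih1
    by (simp add: algebra_simps)
  then show ?case by (simp add: A_def k_def)
qed

lemma sum_p_product:
  assumes "card {i \<in> {..<n}. g i 1 \<noteq> g i (-1)} < L"
  shows "(\<Sum>w\<in>words tri n. p w * (\<Prod>i<n. g i (w ! i))) = (\<Prod>i<n. tri_avg (g i))"
proof -
  have "length (filter (\<lambda>g. g 1 \<noteq> g (-1)) ([] @ map g [0..<n])) < L"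
  proof -
    have "length (filter (\<lambda>i. g i 1 \<noteq> g i (-1)) [0..<n]) = card {i \<in> {..<n}. g i 1 \<noteq> g i (-1)}"
      by (subst distinct_card[symmetric]) (auto intro!: arg_cong[where f = card])
    then show ?thesis using assms by (simp add: filter_map o_def)
  qed
  from sum_p_product_prefix[OF this]
  have "(\<Sum>w\<in>words tri n. q (thin w) / 2 ^ n * (\<Prod>i<n. g i (w ! i))) = (\<Prod>i<n. tri_avg (g i))"
    by (simp add: prod_list_nth)
  moreover have "(\<Sum>w\<in>words tri n. p w * (\<Prod>i<n. g i (w ! i)))
      = (\<Sum>w\<in>words tri n. q (thin w) / 2 ^ n * (\<Prod>i<n. g i (w ! i)))"
    by (intro sum.cong refl) (simp add: p_def words_def)
  ultimately show ?thesis by simp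
qed

text \<open>Given k heads in the gap, \<open>Q_mixed\<close> bounds the probability of the pair from
  below by a function of k with period L ^ i. Binomial averaging replaces this function by its mean
  over a period, the product of the two frequencies at level i, which is close to the product of the
  limits. Short gaps lose their weight. Each of the two approximations costs e / 3.\<close>

lemma gap_lower:
  assumes u: "u \<in> words tri m" and v: "v \<in> words tri l" and "e > 0"
  shows "eventually (\<lambda>n. (\<Sum>g\<in>words tri n. p (u @ g @ v)) \<ge> p u * p v - e) sequentially"
proof -
  define u' v' a b where "u' = thin u" and "v' = thin v" and "a = length u'" and "b = length v'"
  have u': "u' \<in> words signs a" and v': "v' \<in> words signs b"
    unfolding u'_def v'_def a_def b_def using thin_words u v by auto
  \<comment> \<open>The probability of \<open>u'\<close> and \<open>v'\<close> separated by exactly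
    k letters of X.\<close>
  define R where "R k = (\<Sum>g\<in>words signs k. q (u' @ g @ v'))" for k
  have R_Q: "R k = Q (a + k + b) (\<lambda>w. indicator {u'} (window 0 a w) * indicator {v'} (window (a + k) b w))" for k
  proof -
    have "Q (a + k + b) (\<lambda>w. indicator {u'} (window 0 a w) * indicator {v'} (window (a + k) b w))
        = (\<Sum>x\<in>words signs a. \<Sum>g\<in>words signs k. \<Sum>y\<in>words signs b.
            q (x @ g @ y) * (indicator {u'} x * indicator {v'} y))"
      unfolding Q_def sum_words_append
      by (intro sum.cong refl) (simp add: window_def words_def)
    also have "\<dots> = (\<Sum>x\<in>words signs a. if x = u' then \<Sum>g\<in>words signs k. \<Sum>y\<in>words signs b.
         if y = v' then q (x @ g @ y) else 0 else 0)"
      by (intro sum.cong refl) (auto simp: indicator_def intro!: sum.cong)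
    also have "\<dots> = R k"
      using u' v' by (simp add: R_def finite_words)
    finally show ?thesis by simp
  qed
  have R0: "0 \<le> R k" for k by (simp add: R_def sum_nonneg q_nonneg)
  have gap: "(\<Sum>g\<in>words tri n. p (u @ g @ v)) = bin_mean n R / 2 ^ (m + l)" for n
  proof -
    have "(\<Sum>g\<in>words tri n. p (u @ g @ v)) = (\<Sum>g\<in>words tri n. q (u' @ thin g @ v')) / 2 ^ n / 2 ^ (m + l)"
      unfolding sum_divide_distrib
      by (intro sum.cong refl) (use u v in \<open>auto simp: p_def words_def u'_def v'_def power_add\<close>)
    also have "\<dots> = bin_mean n R / 2 ^ (m + l)"
      unfolding sum_thin_words[of "\<lambda>g. q (u' @ g @ v')"] R_def ..
    finally show ?thesis .
  qed
  have "(\<lambda>i. freq i u' * freq i v') \<longlonglongrightarrow> q u' * q v'"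
    by (intro tendsto_intros freq_tendsto)
  then have "eventually (\<lambda>i. q u' * q v' - e / 3 < freq i u' * freq i v') sequentially"
    by (rule order_tendstoD) (use \<open>e > 0\<close> in simp)
  then obtain i where i: "q u' * q v' - e / 3 < freq i u' * freq i v'"
    by (auto simp: eventually_sequentially)
  define N where "N = L ^ i"
  have N: "N > 0" using L_pos by (simp add: N_def)
  define \<alpha> \<beta> where "\<alpha> = placed i a (indicator {u'})" and "\<beta> = placed i b (indicator {v'})"
  have \<alpha>\<beta>: "0 \<le> \<alpha> s" "0 \<le> \<beta> s" for s
    unfolding \<alpha>_def \<beta>_def by (intro placed_nonneg; simp)+
  define \<psi> where "\<psi> k = (\<Sum>s<N. \<alpha> s * \<beta> ((s + (a + k)) mod N)) / N" for k
  have \<psi>0: "0 \<le> \<psi> k" for k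
    unfolding \<psi>_def by (intro divide_nonneg_nonneg sum_nonneg mult_nonneg_nonneg \<alpha>\<beta>) simp
  have \<psi>_per: "\<psi> (k + N) = \<psi> k" for k
    unfolding \<psi>_def by (simp flip: add.assoc)
  have low: "\<psi> k \<le> R k" if "N \<le> k" for k
    unfolding \<psi>_def \<alpha>_def \<beta>_def N_def R_Q
    by (rule Q_mixed) (use that in \<open>auto simp: N_def\<close>)
  have shift: "(\<Sum>k<N. \<beta> ((c + k) mod N)) = (\<Sum>k<N. \<beta> k)" for c
    using sum_periodic_shift[of N "\<lambda>k. \<beta> (k mod N)" c] N by (simp add: add.commute)
  \<comment> \<open>Averaging over the lag makes the two residues independent and uniform, so the
    double sum factorises.\<close>
  have "(\<Sum>k<N. \<psi> k) = (\<Sum>s<N. \<alpha> s * (\<Sum>k<N. \<beta> ((s + a + k) mod N))) / N"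
    unfolding \<psi>_def sum_divide_distrib[symmetric] sum_distrib_left
    by (subst sum.swap) (simp add: add.assoc)
  also have "\<dots> = (\<Sum>s<N. \<alpha> s) * (\<Sum>s<N. \<beta> s) / N"
    by (simp add: shift sum_distrib_right)
  finally have "(\<Sum>k<N. \<psi> k) / N = (\<Sum>s<N. \<alpha> s) / N * ((\<Sum>s<N. \<beta> s) / N)" by simp
  then have avg: "(\<Sum>k<N. \<psi> k) / N = freq i u' * freq i v'"
    unfolding \<alpha>_def \<beta>_def N_def sum_placed by (simp only: freq_def a_def b_def)
  \<comment> \<open>An upper bound of \<psi>: subtracting it for k < N makes the comparison with
    \<open>R\<close> valid for every k, including the short gaps outside the range of
    \<open>Q_mixed\<close>.\<close>
  define C where "C = (\<Sum>k<N. \<psi> k)"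
  have \<psi>C: "\<psi> k \<le> C" for k
  proof -
    have "\<psi> k = \<psi> (k mod N)" by (rule periodic_mod[of \<psi>, symmetric]) (rule \<psi>_per)
    also have "\<dots> \<le> C" unfolding C_def using N \<psi>0 by (intro member_le_sum) auto
    finally show ?thesis .
  qed
  have "(\<lambda>n. bin_mean n \<psi> - C * bin_mean n (indicator {..<N})) \<longlonglongrightarrow> freq i u' * freq i v' - C * 0"
    unfolding avg[symmetric]
    by (intro tendsto_intros bin_mean_periodic N \<psi>_per bin_mean_small_tendsto)
  then have "eventually (\<lambda>n. freq i u' * freq i v' - C * 0 - e / 3 <
      bin_mean n \<psi> - C * bin_mean n (indicator {..<N})) sequentially"
    by (rule order_tendstoD) (use \<open>e > 0\<close> in simp)
  then show ?thesis
  proof eventually_elim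
    case (elim n)
    note B = mean_bin[of n]
    have "bin_mean n (\<lambda>k. \<psi> k - C * indicator {..<N} k) \<le> bin_mean n R"
    proof (rule mean_mono[OF B])
      show "\<psi> k - C * indicator {..<N} k \<le> R k" for k
        using low[of k] \<psi>C[of k] R0[of k] by (cases "k < N") auto
    qed
    then have "q u' * q v' - e \<le> bin_mean n R"
      using elim i \<open>e > 0\<close> by (simp add: mean_diff[OF B] mean_cmult[OF B])
    then have "(q u' * q v' - e) / 2 ^ (m + l) \<le> bin_mean n R / 2 ^ (m + l)"
      by (intro divide_right_mono) auto
    moreover have "p u * p v = q u' * q v' / 2 ^ (m + l)"
      using u v by (simp add: p_def words_def u'_def v'_def power_add)
    moreover have "e / 2 ^ (m + l) \<le> e / 1"
      using \<open>e > 0\<close> by (intro divide_left_mono) auto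
    ultimately show ?case by (simp add: gap diff_divide_distrib)
  qed
qed

text \<open>For every gap the probabilities of all pairs of words of the given lengths add up to 1,
  as do the products \<open>p u * p v\<close>; so the one-sided estimates of all pairs together
  suffice.\<close>

lemma gap_tendsto:
  assumes "u \<in> words tri m" "v \<in> words tri l"
  shows "(\<lambda>n. \<Sum>g\<in>words tri n. p (u @ g @ v)) \<longlonglongrightarrow> p u * p v"
proof -
  have "(\<lambda>n. (\<lambda>(u, v). \<Sum>g\<in>words tri n. p (u @ g @ v)) (u, v)) \<longlonglongrightarrow> (\<lambda>(u, v). p u * p v) (u, v)"
  proof (rule limits_of_lower_bounds[where I = "words tri m \<times> words tri l" and S = 1])
    show "finite (words tri m \<times> words tri l)" by (simp add: finite_words)
    show "(\<Sum>i\<in>words tri m \<times> words tri l. case i of (u, v) \<Rightarrow> p u * p v) = 1"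
      using sum_p_1 by (simp add: sum.cartesian_product[symmetric] flip: sum_distrib_left sum_distrib_right)
    show "(\<Sum>i\<in>words tri m \<times> words tri l. case i of (u, v) \<Rightarrow> \<Sum>g\<in>words tri n. p (u @ g @ v)) = 1" for n
    proof -
      have "(\<Sum>i\<in>words tri m \<times> words tri l. case i of (u, v) \<Rightarrow> \<Sum>g\<in>words tri n. p (u @ g @ v))
          = (\<Sum>u\<in>words tri m. \<Sum>g\<in>words tri n. \<Sum>v\<in>words tri l. p (u @ g @ v))"
        unfolding sum.cartesian_product[symmetric] by (rule sum.cong[OF refl], rule sum.swap)
      also have "\<dots> = 1" using sum_p_1[of "m + (n + l)"] by (simp add: sum_words_append)
      finally show ?thesis .
    qed
  qed (use gap_lower assms in auto)
  then show ?thesis by simp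
qed

end

section \<open>The process with given word probabilities\<close>

text \<open>Extension on the right gives consistency, extension on the left makes the law
  independent of the starting point: together they describe a stationary sequence over all
  integers.\<close>

locale word_law =
  fixes A :: "real set" and p :: "real list \<Rightarrow> real"
  assumes fin: "finite A"
    and nonneg: "\<And>w. 0 \<le> p w"
    and empty: "p [] = 1"
    and extend_right: "\<And>w. set w \<subseteq> A \<Longrightarrow> (\<Sum>s\<in>A. p (w @ [s])) = p w"
    and extend_left: "\<And>w. set w \<subseteq> A \<Longrightarrow> (\<Sum>s\<in>A. p (s # w)) = p w"
begin

lemma sum_append: "set u \<subseteq> A \<Longrightarrow> (\<Sum>v\<in>words A n. p (u @ v)) = p u"
proof (induction n arbitrary: u)
  case (Suc n)
  have "(\<Sum>v\<in>words A (Suc n). p (u @ v)) = (\<Sum>s\<in>A. \<Sum>v\<in>words A n. p ((u @ [s]) @ v))"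
    by (simp add: sum_words_Suc)
  also have "\<dots> = (\<Sum>s\<in>A. p (u @ [s]))"
    by (intro sum.cong refl Suc.IH) (use Suc.prems in auto)
  finally show ?case using extend_right Suc.prems by simp
qed simp

lemma sum_prepend: "set u \<subseteq> A \<Longrightarrow> (\<Sum>v\<in>words A n. p (v @ u)) = p u"
proof (induction n arbitrary: u)
  case (Suc n)
  have "(\<Sum>v\<in>words A (Suc n). p (v @ u)) = (\<Sum>s\<in>A. \<Sum>v\<in>words A n. p (v @ (s # u)))"
    unfolding sum_words_snoc by (subst sum.swap) simp
  also have "\<dots> = (\<Sum>s\<in>A. p (s # u))"
    by (intro sum.cong refl Suc.IH) (use Suc.prems in auto)
  finally show ?case using extend_left Suc.prems by simp
qed simp

lemma sum_words_eq_1: "(\<Sum>w\<in>words A n. p w) = 1"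
  using sum_append[of "[]" n] empty by simp

definition word_pmf :: "nat \<Rightarrow> real list pmf" where
  "word_pmf n = embed_pmf (\<lambda>w. if w \<in> words A n then p w else 0)"

lemma pmf_word_pmf: "pmf (word_pmf n) w = (if w \<in> words A n then p w else 0)"
  unfolding word_pmf_def
proof (rule pmf_embed_pmf)
  have "(\<integral>\<^sup>+ w. ennreal (if w \<in> words A n then p w else 0) \<partial>count_space UNIV)
      = (\<Sum>w\<in>words A n. ennreal (p w))"
    by (subst nn_integral_count_space'[of "words A n"]) (auto simp: finite_words fin)
  also have "\<dots> = ennreal (\<Sum>w\<in>words A n. p w)" by (rule sum_ennreal) (rule nonneg)
  finally show "(\<integral>\<^sup>+ w. ennreal (if w \<in> words A n then p w else 0) \<partial>count_space UNIV) = 1"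
    by (simp add: sum_words_eq_1)
qed (simp add: nonneg)

lemma set_word_pmf: "set_pmf (word_pmf n) \<subseteq> words A n"
  by (auto simp: set_pmf_eq pmf_word_pmf split: if_splits)

lemma finite_set_word_pmf: "finite (set_pmf (word_pmf n))"
  using set_word_pmf finite_words[OF fin] by (rule finite_subset)

lemma integral_word_pmf: "(\<integral>w. f w \<partial>word_pmf n) = (\<Sum>w\<in>words A n. p w * f w)" for f :: "real list \<Rightarrow> real"
  by (subst integral_measure_pmf[of "words A n"])
     (use set_word_pmf in \<open>auto simp: finite_words fin pmf_word_pmf\<close>)

text \<open>The letters after the window are summed out by right extension, those before it by left
  extension.\<close>

lemma map_window_word_pmf:
  assumes "a + k \<le> n"
  shows "map_pmf (window a k) (word_pmf n) = word_pmf k"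
proof (rule pmf_eqI)
  fix u
  obtain c where n: "n = a + (k + c)" using assms by (metis add.assoc le_Suc_ex)
  have "pmf (map_pmf (window a k) (word_pmf n)) u = (\<integral>w. indicator {u} (window a k w) \<partial>word_pmf n)"
    by (simp add: pmf_map indicator_vimage[symmetric] flip: integral_indicator)
  also have "\<dots> = (\<Sum>x\<in>words A a. \<Sum>w\<in>words A k. \<Sum>y\<in>words A c. p (x @ w @ y) * indicator {u} w)"
    unfolding integral_word_pmf n sum_words_append
    by (intro sum.cong refl) (simp add: window_def words_def)
  also have "\<dots> = (\<Sum>x\<in>words A a. \<Sum>w\<in>words A k. if w = u then p (x @ u) else 0)"
  proof (intro sum.cong refl)
    fix x w assume xw: "x \<in> words A a" "w \<in> words A k"
    have "(\<Sum>y\<in>words A c. p (x @ w @ y) * indicator {u} w) = (\<Sum>y\<in>words A c. p ((x @ w) @ y)) * indicator {u} w"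
      by (simp add: sum_distrib_right)
    also have "\<dots> = p (x @ w) * indicator {u} w"
      using xw by (subst sum_append) (auto simp: words_def)
    finally show "(\<Sum>y\<in>words A c. p (x @ w @ y) * indicator {u} w) = (if w = u then p (x @ u) else 0)"
      by (simp add: indicator_def)
  qed
  also have "\<dots> = (\<Sum>x\<in>words A a. if u \<in> words A k then p (x @ u) else 0)"
    by (simp add: finite_words fin)
  also have "\<dots> = pmf (word_pmf k) u"
  proof (cases "u \<in> words A k")
    case True
    then have "set u \<subseteq> A" by (simp add: words_def)
    with True show ?thesis by (simp add: pmf_word_pmf sum_prepend)
  qed (simp add: pmf_word_pmf)
  finally show "pmf (map_pmf (window a k) (word_pmf n)) u = pmf (word_pmf k) u" .
qed

abbreviation borels :: "'i set \<Rightarrow> ('i \<Rightarrow> real) measure" where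
  "borels J \<equiv> PiM J (\<lambda>_. borel)"

definition reach :: "int set \<Rightarrow> nat" where
  "reach J = nat (Max (insert 0 (abs ` J)))"

lemma abs_le_reach: "finite J \<Longrightarrow> k \<in> J \<Longrightarrow> \<bar>k\<bar> \<le> int (reach J)"
  using Max_ge[of "insert 0 (abs ` J)" "\<bar>k\<bar>"] by (simp add: reach_def)

text \<open>A finite index set is placed in a symmetric interval around 0, whose letters form one
  word centred at the origin.\<close>

definition fdd :: "int set \<Rightarrow> (int \<Rightarrow> real) measure" where
  "fdd J = distr (word_pmf (2 * reach J + 1)) (borels J) (\<lambda>w. \<lambda>k\<in>J. w ! nat (k + int (reach J)))"

text \<open>A centred word is a window of every longer centred word, so any sufficient radius
  defines the same law.\<close>

lemma fdd_eq:
  assumes "\<And>k. k \<in> J \<Longrightarrow> \<bar>k\<bar> \<le> int N" "finite J"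
  shows "fdd J = distr (word_pmf (2 * N + 1)) (borels J) (\<lambda>w. \<lambda>k\<in>J. w ! nat (k + int N))"
proof -
  have *: "distr (word_pmf (2 * n + 1)) (borels J) (\<lambda>w. \<lambda>k\<in>J. w ! nat (k + int n))
     = distr (word_pmf (2 * m + 1)) (borels J) (\<lambda>w. \<lambda>k\<in>J. w ! nat (k + int m))"
    if nm: "n \<le> m" and J: "\<And>k. k \<in> J \<Longrightarrow> \<bar>k\<bar> \<le> int n" for n m
  proof -
    have "distr (word_pmf (2 * n + 1)) (borels J) (\<lambda>w. \<lambda>k\<in>J. w ! nat (k + int n))
      = distr (map_pmf (window (m - n) (2 * n + 1)) (word_pmf (2 * m + 1))) (borels J)
          (\<lambda>w. \<lambda>k\<in>J. w ! nat (k + int n))"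
      using nm by (subst map_window_word_pmf) simp_all
    also have "\<dots> = distr (word_pmf (2 * m + 1)) (borels J)
          (\<lambda>w. \<lambda>k\<in>J. window (m - n) (2 * n + 1) w ! nat (k + int n))"
      unfolding map_pmf_rep_eq by (subst distr_distr) (auto simp: o_def space_PiM)
    also have "\<dots> = distr (word_pmf (2 * m + 1)) (borels J) (\<lambda>w. \<lambda>k\<in>J. w ! nat (k + int m))"
    proof (rule distr_cong_AE)
      show "AE w in word_pmf (2 * m + 1). (\<lambda>k\<in>J. window (m - n) (2 * n + 1) w ! nat (k + int n))
          = (\<lambda>k\<in>J. w ! nat (k + int m))"
      proof (rule AE_pmfI)
        fix w assume "w \<in> set_pmf (word_pmf (2 * m + 1))"
        then have len: "length w = 2 * m + 1" using set_word_pmf by (auto simp: words_def)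
        show "(\<lambda>k\<in>J. window (m - n) (2 * n + 1) w ! nat (k + int n)) = (\<lambda>k\<in>J. w ! nat (k + int m))"
        proof (rule restrict_ext)
          fix k assume "k \<in> J"
          then have k: "\<bar>k\<bar> \<le> int n" by (rule J)
          then have "nat (k + int n) < 2 * n + 1" "m - n + nat (k + int n) = nat (k + int m)"
            using nm by auto
          then show "window (m - n) (2 * n + 1) w ! nat (k + int n) = w ! nat (k + int m)"
            using len nm by (simp add: window_def)
        qed
      qed
    qed (auto simp: space_PiM)
    finally show ?thesis .
  qed
  show ?thesis
  proof (cases "N \<le> reach J")
    case True
    then show ?thesis unfolding fdd_def using *[of N "reach J"] assms by simp
  next
    case False
    then show ?thesis unfolding fdd_def using *[of "reach J" N] abs_le_reach[OF assms(2)] by simp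
  qed
qed

text \<open>Kolmogorov's extension theorem; its consistency condition is the independence of the
  radius from \<open>fdd_eq\<close>.\<close>

sublocale PF: polish_projective UNIV fdd
proof (intro polish_projective.intro projective_family.intro)
  fix J H :: "int set" assume JH: "J \<subseteq> H" "finite H"
  then have "finite J" by (rule finite_subset)
  have "distr (fdd H) (borels J) (\<lambda>f. restrict f J)
      = distr (word_pmf (2 * reach H + 1)) (borels J) (\<lambda>w. \<lambda>k\<in>J. w ! nat (k + int (reach H)))"
    unfolding fdd_def
    by (subst distr_distr)
       (use JH in \<open>auto simp: o_def space_PiM Int_absorb1 intro!: measurable_restrict_subset\<close>)
  also have "\<dots> = fdd J"
    by (rule fdd_eq[symmetric]) (use JH abs_le_reach \<open>finite J\<close> in auto)
  finally show "fdd J = distr (fdd H) (borels J) (\<lambda>f. restrict f J)" ..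
next
  fix J :: "int set"
  show "prob_space (fdd J)"
    unfolding fdd_def by (rule measure_pmf.prob_space_distr) (auto simp: space_PiM)
qed

definition \<mu> :: "(int \<Rightarrow> real) measure" where
  "\<mu> = PF.lim"

lemma space_\<mu> [simp]: "space \<mu> = UNIV"
  by (simp add: \<mu>_def space_PiM)

lemma sets_\<mu> [simp, measurable_cong]: "sets \<mu> = sets path_space"
  by (simp add: \<mu>_def path_space_def)

sublocale prob_space \<mu>
  unfolding \<mu>_def by (rule PF.P.prob_space_axioms)

lemma coordinate_measurable [measurable]: "(\<lambda>\<omega>. \<omega> k) \<in> borel_measurable \<mu>"
  unfolding measurable_cong_sets[OF sets_\<mu> refl] path_space_def by measurable

lemma distr_restrict:
  assumes "finite J"
  shows "distr \<mu> (borels J) (\<lambda>\<omega>. restrict \<omega> J) = fdd J"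
proof (rule measure_eqI)
  fix X assume "X \<in> sets (distr \<mu> (borels J) (\<lambda>\<omega>. restrict \<omega> J))"
  then have X: "X \<in> sets (borels J)" by simp
  have "emeasure (distr \<mu> (borels J) (\<lambda>\<omega>. restrict \<omega> J)) X = emeasure \<mu> ((\<lambda>\<omega>. restrict \<omega> J) -` X)"
    using X by (subst emeasure_distr) (auto intro!: measurable_restrict)
  also have "(\<lambda>\<omega>. restrict \<omega> J) -` X = prod_emb UNIV (\<lambda>_. borel) J X"
    by (auto simp: prod_emb_def)
  also have "emeasure \<mu> \<dots> = emeasure (fdd J) X"
    unfolding \<mu>_def by (rule PF.emeasure_lim_emb) (use assms X in auto)
  finally show "emeasure (distr \<mu> (borels J) (\<lambda>\<omega>. restrict \<omega> J)) X = emeasure (fdd J) X" .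
qed (simp add: fdd_def)

lemma distr_word:
  "distr \<mu> (borels {..<n}) (\<lambda>\<omega>. \<lambda>i\<in>{..<n}. \<omega> (a + int i))
   = distr (word_pmf n) (borels {..<n}) (\<lambda>w. \<lambda>i\<in>{..<n}. w ! i)"
proof -
  define J where "J = (\<lambda>i. a + int i) ` {..<n}"
  define N where "N = nat \<bar>a\<bar> + n"
  have J: "finite J" "\<And>k. k \<in> J \<Longrightarrow> \<bar>k\<bar> \<le> int N" by (auto simp: J_def N_def)
  have fdd: "fdd J = distr (word_pmf (2 * N + 1)) (borels J) (\<lambda>w. \<lambda>k\<in>J. w ! nat (k + int N))"
    by (rule fdd_eq) (use J in auto)
  define off where "off = nat (a + int N)"
  have off: "off + n \<le> 2 * N + 1" "\<And>i. nat (a + int i + int N) = off + i"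
    by (auto simp: off_def N_def)
  have [measurable]: "(\<lambda>f. \<lambda>i\<in>{..<n}. f (a + int i)) \<in> measurable (borels J) (borels {..<n})"
    by (intro measurable_restrict measurable_component_singleton) (auto simp: J_def)
  have "distr \<mu> (borels {..<n}) (\<lambda>\<omega>. \<lambda>i\<in>{..<n}. \<omega> (a + int i))
      = distr (distr \<mu> (borels J) (\<lambda>\<omega>. restrict \<omega> J)) (borels {..<n}) (\<lambda>f. \<lambda>i\<in>{..<n}. f (a + int i))"
    by (subst distr_distr) (auto simp: o_def J_def intro!: measurable_restrict distr_cong)
  also have "\<dots> = distr (word_pmf (2 * N + 1)) (borels {..<n}) (\<lambda>w. \<lambda>i\<in>{..<n}. w ! (off + i))"
    unfolding distr_restrict[OF J(1)] fdd
    by (subst distr_distr) (auto simp: o_def J_def space_PiM off(2) intro!: distr_cong)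
  also have "\<dots> = distr (word_pmf (2 * N + 1)) (borels {..<n}) (\<lambda>w. \<lambda>i\<in>{..<n}. window off n w ! i)"
  proof (rule distr_cong_AE)
    show "AE w in word_pmf (2 * N + 1). (\<lambda>i\<in>{..<n}. w ! (off + i)) = (\<lambda>i\<in>{..<n}. window off n w ! i)"
    proof (rule AE_pmfI)
      fix w assume "w \<in> set_pmf (word_pmf (2 * N + 1))"
      then have "length w = 2 * N + 1" using set_word_pmf by (auto simp: words_def)
      then show "(\<lambda>i\<in>{..<n}. w ! (off + i)) = (\<lambda>i\<in>{..<n}. window off n w ! i)"
        using off(1) by (intro restrict_ext) (simp add: window_def)
    qed
  qed (auto simp: space_PiM)
  also have "\<dots> = distr (map_pmf (window off n) (word_pmf (2 * N + 1))) (borels {..<n}) (\<lambda>w. \<lambda>i\<in>{..<n}. w ! i)"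
    unfolding map_pmf_rep_eq by (subst distr_distr) (auto simp: o_def space_PiM)
  also have "map_pmf (window off n) (word_pmf (2 * N + 1)) = word_pmf n"
    by (rule map_window_word_pmf[OF off(1)])
  finally show ?thesis .
qed

abbreviation block_at :: "int \<Rightarrow> nat \<Rightarrow> (int \<Rightarrow> real) \<Rightarrow> nat \<Rightarrow> real" where
  "block_at a n \<omega> \<equiv> (\<lambda>i\<in>{..<n}. \<omega> (a + int i))"

lemma word_expectation:
  fixes G :: "(nat \<Rightarrow> real) \<Rightarrow> real"
  assumes G: "G \<in> borel_measurable (borels {..<n})"
  shows "integrable \<mu> (\<lambda>\<omega>. G (block_at a n \<omega>))"
    and "(\<integral>\<omega>. G (block_at a n \<omega>) \<partial>\<mu>) = (\<Sum>w\<in>words A n. p w * G (\<lambda>i\<in>{..<n}. w ! i))"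
proof -
  have m: "block_at a n \<in> measurable \<mu> (borels {..<n})"
    by (intro measurable_restrict) auto
  have m': "(\<lambda>w. \<lambda>i\<in>{..<n}. w ! i) \<in> measurable (word_pmf n) (borels {..<n})"
    by (auto simp: space_PiM)
  have "integrable (word_pmf n) (\<lambda>w. G (\<lambda>i\<in>{..<n}. w ! i))"
    by (rule integrable_measure_pmf_finite[OF finite_set_word_pmf])
  then show "integrable \<mu> (\<lambda>\<omega>. G (block_at a n \<omega>))"
    using integrable_distr_eq[OF m G] integrable_distr_eq[OF m' G] by (simp add: distr_word)
  show "(\<integral>\<omega>. G (block_at a n \<omega>) \<partial>\<mu>) = (\<Sum>w\<in>words A n. p w * G (\<lambda>i\<in>{..<n}. w ! i))"
    using integral_distr[OF m G] integral_distr[OF m' G] by (simp add: distr_word integral_word_pmf)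
qed

lemma word_probability:
  assumes B: "\<And>i. i < n \<Longrightarrow> B i \<in> sets borel"
  shows "measure \<mu> {\<omega>. \<forall>i<n. \<omega> (a + int i) \<in> B i} = (\<Sum>w\<in>words A n. p w * (\<Prod>i<n. indicator (B i) (w ! i)))"
proof -
  define G :: "(nat \<Rightarrow> real) \<Rightarrow> real" where "G f = (\<Prod>i<n. indicator (B i) (f i))" for f
  have G: "G \<in> borel_measurable (borels {..<n})"
    unfolding G_def
  proof (rule borel_measurable_prod)
    fix i assume "i \<in> {..<n}"
    then show "(\<lambda>f. indicator (B i) (f i)) \<in> borel_measurable (borels {..<n})"
      by (intro measurable_compose[OF measurable_component_singleton borel_measurable_indicator] B) auto
  qed
  have S: "{\<omega>. \<forall>i<n. \<omega> (a + int i) \<in> B i} \<in> sets \<mu>"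
  proof -
    have "{\<omega> \<in> space \<mu>. \<forall>i\<in>{..<n}. \<omega> (a + int i) \<in> B i} \<in> sets \<mu>"
    proof (rule sets.sets_Collect_finite_All)
      fix i assume "i \<in> {..<n}"
      then have "B i \<in> sets borel" by (simp add: B)
      from measurable_sets[OF coordinate_measurable this, of "a + int i"]
      show "{\<omega> \<in> space \<mu>. \<omega> (a + int i) \<in> B i} \<in> sets \<mu>" by (simp add: vimage_def)
    qed simp
    then show ?thesis by (simp add: Ball_def)
  qed
  have "measure \<mu> {\<omega>. \<forall>i<n. \<omega> (a + int i) \<in> B i} = (\<integral>\<omega>. indicator {\<omega>. \<forall>i<n. \<omega> (a + int i) \<in> B i} \<omega> \<partial>\<mu>)"
    using S by simp
  also have "\<dots> = (\<integral>\<omega>. G (block_at a n \<omega>) \<partial>\<mu>)"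
    by (intro Bochner_Integration.integral_cong refl)
       (auto simp: G_def indicator_def prod_zero_iff split: if_splits)
  also have "\<dots> = (\<Sum>w\<in>words A n. p w * (\<Prod>i<n. indicator (B i) (w ! i)))"
    unfolding word_expectation(2)[OF G] by (simp add: G_def)
  finally show ?thesis .
qed

text \<open>Indices of the interval that lie outside \<open>J\<close> receive the set
  \<open>UNIV\<close>, so a box over any finite index set becomes a condition on one word.\<close>

lemma box_window:
  fixes B :: "int \<Rightarrow> real set"
  assumes J: "\<And>k. k \<in> J \<Longrightarrow> \<bar>k\<bar> \<le> int N"
  shows "{\<omega>. \<forall>k\<in>J. \<omega> (k + c) \<in> B k}
      = {\<omega>. \<forall>i<2 * N + 1. \<omega> (c - int N + int i) \<in> (if int i - int N \<in> J then B (int i - int N) else UNIV)}"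
proof (intro Collect_cong iffI allI impI ballI)
  fix \<omega> :: "int \<Rightarrow> real" and i assume "\<forall>k\<in>J. \<omega> (k + c) \<in> B k"
  then show "\<omega> (c - int N + int i) \<in> (if int i - int N \<in> J then B (int i - int N) else UNIV)"
    by (auto dest!: bspec[of _ _ "int i - int N"] simp: algebra_simps)
next
  fix \<omega> :: "int \<Rightarrow> real" and k
  assume *: "\<forall>i<2 * N + 1. \<omega> (c - int N + int i) \<in> (if int i - int N \<in> J then B (int i - int N) else UNIV)"
    and k: "k \<in> J"
  have "nat (k + int N) < 2 * N + 1" "int (nat (k + int N)) = k + int N" using J[OF k] by auto
  with *[rule_format, of "nat (k + int N)"] k show "\<omega> (k + c) \<in> B k"
    by (simp add: algebra_simps)
qed

lemma box_probability:
  assumes J: "\<And>k. k \<in> J \<Longrightarrow> \<bar>k\<bar> \<le> int N" and B: "\<And>k. k \<in> J \<Longrightarrow> B k \<in> sets borel"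
  shows "measure \<mu> {\<omega>. \<forall>k\<in>J. \<omega> (k + c) \<in> B k}
    = (\<Sum>w\<in>words A (2 * N + 1). p w * (\<Prod>i<2 * N + 1. indicator (if int i - int N \<in> J then B (int i - int N) else UNIV) (w ! i)))"
  by (simp only: box_window[of J N c B, OF J], rule word_probability, simp add: B)

lemma shift_measurable: "(\<lambda>\<omega> k. \<omega> (k + c)) \<in> measurable \<mu> path_space"
  unfolding path_space_def by (rule measurable_PiM_single') (auto simp: space_PiM)

text \<open>The value given by \<open>box_probability\<close> does not contain the shift c, and
  boxes determine a law on the path space.\<close>

lemma stationary: "strictly_stationary \<mu> (\<lambda>k \<omega>. \<omega> k)"
  unfolding strictly_stationary_def
proof
  fix c :: int
  note [measurable] = shift_measurable[of c] shift_measurable[of 0]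
  show "distr \<mu> path_space (\<lambda>\<omega> k. \<omega> (k + c)) = distr \<mu> path_space (\<lambda>\<omega> k. \<omega> k)"
  proof (rule measure_eqI_PiM_infinite[where I = UNIV and M = "\<lambda>_. borel"])
    show "finite_measure (distr \<mu> path_space (\<lambda>\<omega> k. \<omega> (k + c)))"
      by (rule prob_space.finite_measure, rule prob_space_distr) (rule shift_measurable)
  next
    fix B :: "int \<Rightarrow> real set" and J :: "int set"
    assume J: "finite J" and B: "\<And>k. k \<in> J \<Longrightarrow> B k \<in> sets borel"
    have emb: "prod_emb UNIV (\<lambda>_. borel) J (Pi\<^sub>E J B) = {\<omega>. \<forall>k\<in>J. \<omega> k \<in> B k}"
      by (auto simp: prod_emb_def)
    have S: "{\<omega>. \<forall>k\<in>J. \<omega> k \<in> B k} \<in> sets path_space"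
      unfolding emb[symmetric] path_space_def by (rule sets_PiM_I) (use J B in auto)
    have eq: "measure \<mu> {\<omega>. \<forall>k\<in>J. \<omega> (k + c) \<in> B k} = measure \<mu> {\<omega>. \<forall>k\<in>J. \<omega> (k + 0) \<in> B k}"
      by (subst (1 2) box_probability[of J "reach J"]) (use abs_le_reach[OF J] B in auto)
    have "emeasure (distr \<mu> path_space (\<lambda>\<omega> k. \<omega> (k + c))) {\<omega>. \<forall>k\<in>J. \<omega> k \<in> B k}
        = emeasure \<mu> {\<omega>. \<forall>k\<in>J. \<omega> (k + c) \<in> B k}"
      using S shift_measurable by (subst emeasure_distr) (auto simp: vimage_def)
    also have "\<dots> = emeasure \<mu> {\<omega>. \<forall>k\<in>J. \<omega> k \<in> B k}"
      using eq by (simp add: emeasure_eq_measure)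
    also have "\<dots> = emeasure (distr \<mu> path_space (\<lambda>\<omega> k. \<omega> k)) {\<omega>. \<forall>k\<in>J. \<omega> k \<in> B k}"
      using S shift_measurable[of 0] by (subst emeasure_distr) (auto simp: vimage_def)
    finally show "emeasure (distr \<mu> path_space (\<lambda>\<omega> k. \<omega> (k + c))) (prod_emb UNIV (\<lambda>_. borel) J (Pi\<^sub>E J B))
        = emeasure (distr \<mu> path_space (\<lambda>\<omega> k. \<omega> k)) (prod_emb UNIV (\<lambda>_. borel) J (Pi\<^sub>E J B))"
      unfolding emb .
  qed (simp_all add: path_space_def)
qed

end

section \<open>Mixing: from words to all events\<close>

lemma prod_lessThan_add: "(\<Prod>i<m + n. f i) = (\<Prod>i<m. f i) * (\<Prod>i<n. f (m + i))" for f :: "nat \<Rightarrow> 'a::comm_monoid_mult"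
  by (induction n) (simp_all add: mult_ac)

text \<open>The sets on which convergence holds form a Dynkin class. Countable disjoint unions are
  handled by dominated convergence for series, with the probabilities of the pieces as the
  dominating summable sequence.\<close>

lemma (in prob_space) limit_additive:
  fixes \<nu> :: "nat \<Rightarrow> 'a set \<Rightarrow> real"
  assumes gen: "Int_stable G" "G \<subseteq> Pow (space M)" "sets M = sigma_sets (space M) G"
    and additive: "\<And>n F. disjoint_family F \<Longrightarrow> range F \<subseteq> sets M \<Longrightarrow> (\<lambda>i. \<nu> n (F i)) sums \<nu> n (\<Union>i. F i)"
    and total: "\<And>n A. A \<in> sets M \<Longrightarrow> \<nu> n (space M - A) = c - \<nu> n A"
    and bounds: "\<And>n A. A \<in> sets M \<Longrightarrow> 0 \<le> \<nu> n A \<and> \<nu> n A \<le> prob A"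
    and basic: "\<And>A. A \<in> G \<Longrightarrow> (\<lambda>n. \<nu> n A) \<longlonglongrightarrow> prob A * c"
    and "A \<in> sets M"
  shows "(\<lambda>n. \<nu> n A) \<longlonglongrightarrow> prob A * c"
  using gen(1,2) \<open>A \<in> sets M\<close>[unfolded gen(3)]
proof (induction rule: sigma_sets_induct_disjoint)
  case (basic A)
  then show ?case by (rule assms(7))
next
  case empty
  have "\<nu> n {} = 0" for n using bounds[of "{}" n] by simp
  then show ?case by simp
next
  case (compl A)
  then have A: "A \<in> sets M" by (simp add: gen(3))
  have "(\<lambda>n. c - \<nu> n A) \<longlonglongrightarrow> c - prob A * c"
    by (intro tendsto_intros compl)
  then show ?case using A by (simp add: total prob_compl algebra_simps)
next
  case (union F)
  then have F: "range F \<subseteq> sets M" by (simp add: gen(3))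
  have s: "(\<lambda>i. prob (F i)) sums prob (\<Union>i. F i)"
    by (rule finite_measure_UNION[OF F union(1)])
  have "(\<lambda>n. \<Sum>i. \<nu> n (F i)) \<longlonglongrightarrow> (\<Sum>i. prob (F i) * c)"
  proof (rule tannerys_theorem[THEN conjunct2, THEN conjunct2])
    show "\<And>i. (\<lambda>n. \<nu> n (F i)) \<longlonglongrightarrow> prob (F i) * c" by (rule union)
    show "\<forall>\<^sub>F (i, n) in at_top \<times>\<^sub>F sequentially. norm (\<nu> n (F i)) \<le> prob (F i)"
      using bounds F by (intro always_eventually) (auto simp: range_subsetD)
    show "summable (\<lambda>i. prob (F i))" using s by (rule sums_summable)
  qed simp
  moreover have "(\<Sum>i. \<nu> n (F i)) = \<nu> n (\<Union>i. F i)" for n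
    using additive[OF union(1) F] by (rule sums_unique[symmetric])
  moreover have "(\<Sum>i. prob (F i) * c) = prob (\<Union>i. F i) * c"
    using sums_mult2[OF s, of c] by (rule sums_unique[symmetric])
  ultimately show ?case by simp
qed

context word_law
begin

definition shift :: "nat \<Rightarrow> (int \<Rightarrow> real) \<Rightarrow> int \<Rightarrow> real" where
  "shift n \<omega> = (\<lambda>k. \<omega> (k + int n))"

lemma shift_meas: "shift n \<in> measurable \<mu> path_space"
  unfolding shift_def[abs_def] by (rule shift_measurable)

lemma shift_sets: "B \<in> sets path_space \<Longrightarrow> shift n -` B \<in> sets path_space"
  using measurable_sets[OF shift_meas, of B n] by simp

lemma prob_shift: "B \<in> sets path_space \<Longrightarrow> prob (shift n -` B) = prob B"
proof -
  assume B: "B \<in> sets path_space"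
  have "measure (distr \<mu> path_space (\<lambda>\<omega> k. \<omega> (k + int n))) B = measure (distr \<mu> path_space (\<lambda>\<omega> k. \<omega> k)) B"
    using stationary by (simp only: strictly_stationary_def)
  then show ?thesis
    using B shift_measurable[of "int n"] shift_measurable[of 0]
    by (simp add: measure_distr shift_def[abs_def])
qed

lemma cylinders:
  assumes "C \<in> prod_algebra UNIV (\<lambda>_. borel :: real measure)"
  obtains J B where "finite J" "\<And>k. k \<in> J \<Longrightarrow> B k \<in> sets borel" "C = {\<omega> :: int \<Rightarrow> real. \<forall>k\<in>J. \<omega> k \<in> B k}"
proof -
  from assms obtain J B where "finite J" "B \<in> (\<Pi> k\<in>J. sets borel)" "C = prod_emb UNIV (\<lambda>_. borel) J (Pi\<^sub>E J B)"
    by (elim prod_algebraE) auto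
  moreover have "prod_emb UNIV (\<lambda>_. borel) J (Pi\<^sub>E J B) = {\<omega>. \<forall>k\<in>J. \<omega> k \<in> B k}"
    by (auto simp: prod_emb_def)
  ultimately show thesis using that[of J B] by (simp add: Pi_iff)
qed

text \<open>Both events are conditions on words of one common length m. A shift by t + m leaves t
  free letters between the two words, and \<open>gap\<close> gives the limit of each of the finitely
  many terms.\<close>

lemma mixing_cylinders:
  assumes gap: "\<And>u v. set u \<subseteq> A \<Longrightarrow> set v \<subseteq> A \<Longrightarrow> (\<lambda>n. \<Sum>g\<in>words A n. p (u @ g @ v)) \<longlonglongrightarrow> p u * p v"
    and C: "C \<in> prod_algebra UNIV (\<lambda>_. borel)" and D: "D \<in> prod_algebra UNIV (\<lambda>_. borel)"
  shows "(\<lambda>n. prob (C \<inter> shift n -` D)) \<longlonglongrightarrow> prob C * prob D"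
proof -
  obtain J B where J: "finite J" "\<And>k. k \<in> J \<Longrightarrow> B k \<in> sets borel" "C = {\<omega>. \<forall>k\<in>J. \<omega> k \<in> B k}"
    by (rule cylinders[OF C]) blast
  obtain J' B' where J': "finite J'" "\<And>k. k \<in> J' \<Longrightarrow> B' k \<in> sets borel" "D = {\<omega>. \<forall>k\<in>J'. \<omega> k \<in> B' k}"
    by (rule cylinders[OF D]) blast
  define N where "N = max (reach J) (reach J')"
  have N: "\<bar>k\<bar> \<le> int N" if "k \<in> J \<or> k \<in> J'" for k
    using that abs_le_reach[OF J(1), of k] abs_le_reach[OF J'(1), of k] by (auto simp: N_def)
  define m where "m = 2 * N + 1"
  define b where "b i = (if int i - int N \<in> J then B (int i - int N) else UNIV)" for i
  define b' where "b' i = (if int i - int N \<in> J' then B' (int i - int N) else UNIV)" for i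
  have bm: "b i \<in> sets borel" "b' i \<in> sets borel" for i
    using J(2) J'(2) by (auto simp: b_def b'_def)
  define a a' where "a u = (\<Prod>i<m. indicator (b i) (u ! i) :: real)"
    and "a' u = (\<Prod>i<m. indicator (b' i) (u ! i) :: real)" for u :: "real list"
  have Cb: "C = {\<omega>. \<forall>i<m. \<omega> (int i - int N) \<in> b i}" and Db: "D = {\<omega>. \<forall>i<m. \<omega> (int i - int N) \<in> b' i}"
    unfolding J(3) J'(3) b_def b'_def m_def
    using box_window[of J N 0 B] box_window[of J' N 0 B'] N by simp_all
  have pC: "prob C = (\<Sum>u\<in>words A m. p u * a u)" and pD: "prob D = (\<Sum>u\<in>words A m. p u * a' u)"
    using word_probability[of m b "- int N"] word_probability[of m b' "- int N"] bm
    by (simp_all add: Cb Db a_def a'_def)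
  have ev: "prob (C \<inter> shift (t + m) -` D)
      = (\<Sum>u\<in>words A m. \<Sum>v\<in>words A m. (a u * a' v) * (\<Sum>g\<in>words A t. p (u @ g @ v)))" for t
  proof -
    \<comment> \<open>The conditions of the first event, then t free places, then those of the
      second event.\<close>
    define c where "c i = (if i < m then b i else if i < m + t then UNIV else b' (i - (m + t)))" for i
    have "C \<inter> shift (t + m) -` D = {\<omega>. \<forall>i<m + (t + m). \<omega> (- int N + int i) \<in> c i}"
    proof (intro set_eqI iffI)
      fix \<omega> assume w: "\<omega> \<in> C \<inter> shift (t + m) -` D"
      show "\<omega> \<in> {\<omega>. \<forall>i<m + (t + m). \<omega> (- int N + int i) \<in> c i}"
      proof (intro CollectI allI impI)
        fix i assume i: "i < m + (t + m)"
        have "i < m \<or> m \<le> i \<and> i < m + t \<or> (\<exists>j<m. i = m + t + j)" using i by presburger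
        then consider "i < m" | "m \<le> i" "i < m + t" | j where "i = m + t + j" "j < m" by blast
        then show "\<omega> (- int N + int i) \<in> c i"
          using w by cases (auto simp: Cb Db c_def shift_def algebra_simps)
      qed
    next
      fix \<omega> assume w: "\<omega> \<in> {\<omega>. \<forall>i<m + (t + m). \<omega> (- int N + int i) \<in> c i}"
      have "\<omega> (int i - int N) \<in> b i" if "i < m" for i
        using w that by (auto simp: c_def dest: spec[of _ i])
      moreover have "\<omega> (int i - int N + int (t + m)) \<in> b' i" if "i < m" for i
        using w that by (auto simp: c_def algebra_simps dest: spec[of _ "m + t + i"])
      ultimately show "\<omega> \<in> C \<inter> shift (t + m) -` D"
        by (auto simp: Cb Db shift_def)
    qed
    then have "prob (C \<inter> shift (t + m) -` D)
        = (\<Sum>w\<in>words A (m + (t + m)). p w * (\<Prod>i<m + (t + m). indicator (c i) (w ! i)))"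
      using word_probability[of "m + (t + m)" c "- int N"] bm by (simp add: c_def)
    also have "\<dots> = (\<Sum>u\<in>words A m. \<Sum>g\<in>words A t. \<Sum>v\<in>words A m. p (u @ g @ v) * (a u * a' v))"
      unfolding sum_words_append
    proof (intro sum.cong refl arg_cong2[where f = "(*)"])
      fix u g v assume uv: "u \<in> words A m" "g \<in> words A t" "v \<in> words A m"
      show "(\<Prod>i<m + (t + m). indicator (c i) ((u @ g @ v) ! i)) = a u * a' v"
        unfolding prod_lessThan_add a_def a'_def
        using uv by (simp add: c_def words_def nth_append)
    qed
    also have "\<dots> = (\<Sum>u\<in>words A m. \<Sum>v\<in>words A m. (a u * a' v) * (\<Sum>g\<in>words A t. p (u @ g @ v)))"
      by (rule sum.cong[OF refl], subst sum.swap) (simp add: sum_distrib_left mult.commute)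
    finally show ?thesis .
  qed
  have "(\<lambda>t. prob (C \<inter> shift (t + m) -` D)) \<longlonglongrightarrow> (\<Sum>u\<in>words A m. \<Sum>v\<in>words A m. (a u * a' v) * (p u * p v))"
    unfolding ev by (intro tendsto_intros gap) (auto simp: words_def)
  also have "(\<Sum>u\<in>words A m. \<Sum>v\<in>words A m. (a u * a' v) * (p u * p v)) = prob C * prob D"
    unfolding pC pD sum_product by (simp add: mult_ac)
  finally show ?thesis by (rule LIMSEQ_offset)
qed

text \<open>The passage from cylinders to arbitrary events is made in one argument at a time, by two
  uses of \<open>limit_additive\<close>.\<close>

lemma mixingI:
  assumes gap: "\<And>u v. set u \<subseteq> A \<Longrightarrow> set v \<subseteq> A \<Longrightarrow> (\<lambda>n. \<Sum>g\<in>words A n. p (u @ g @ v)) \<longlonglongrightarrow> p u * p v"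
  shows "mixing \<mu> (\<lambda>k \<omega>. \<omega> k)"
proof -
  let ?G = "prod_algebra UNIV (\<lambda>_ :: int. borel :: real measure)"
  have gen: "Int_stable ?G" "?G \<subseteq> Pow (space \<mu>)" "sets \<mu> = sigma_sets (space \<mu>) ?G"
    by (simp_all add: Int_stable_prod_algebra path_space_def sets_PiM)
  have G_sets: "C \<in> sets path_space" if "C \<in> ?G" for C
    using that gen(3) by (auto intro: sigma_sets.Basic)
  \<comment> \<open>The second event stays a cylinder while the first becomes arbitrary.\<close>
  have one: "(\<lambda>n. prob (C \<inter> shift n -` D)) \<longlonglongrightarrow> prob C * prob D"
    if C: "C \<in> sets path_space" and D: "D \<in> ?G" for C D
  proof (rule limit_additive[OF gen])
    fix n and F :: "nat \<Rightarrow> (int \<Rightarrow> real) set"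
    assume F: "disjoint_family F" "range F \<subseteq> sets \<mu>"
    have "(\<lambda>i. prob (F i \<inter> shift n -` D)) sums prob (\<Union>i. F i \<inter> shift n -` D)"
      by (rule finite_measure_UNION)
         (use F shift_sets[OF G_sets[OF D], of n] in \<open>auto simp: disjoint_family_on_def\<close>)
    then show "(\<lambda>i. prob (F i \<inter> shift n -` D)) sums prob ((\<Union>i. F i) \<inter> shift n -` D)" by simp
  next
    fix n E assume E: "E \<in> sets \<mu>"
    have S: "shift n -` D \<in> sets \<mu>" using shift_sets[OF G_sets[OF D]] by simp
    have cE: "UNIV - E \<in> sets \<mu>" using sets.compl_sets[OF E] by simp
    have "prob (shift n -` D) = prob (E \<inter> shift n -` D) + prob ((space \<mu> - E) \<inter> shift n -` D)"
      by (subst finite_measure_Union[symmetric]) (use sets.Int[OF E S] sets.Int[OF cE S] in \<open>auto intro!: arg_cong[where f = prob]\<close>)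
    then show "prob ((space \<mu> - E) \<inter> shift n -` D) = prob D - prob (E \<inter> shift n -` D)"
      using prob_shift[OF G_sets[OF D]] by simp
    show "0 \<le> prob (E \<inter> shift n -` D) \<and> prob (E \<inter> shift n -` D) \<le> prob E"
      using E by (auto intro: finite_measure_mono)
  qed (use C D gap mixing_cylinders in auto)
  \<comment> \<open>Now the first event is arbitrary and fixed; stationarity supplies the domination
    by \<open>prob E\<close>.\<close>
  have two: "(\<lambda>n. prob (C \<inter> shift n -` D)) \<longlonglongrightarrow> prob D * prob C"
    if C: "C \<in> sets path_space" and D: "D \<in> sets path_space" for C D
  proof (rule limit_additive[OF gen])
    fix n and F :: "nat \<Rightarrow> (int \<Rightarrow> real) set"
    assume F: "disjoint_family F" "range F \<subseteq> sets \<mu>"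
    have "(\<lambda>i. prob (C \<inter> shift n -` F i)) sums prob (\<Union>i. C \<inter> shift n -` F i)"
      by (rule finite_measure_UNION)
         (use F C shift_sets[of _ n] in \<open>auto simp: disjoint_family_on_def\<close>)
    then show "(\<lambda>i. prob (C \<inter> shift n -` F i)) sums prob (C \<inter> shift n -` (\<Union>i. F i))"
      by (simp add: vimage_UN)
  next
    fix n E assume E: "E \<in> sets \<mu>"
    have S: "shift n -` E \<in> sets \<mu>" using shift_sets E by simp
    have cS: "UNIV - shift n -` E \<in> sets \<mu>" using sets.compl_sets[OF S] by simp
    have C': "C \<in> sets \<mu>" using C by simp
    have "prob C = prob (C \<inter> shift n -` E) + prob (C \<inter> shift n -` (space \<mu> - E))"
      by (subst finite_measure_Union[symmetric])
         (use sets.Int[OF C' S] sets.Int[OF C' cS] in \<open>auto intro!: arg_cong[where f = prob] simp: vimage_Diff\<close>)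
    then show "prob (C \<inter> shift n -` (space \<mu> - E)) = prob C - prob (C \<inter> shift n -` E)" by simp
    have "prob (C \<inter> shift n -` E) \<le> prob (shift n -` E)"
      using S by (intro finite_measure_mono) auto
    then show "0 \<le> prob (C \<inter> shift n -` E) \<and> prob (C \<inter> shift n -` E) \<le> prob E"
      using E prob_shift[of E n] by simp
  next
    fix E assume "E \<in> ?G"
    then show "(\<lambda>n. prob (C \<inter> shift n -` E)) \<longlonglongrightarrow> prob E * prob C"
      using one[OF C, of E] by (simp add: mult.commute[of "prob E"])
  qed (use D in auto)
  show ?thesis
    unfolding mixing_def
  proof (intro ballI)
    fix C D :: "(int \<Rightarrow> real) set"
    assume "C \<in> sets path_space" "D \<in> sets path_space"
    from two[OF this] show "(\<lambda>n. prob {\<omega> \<in> space \<mu>. (\<lambda>k. \<omega> k) \<in> C \<and> (\<lambda>k. \<omega> (k + int n)) \<in> D})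
        \<longlonglongrightarrow> prob {\<omega> \<in> space \<mu>. (\<lambda>k. \<omega> k) \<in> C} * prob {\<omega> \<in> space \<mu>. (\<lambda>k. \<omega> k) \<in> D}"
      by (simp add: shift_def vimage_def Int_def mult.commute)
  qed
qed

end

section \<open>The delayed sequence: mixing and independence\<close>

context hierarchy
begin

sublocale W: word_law tri p
proof
  show "p [] = 1" by (simp add: p_def q_Nil)
  show "(\<Sum>s\<in>tri. p (w @ [s])) = p w" if "set w \<subseteq> tri" for w
    by (rule p_snoc[of w "length w"]) (use that in \<open>simp add: words_def\<close>)
  show "(\<Sum>s\<in>tri. p (s # w)) = p w" if "set w \<subseteq> tri" for w
    by (rule p_Cons[of w "length w"]) (use that in \<open>simp add: words_def\<close>)
qed (simp_all add: p_nonneg)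

lemma coordinate_mixing: "mixing W.\<mu> (\<lambda>k \<omega>. \<omega> k)"
proof (rule W.mixingI)
  fix u v :: "real list" assume "set u \<subseteq> tri" "set v \<subseteq> tri"
  then show "(\<lambda>n. \<Sum>g\<in>words tri n. p (u @ g @ v)) \<longlonglongrightarrow> p u * p v"
    by (intro gap_tendsto[of u "length u" v "length v"]) (auto simp: words_def)
qed

definition tri_prob :: "real set \<Rightarrow> real" where
  "tri_prob B = tri_avg (indicator B)"

text \<open>The indicator of a set with both or neither of 1 and -1 is insensitive to the sign, so
  only the remaining indices count against L.\<close>

lemma box_product:
  assumes J: "finite J" and B: "\<And>k. k \<in> J \<Longrightarrow> B k \<in> sets borel"
    and few: "card {k \<in> J. (1 \<in> B k) \<noteq> (-1 \<in> B k)} < L"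
  shows "measure W.\<mu> {\<omega>. \<forall>k\<in>J. \<omega> k \<in> B k} = (\<Prod>k\<in>J. tri_prob (B k))"
proof -
  define N where "N = W.reach J"
  define g where "g i = (indicator (if int i - int N \<in> J then B (int i - int N) else UNIV) :: real \<Rightarrow> real)" for i
  have le: "\<And>k. k \<in> J \<Longrightarrow> \<bar>k\<bar> \<le> int N" using W.abs_le_reach[OF J] by (simp add: N_def)
  have "measure W.\<mu> {\<omega>. \<forall>k\<in>J. \<omega> k \<in> B k} = (\<Sum>w\<in>words tri (2 * N + 1). p w * (\<Prod>i<2 * N + 1. g i (w ! i)))"
    using W.box_probability[of J N B 0, OF le B] by (simp add: g_def)
  also have "\<dots> = (\<Prod>i<2 * N + 1. tri_avg (g i))"
  proof (rule sum_p_product)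
    have "card {i \<in> {..<2 * N + 1}. g i 1 \<noteq> g i (-1)} \<le> card {k \<in> J. (1 \<in> B k) \<noteq> (-1 \<in> B k)}"
    proof (rule card_inj_on_le[of "\<lambda>i. int i - int N"])
      show "(\<lambda>i. int i - int N) ` {i \<in> {..<2 * N + 1}. g i 1 \<noteq> g i (-1)} \<subseteq> {k \<in> J. (1 \<in> B k) \<noteq> (-1 \<in> B k)}"
        by (auto simp: g_def indicator_def split: if_splits)
    qed (use J in \<open>auto simp: inj_on_def\<close>)
    then show "card {i \<in> {..<2 * N + 1}. g i 1 \<noteq> g i (-1)} < L" using few by simp
  qed
  also have "\<dots> = (\<Prod>i\<in>(\<lambda>k. nat (k + int N)) ` J. tri_avg (g i))"
  proof (rule prod.mono_neutral_right)
    show "(\<lambda>k. nat (k + int N)) ` J \<subseteq> {..<2 * N + 1}" using le by force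
    show "\<forall>i\<in>{..<2 * N + 1} - (\<lambda>k. nat (k + int N)) ` J. tri_avg (g i) = 1"
    proof
      fix i assume i: "i \<in> {..<2 * N + 1} - (\<lambda>k. nat (k + int N)) ` J"
      have "int i - int N \<notin> J"
      proof
        assume "int i - int N \<in> J"
        then have "nat (int i - int N + int N) \<in> (\<lambda>k. nat (k + int N)) ` J" by blast
        with i show False by simp
      qed
      then show "tri_avg (g i) = 1" by (simp add: g_def)
    qed
  qed simp
  also have "\<dots> = (\<Prod>k\<in>J. tri_prob (B k))"
  proof (subst prod.reindex)
    show "inj_on (\<lambda>k. nat (k + int N)) J"
    proof (rule inj_onI)
      fix x y assume "x \<in> J" "y \<in> J" "nat (x + int N) = nat (y + int N)"
      then show "x = y" using le[of x] le[of y] by auto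
    qed
    show "prod ((\<lambda>i. tri_avg (g i)) \<circ> (\<lambda>k. nat (k + int N))) J = (\<Prod>k\<in>J. tri_prob (B k))"
    proof (rule prod.cong[OF refl])
      fix k assume k: "k \<in> J"
      then have "int (nat (k + int N)) - int N = k" using le[OF k] by simp
      then show "((\<lambda>i. tri_avg (g i)) \<circ> (\<lambda>k. nat (k + int N))) k = tri_prob (B k)"
        using k by (simp add: g_def tri_prob_def)
    qed
  qed
  finally show ?thesis .
qed

text \<open>One statement serves both independence claims: the identity on fewer than L indices, and
  the absolute value, which cannot tell 1 from -1, on all of them.\<close>

lemma indep_vars_coordinates:
  fixes f :: "real \<Rightarrow> real"
  assumes f [measurable]: "f \<in> borel_measurable borel"
    and few: "\<And>J. finite J \<Longrightarrow> J \<subseteq> S \<Longrightarrow> card J < L \<or> f 1 = f (-1)"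
  shows "W.indep_vars (\<lambda>_. borel) (\<lambda>k \<omega>. f (\<omega> k)) S"
  unfolding W.indep_vars_def2
proof (intro conjI ballI W.indep_setsI)
  show "(\<lambda>\<omega>. f (\<omega> k)) \<in> borel_measurable W.\<mu>" for k
    by (rule measurable_compose[OF W.coordinate_measurable f])
  then show "{(\<lambda>\<omega>. f (\<omega> k)) -` B \<inter> space W.\<mu> |B. B \<in> sets borel} \<subseteq> sets W.\<mu>" for k
    using measurable_sets by blast
next
  fix A and J :: "int set"
  assume J: "J \<subseteq> S" "finite J" and "\<forall>j\<in>J. A j \<in> {(\<lambda>\<omega>. f (\<omega> j)) -` B \<inter> space W.\<mu> |B. B \<in> sets borel}"
  then have "\<forall>j\<in>J. \<exists>B. B \<in> sets borel \<and> A j = (\<lambda>\<omega>. f (\<omega> j)) -` B" by auto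
  then obtain B where B: "\<And>j. j \<in> J \<Longrightarrow> B j \<in> sets borel" "\<And>j. j \<in> J \<Longrightarrow> A j = (\<lambda>\<omega>. f (\<omega> j)) -` B j"
    by metis
  define H where "H j = f -` B j" for j
  have H: "H j \<in> sets borel" if "j \<in> J" for j
    using measurable_sets[OF f B(1)[OF that]] by (simp add: H_def)
  have A_eq: "A j = {\<omega>. \<forall>k\<in>{j}. \<omega> k \<in> H k}" if "j \<in> J" for j
    using B(2)[OF that] by (auto simp: H_def)
  have "card {k \<in> J. (1 \<in> H k) \<noteq> (-1 \<in> H k)} < L"
    using few[OF J(2,1)]
  proof
    assume "card J < L"
    moreover have "card {k \<in> J. (1 \<in> H k) \<noteq> (-1 \<in> H k)} \<le> card J" using J by (intro card_mono) auto
    ultimately show ?thesis by simp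
  next
    assume "f 1 = f (-1)"
    then show ?thesis using L_pos by (simp add: H_def)
  qed
  then have "measure W.\<mu> {\<omega>. \<forall>k\<in>J. \<omega> k \<in> H k} = (\<Prod>k\<in>J. tri_prob (H k))"
    by (intro box_product J H)
  moreover have "(\<Inter>j\<in>J. A j) = {\<omega>. \<forall>k\<in>J. \<omega> k \<in> H k}" using A_eq by auto
  moreover have "measure W.\<mu> (A j) = tri_prob (H j)" if "j \<in> J" for j
  proof -
    have "card {k \<in> {j}. (1 \<in> H k) \<noteq> (-1 \<in> H k)} \<le> card {j}" by (intro card_mono) auto
    then have "card {k \<in> {j}. (1 \<in> H k) \<noteq> (-1 \<in> H k)} < L" using L_gt_1 by simp
    then have "measure W.\<mu> {\<omega>. \<forall>k\<in>{j}. \<omega> k \<in> H k} = (\<Prod>k\<in>{j}. tri_prob (H k))"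
      by (intro box_product) (use H that in auto)
    then show ?thesis using A_eq[OF that] by simp
  qed
  ultimately show "measure W.\<mu> (\<Inter>j\<in>J. A j) = (\<Prod>j\<in>J. measure W.\<mu> (A j))" by simp
qed

end

section \<open>Weak limits of the normalised sums\<close>

lemma enumerate_range:
  fixes f :: "nat \<Rightarrow> nat"
  assumes "strict_mono f"
  shows "enumerate (range f) n = f n"
proof (induction n)
  case 0
  show ?case
    unfolding enumerate_0
    by (rule Least_equality) (use assms in \<open>auto simp: strict_mono_less_eq\<close>)
next
  case (Suc n)
  have "infinite (range f)" using assms by (simp add: finite_image_iff strict_mono_imp_inj_on)
  then have "enumerate (range f) (Suc n) = (LEAST s. s \<in> range f \<and> f n < s)"
    by (simp add: enumerate_Suc'' Suc)
  also have "\<dots> = f (Suc n)"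
    by (rule Least_equality) (use assms in \<open>auto simp: strict_mono_less strict_mono_less_eq\<close>)
  finally show ?case .
qed

text \<open>Fatou's lemma for weak convergence: the truncations min(g, k) are bounded and
  continuous, so their integrals converge, and monotone convergence in k recovers g.\<close>

lemma weak_limit_integral_le:
  fixes M :: "nat \<Rightarrow> real measure" and g :: "real \<Rightarrow> real"
  assumes M: "\<And>n. real_distribution (M n)" and N: "real_distribution N" and conv: "weak_conv_m M N"
    and g: "\<And>x. isCont g x" "\<And>x. 0 \<le> g x" and int: "\<And>n. integrable (M n) g"
    and le: "eventually (\<lambda>n. integral\<^sup>L (M n) g \<le> b n) sequentially" and b: "b \<longlonglongrightarrow> B"
  shows "integrable N g" "integral\<^sup>L N g \<le> B"
proof -
  interpret N: real_distribution N by fact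
  have g_meas: "g \<in> borel_measurable borel"
    using g by (intro borel_measurable_continuous_onI) (simp add: continuous_at_imp_continuous_on)
  define t where "t k x = min (g x) (real k)" for k :: nat and x
  have t: "isCont (t k) x" "norm (t k x) \<le> real k" for k x
    using g by (auto simp: t_def[abs_def] intro!: continuous_intros)
  have t_meas: "t k \<in> borel_measurable borel" for k
    unfolding t_def[abs_def] using g_meas by measurable
  have t_int: "integrable N (t k)" for k
    by (rule N.integrable_const_bound[of _ "real k"]) (use t t_meas in auto)
  have t_le: "integral\<^sup>L N (t k) \<le> B" for k
  proof (rule tendsto_le[OF _ b])
    show "(\<lambda>n. integral\<^sup>L (M n) (t k)) \<longlonglongrightarrow> integral\<^sup>L N (t k)"
      by (rule weak_conv_imp_integral_bdd_continuous_conv[OF M N conv t])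
    show "\<forall>\<^sub>F n in sequentially. integral\<^sup>L (M n) (t k) \<le> b n"
      using le
    proof eventually_elim
      case (elim n)
      interpret Mn: real_distribution "M n" by (rule M)
      have "integrable (M n) (t k)"
        by (rule Mn.integrable_const_bound[of _ "real k"]) (use t t_meas in auto)
      then have "integral\<^sup>L (M n) (t k) \<le> integral\<^sup>L (M n) g"
        by (intro integral_mono int) (auto simp: t_def)
      with elim show ?case by linarith
    qed
  qed simp
  have inc: "incseq (\<lambda>k. integral\<^sup>L N (t k))"
    by (intro incseq_SucI integral_mono t_int) (auto simp: t_def)
  obtain l where l: "(\<lambda>k. integral\<^sup>L N (t k)) \<longlonglongrightarrow> l"
    using incseq_convergent[OF inc, of B] t_le by blast
  have lim: "(\<lambda>k. t k x) \<longlonglongrightarrow> g x" for x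
  proof (rule tendsto_eventually)
    obtain K where "g x \<le> real K" using real_arch_simple by blast
    then show "\<forall>\<^sub>F k in sequentially. t k x = g x"
      unfolding eventually_sequentially t_def by (intro exI[of _ K]) auto
  qed
  have mono: "mono (\<lambda>k. t k x)" for x by (auto simp: mono_def t_def)
  have "integrable N g \<and> integral\<^sup>L N g = l"
    using integral_monotone_convergence_nonneg[of N t g l] t_int mono lim l g g_meas
    by (auto simp: t_def)
  moreover have "l \<le> B" by (rule LIMSEQ_le_const2[OF l]) (use t_le in auto)
  ultimately show "integrable N g" "integral\<^sup>L N g \<le> B" by auto
qed

text \<open>The bound on the integrals of g^2 makes g uniformly integrable: cutting g off at level K
  costs at most C / K, for the approximating laws and for the limit alike.\<close>

lemma weak_limit_integral_eq:
  fixes M :: "nat \<Rightarrow> real measure" and g :: "real \<Rightarrow> real"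
  assumes M: "\<And>n. real_distribution (M n)" and N: "real_distribution N" and conv: "weak_conv_m M N"
    and g: "\<And>x. isCont g x" and int: "\<And>n. integrable (M n) g" "\<And>n. integrable (M n) (\<lambda>x. (g x)\<^sup>2)"
    and sq: "\<And>n. integral\<^sup>L (M n) (\<lambda>x. (g x)\<^sup>2) \<le> C"
    and eq: "eventually (\<lambda>n. integral\<^sup>L (M n) g = c) sequentially"
  shows "integrable N g" "integral\<^sup>L N g = c"
proof -
  interpret N: real_distribution N by fact
  have g_meas: "g \<in> borel_measurable borel"
    using g by (intro borel_measurable_continuous_onI) (simp add: continuous_at_imp_continuous_on)
  have N2: "integrable N (\<lambda>x. (g x)\<^sup>2)" "integral\<^sup>L N (\<lambda>x. (g x)\<^sup>2) \<le> C"
    using weak_limit_integral_le[OF M N conv, of "\<lambda>x. (g x)\<^sup>2" "\<lambda>_. C" C] g int sq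
    by (auto intro!: continuous_intros)
  show N1: "integrable N g"
    by (rule N.square_integrable_imp_integrable) (use g_meas N2 in auto)
  have "0 \<le> integral\<^sup>L (M 0) (\<lambda>x. (g x)\<^sup>2)" by simp
  then have C: "0 \<le> C" using sq[of 0] by linarith
  define t where "t K x = max (-K) (min (g x) K)" for K x
  have trunc: "\<bar>t K x - g x\<bar> \<le> (g x)\<^sup>2 / K" if "K > 0" for K x
  proof (cases "\<bar>g x\<bar> \<le> K")
    case False
    have "\<bar>t K x - g x\<bar> \<le> \<bar>g x\<bar>" using \<open>K > 0\<close> by (auto simp: t_def)
    moreover have "\<bar>g x\<bar> * K \<le> \<bar>g x\<bar> * \<bar>g x\<bar>" using False by (intro mult_left_mono) auto
    ultimately show ?thesis using \<open>K > 0\<close>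
      by (simp add: pos_le_divide_eq power2_eq_square order_trans[OF mult_right_mono])
  qed (use \<open>K > 0\<close> in \<open>auto simp: t_def\<close>)
  have err: "\<bar>integral\<^sup>L R (t K) - integral\<^sup>L R g\<bar> \<le> C / K"
    if R: "real_distribution R" "integrable R g" "integrable R (\<lambda>x. (g x)\<^sup>2)" "integral\<^sup>L R (\<lambda>x. (g x)\<^sup>2) \<le> C"
      and K: "K > 0" for R K
  proof -
    interpret R: real_distribution R by fact
    have [measurable]: "t K \<in> borel_measurable borel" unfolding t_def[abs_def] using g_meas by measurable
    have tint: "integrable R (t K)"
      by (rule R.integrable_const_bound[of _ K]) (use K in \<open>auto simp: t_def\<close>)
    have "\<bar>integral\<^sup>L R (t K) - integral\<^sup>L R g\<bar> = \<bar>\<integral>x. t K x - g x \<partial>R\<bar>"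
      using tint R by simp
    also have "\<dots> \<le> (\<integral>x. \<bar>t K x - g x\<bar> \<partial>R)" by (rule integral_abs_bound)
    also have "\<dots> \<le> (\<integral>x. (g x)\<^sup>2 / K \<partial>R)"
      by (rule integral_mono) (use tint R trunc[OF K] in auto)
    also have "\<dots> \<le> C / K" using R K by (simp add: divide_right_mono)
    finally show ?thesis .
  qed
  have bound: "\<bar>integral\<^sup>L N g - c\<bar> \<le> 2 * C / K" if K: "K > 0" for K
  proof (rule tendsto_le[of sequentially "\<lambda>_. 2 * C / K" _ "\<lambda>n. \<bar>integral\<^sup>L N g - integral\<^sup>L N (t K) + integral\<^sup>L (M n) (t K) - c\<bar>"])
    have "(\<lambda>n. integral\<^sup>L (M n) (t K)) \<longlonglongrightarrow> integral\<^sup>L N (t K)"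
      by (rule weak_conv_imp_integral_bdd_continuous_conv[OF M N conv, of _ K])
         (use g K in \<open>auto simp: t_def[abs_def] intro!: continuous_intros\<close>)
    then have "(\<lambda>n. \<bar>integral\<^sup>L N g - integral\<^sup>L N (t K) + integral\<^sup>L (M n) (t K) - c\<bar>)
        \<longlonglongrightarrow> \<bar>integral\<^sup>L N g - integral\<^sup>L N (t K) + integral\<^sup>L N (t K) - c\<bar>"
      by (intro tendsto_intros)
    then show "(\<lambda>n. \<bar>integral\<^sup>L N g - integral\<^sup>L N (t K) + integral\<^sup>L (M n) (t K) - c\<bar>) \<longlonglongrightarrow> \<bar>integral\<^sup>L N g - c\<bar>"
      by simp
    show "\<forall>\<^sub>F n in sequentially. \<bar>integral\<^sup>L N g - integral\<^sup>L N (t K) + integral\<^sup>L (M n) (t K) - c\<bar> \<le> 2 * C / K"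
      using eq
    proof eventually_elim
      case (elim n)
      have "\<bar>integral\<^sup>L (M n) (t K) - c\<bar> \<le> C / K"
        using err[OF M int sq K, of n] elim by simp
      moreover have "\<bar>integral\<^sup>L N (t K) - integral\<^sup>L N g\<bar> \<le> C / K"
        by (rule err[OF N N1 N2 K])
      ultimately show ?case by (simp add: abs_le_iff)
    qed
  qed simp_all
  have "\<bar>integral\<^sup>L N g - c\<bar> \<le> 0"
  proof (rule tendsto_le[of sequentially "\<lambda>k. 2 * C / real (Suc k)" 0 "\<lambda>_. \<bar>integral\<^sup>L N g - c\<bar>"])
    show "(\<lambda>k. 2 * C / real (Suc k)) \<longlonglongrightarrow> 0"
      by (rule LIMSEQ_Suc[OF lim_const_over_n])
  qed (use bound in \<open>auto simp del: of_nat_Suc\<close>)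
  then show "integral\<^sup>L N g = c" by simp
qed

lemma tight_of_second_moment:
  assumes M: "\<And>n. real_distribution (M n)" and int: "\<And>n. integrable (M n) (\<lambda>x. x\<^sup>2)"
    and sq: "\<And>n. integral\<^sup>L (M n) (\<lambda>x. x\<^sup>2) \<le> 1"
  shows "tight M"
  unfolding tight_def
proof (intro conjI allI impI M)
  fix e :: real assume e: "e > 0"
  \<comment> \<open>Chebyshev's inequality then leaves mass at most e / 2 outside the
    interval.\<close>
  define K where "K = sqrt (2 / e)"
  have K: "K > 0" "K\<^sup>2 = 2 / e" using e by (simp_all add: K_def)
  have "measure (M n) {-K<..K} > 1 - e" for n
  proof -
    interpret Mn: real_distribution "M n" by (rule M)
    have "measure (M n) (UNIV - {-K<..K}) = (\<integral>x. indicator (UNIV - {-K<..K}) x \<partial>M n)" by simp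
    also have "\<dots> \<le> (\<integral>x. x\<^sup>2 / K\<^sup>2 \<partial>M n)"
    proof (rule integral_mono)
      show "integrable (M n) (indicator (UNIV - {-K<..K}) :: real \<Rightarrow> real)"
        by (rule integrable_real_indicator) (auto simp: Mn.emeasure_eq_measure)
    next
      fix x :: real
      show "indicator (UNIV - {-K<..K}) x \<le> x\<^sup>2 / K\<^sup>2"
      proof (cases "x \<in> {-K<..K}")
        case False
        then have "K\<^sup>2 \<le> x\<^sup>2" using K by (intro abs_le_square_iff[THEN iffD1]) auto
        then show ?thesis using K(1) False by (simp add: indicator_def)
      qed simp
    qed (use int in auto)
    also have "\<dots> \<le> 1 / K\<^sup>2" using sq[of n] by (simp add: divide_right_mono)
    also have "\<dots> < e" using e by (simp add: K(2))
    finally show ?thesis using Mn.prob_compl[of "{-K<..K}"] by simp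
  qed
  then show "\<exists>a b. a < b \<and> (\<forall>n. measure (M n) {a<..b} > 1 - e)"
    using K by (intro exI[of _ "-K"] exI[of _ K]) auto
qed

section \<open>Limits of the normalised sums along subsequences\<close>

context hierarchy
begin

abbreviation partial_sum :: "nat \<Rightarrow> (int \<Rightarrow> real) \<Rightarrow> real" where
  "partial_sum \<equiv> S_sum (\<lambda>k \<omega>. \<omega> k)"

lemma S_sum_eq: "partial_sum n \<omega> = (\<Sum>i<n. (\<lambda>i\<in>{..<n}. \<omega> (1 + int i)) i)"
proof -
  have "(\<Sum>k = 1..int n. \<omega> k) = (\<Sum>i<n. \<omega> (1 + int i))"
    by (rule sum.reindex_bij_witness[of _ "\<lambda>i. 1 + int i" "\<lambda>k. nat (k - 1)"]) auto
  then show ?thesis by (simp add: S_sum_def)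
qed

lemma S_sum_power:
  shows "integrable W.\<mu> (\<lambda>\<omega>. partial_sum n \<omega> ^ m)" (is ?int)
    and "(\<integral>\<omega>. partial_sum n \<omega> ^ m \<partial>W.\<mu>) = (\<Sum>w\<in>words tri n. p w * sum_list w ^ m)" (is ?eq)
proof -
  define G :: "(nat \<Rightarrow> real) \<Rightarrow> real" where "G f = (\<Sum>i<n. f i) ^ m" for f
  have "G \<in> borel_measurable (PiM {..<n} (\<lambda>_. borel))"
    unfolding G_def[abs_def]
    by (intro borel_measurable_power borel_measurable_sum measurable_component_singleton) auto
  note G = W.word_expectation[OF this, of 1]
  show ?int using G(1) unfolding G_def S_sum_eq .
  have "(\<Sum>w\<in>words tri n. p w * G (\<lambda>i\<in>{..<n}. w ! i)) = (\<Sum>w\<in>words tri n. p w * sum_list w ^ m)"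
    by (intro sum.cong refl) (simp add: G_def words_def sum_list_sum_nth atLeast0LessThan)
  then show ?eq using G(2) unfolding G_def S_sum_eq by simp
qed

lemma coordinate_power:
  shows "integrable W.\<mu> (\<lambda>\<omega>. \<omega> k ^ m)" (is ?int)
    and "m < L \<Longrightarrow> (\<integral>\<omega>. \<omega> k ^ m \<partial>W.\<mu>) = walk_pow (1/2) m 1" (is "_ \<Longrightarrow> ?eq")
proof -
  define G :: "(nat \<Rightarrow> real) \<Rightarrow> real" where "G f = f 0 ^ m" for f
  have "G \<in> borel_measurable (PiM {..<1} (\<lambda>_. borel))"
    unfolding G_def[abs_def]
    by (intro borel_measurable_power measurable_component_singleton) auto
  note G = W.word_expectation[OF this, of k]
  show ?int using G(1) by (simp add: G_def)
  have "(\<Sum>w\<in>words tri 1. p w * G (\<lambda>i\<in>{..<1}. w ! i)) = (\<Sum>w\<in>words tri 1. p w * sum_list w ^ m)"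
    by (intro sum.cong refl) (auto simp: G_def words_def length_Suc_conv)
  then show "m < L \<Longrightarrow> ?eq" using G(2) p_moment[of m 1] by (simp add: G_def)
qed

definition sum_law :: "nat \<Rightarrow> real measure" where
  "sum_law n = distr W.\<mu> borel (\<lambda>\<omega>. partial_sum n \<omega> / sqrt (real n))"

lemma S_sum_measurable: "(\<lambda>\<omega>. partial_sum n \<omega> / sqrt (real n)) \<in> borel_measurable W.\<mu>"
  unfolding S_sum_def by (intro borel_measurable_divide borel_measurable_sum W.coordinate_measurable) auto

lemma sum_law_distribution: "real_distribution (sum_law n)"
  unfolding sum_law_def by (rule W.real_distribution_distr[OF S_sum_measurable])

lemma sum_law_power:
  shows "integrable (sum_law n) (\<lambda>x. x ^ m)"
    and "(\<integral>x. x ^ m \<partial>sum_law n) = (\<Sum>w\<in>words tri n. p w * sum_list w ^ m) / sqrt (real n) ^ m"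
  unfolding sum_law_def
  using S_sum_power[of n m]
  by (simp_all add: integrable_distr_eq[OF S_sum_measurable] integral_distr[OF S_sum_measurable] power_divide)

lemma sum_law_mean: "(\<integral>x. x \<partial>sum_law n) = 0"
  using sum_law_power(2)[of n 1] p_moment[of 1 n] walk_pow_odd[of 1] L_gt_1 by simp

lemma sum_law_second: "n > 0 \<Longrightarrow> (\<integral>x. x\<^sup>2 \<partial>sum_law n) = 1/2"
  using sum_law_power(2)[of n 2] p_moment[of 2 n] walk_pow_2[of "1/2" n] L h by simp

lemma sum_law_second_le: "(\<integral>x. x\<^sup>2 \<partial>sum_law n) \<le> 1"
proof (cases "n > 0")
  \<comment> \<open>For n = 0 the division by zero yields the value 0.\<close>
  case False
  then show ?thesis using sum_law_power(2)[of n 2] by simp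
qed (simp add: sum_law_second)

text \<open>Controls the square of x^2, so that the second moment passes to a weak limit with
  equality and not merely as an upper bound.\<close>

lemma sum_law_fourth_le: "(\<integral>x. (x\<^sup>2)\<^sup>2 \<partial>sum_law n) \<le> 1"
proof -
  have "(\<integral>x. x ^ 4 \<partial>sum_law n) = walk_pow (1/2) 4 n / sqrt (real n) ^ 4"
    using sum_law_power(2)[of n 4] p_moment[of 4 n] L h by simp
  also have "\<dots> \<le> (3/4 * (real n)\<^sup>2) / sqrt (real n) ^ 4"
    using walk_pow_le[of "1/2" 2 n]
    by (intro divide_right_mono) (simp_all add: power_divide fact_numeral)
  also have "sqrt (real n) ^ 4 = (real n)\<^sup>2"
    using power_mult[of "sqrt (real n)" 2 2] by simp
  also have "(3/4 * (real n)\<^sup>2) / (real n)\<^sup>2 \<le> 1" by simp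
  finally show ?thesis by (simp flip: power_mult)
qed

text \<open>The L-th moment of N(0, 1/2) is \<open>fact L / (2 ^ h * fact h) / 2 ^ h\<close>. The
  bound stays below it by \<open>c / 2 ^ h\<close>, up to an error that vanishes as n grows.\<close>

lemma sum_law_L_le:
  assumes "n > 0"
  defines "c \<equiv> (1 / (128 * L\<^sup>2)) ^ h"
  shows "(\<integral>x. x ^ L \<partial>sum_law n) \<le> (fact L / (2 ^ h * fact h) - c) / 2 ^ h + c * real (2 * L) ^ h / real n ^ h"
proof -
  have s: "sqrt (real n) ^ L = real n ^ h" by (simp add: L power_mult)
  have "(\<integral>x. x ^ L \<partial>sum_law n) \<le>
      ((n / 2) ^ h * (fact L / (2 ^ h * fact h)) - c * ((n / 2) ^ h - real (2 * L) ^ h)) / real n ^ h"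
    unfolding sum_law_power(2) s c_def by (intro divide_right_mono p_moment_L) simp
  also have "\<dots> = (fact L / (2 ^ h * fact h) - c) / 2 ^ h + c * real (2 * L) ^ h / real n ^ h"
  proof -
    have "(a / 2 ^ h * G - c * (a / 2 ^ h - K)) / a = (G - c) / 2 ^ h + c * K / a" if "a > 0" for a G K :: real
      using that by (simp add: diff_divide_distrib right_diff_distrib)
    from this[of "real n ^ h" "fact L / (2 ^ h * fact h)" "real (2 * L) ^ h"] show ?thesis
      using assms(1) by (simp only: power_divide zero_less_power of_nat_0_less_iff)
  qed
  finally show ?thesis .
qed

lemma subsequential_limit:
  assumes s: "strict_mono s"
  obtains r N where "strict_mono (r :: nat \<Rightarrow> nat)" "real_distribution N" "nondegenerate N" "non_normal N"
    "weak_conv_m (sum_law \<circ> s \<circ> r) N"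
proof -
  have "tight sum_law"
    by (rule tight_of_second_moment) (simp_all only: sum_law_distribution sum_law_power(1) sum_law_second_le)
  then obtain r N where r: "strict_mono r" and N: "real_distribution N"
    and conv: "weak_conv_m (sum_law \<circ> s \<circ> r) N"
    using tight_imp_convergent_subsubsequence[OF _ s] by blast
  define v where "v = s \<circ> r"
  have v: "strict_mono v" using s r by (simp add: v_def strict_mono_o)
  \<comment> \<open>The index 0 has to be avoided: there the law is a point mass, with variance 0
    instead of 1/2.\<close>
  have v_pos: "eventually (\<lambda>i. v i > 0) sequentially"
    using eventually_gt_at_top[of 0]
  proof eventually_elim
    case (elim i)
    then show ?case using seq_suble[OF v, of i] by linarith
  qed
  have conv: "weak_conv_m (\<lambda>i. sum_law (v i)) N" using conv by (simp add: v_def o_def)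
  interpret N: real_distribution N by fact
  have law: "real_distribution (sum_law (v i))" for i by (rule sum_law_distribution)
  note limit_eq = weak_limit_integral_eq[where M = "\<lambda>i. sum_law (v i)" and N = N]
  note limit_le = weak_limit_integral_le[where M = "\<lambda>i. sum_law (v i)" and N = N]
  have int: "integrable (sum_law (v i)) (\<lambda>x. x)" "integrable (sum_law (v i)) (\<lambda>x. x\<^sup>2)"
    "integrable (sum_law (v i)) (\<lambda>x. (x\<^sup>2)\<^sup>2)" for i
    using sum_law_power(1)[of "v i" 1] sum_law_power(1)[of "v i" 2] sum_law_power(1)[of "v i" 4]
    by (simp_all flip: power_mult)
  have mean: "(\<integral>x. x \<partial>N) = 0"
  proof (rule limit_eq(2)[where g = "\<lambda>x. x" and C = 1])
    show "\<forall>\<^sub>F i in sequentially. (\<integral>x. x \<partial>sum_law (v i)) = 0" by (simp add: sum_law_mean)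
  qed (simp_all add: law N conv int sum_law_second_le)
  have second: "(\<integral>x. x\<^sup>2 \<partial>N) = 1/2"
  proof (rule limit_eq(2)[where g = "\<lambda>x. x\<^sup>2" and C = 1])
    show "\<forall>\<^sub>F i in sequentially. (\<integral>x. x\<^sup>2 \<partial>sum_law (v i)) = 1/2"
      using v_pos by eventually_elim (rule sum_law_second)
    show "isCont (\<lambda>x. x\<^sup>2) x" for x :: real by (intro continuous_intros)
  qed (simp_all only: law N conv int sum_law_fourth_le)
  define c :: real where "c = (1 / (128 * L\<^sup>2)) ^ h"
  have c: "c > 0" using L_pos by (simp add: c_def)
  have Lth: "(\<integral>x. x ^ L \<partial>N) \<le> (fact L / (2 ^ h * fact h) - c) / 2 ^ h"
  proof (rule limit_le(2)[where g = "\<lambda>x. x ^ L"])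
    show "\<forall>\<^sub>F i in sequentially. (\<integral>x. x ^ L \<partial>sum_law (v i))
        \<le> (fact L / (2 ^ h * fact h) - c) / 2 ^ h + c * real (2 * L) ^ h / real (v i) ^ h"
      using v_pos unfolding c_def by eventually_elim (rule sum_law_L_le)
    have "filterlim (\<lambda>i. real (v i) ^ h) at_top sequentially"
      using h by (intro filterlim_pow_at_top filterlim_compose[OF filterlim_real_sequentially filterlim_subseq[OF v]]) auto
    then have "(\<lambda>i. c * real (2 * L) ^ h / real (v i) ^ h) \<longlonglongrightarrow> 0"
      by (intro tendsto_divide_0[OF tendsto_const] filterlim_at_top_imp_at_infinity)
    then show "(\<lambda>i. (fact L / (2 ^ h * fact h) - c) / 2 ^ h + c * real (2 * L) ^ h / real (v i) ^ h)
        \<longlonglongrightarrow> (fact L / (2 ^ h * fact h) - c) / 2 ^ h"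
      using tendsto_add[OF tendsto_const] by fastforce
    show "0 \<le> x ^ L" for x :: real using even_L by (simp add: zero_le_even_power)
    show "isCont (\<lambda>x. x ^ L) x" for x :: real by (intro continuous_intros)
  qed (simp_all only: law N conv sum_law_power)
  have "nondegenerate N"
    unfolding nondegenerate_def
  proof
    assume "\<exists>a. N = return borel a"
    then obtain a where "N = return borel a" by blast
    with mean second show False by (auto simp: integral_return)
  qed
  moreover have "non_normal N"
    unfolding non_normal_def
  proof
    assume "\<exists>m s. s > 0 \<and> N = density lborel (normal_density m s)"
    then obtain m s where s: "s > 0" and Nd: "N = density lborel (normal_density m s)" by blast
    have dens: "(\<integral>x. f x \<partial>N) = (\<integral>x. normal_density m s x * f x \<partial>lborel)" if "f \<in> borel_measurable borel" for f :: "real \<Rightarrow> real"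
      unfolding Nd using that by (subst integral_density) auto
    \<comment> \<open>The mean and the second moment leave N(0, 1/2) as the only normal
      candidate.\<close>
    have m: "m = 0"
      using dens[of "\<lambda>x. x"] mean integral_normal_moment_nz_1[OF s, of m] by simp
    have "(\<integral>x. x\<^sup>2 \<partial>N) = s\<^sup>2"
      using dens[of "\<lambda>x. x\<^sup>2"] integral_normal_moment_even[OF s, of m 1] by (simp add: m)
    then have s2: "s\<^sup>2 = 1/2" using second by simp
    have "(\<integral>x. x ^ L \<partial>N) = fact L / ((2 / s\<^sup>2) ^ h * fact h)"
      using dens[of "\<lambda>x. x ^ L"] integral_normal_moment_even[OF s, of m h] by (simp add: m L)
    also have "\<dots> = fact L / (2 ^ h * fact h) / 2 ^ h"
    proof -
      have "(4::real) ^ h = 2 ^ h * 2 ^ h" by (simp flip: power_mult_distrib)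
      then show ?thesis by (simp add: s2)
    qed
    finally have "fact L / (2 ^ h * fact h) / 2 ^ h \<le> (fact L / (2 ^ h * fact h) - c) / 2 ^ h"
      using Lth by simp
    then have "fact L / (2 ^ h * fact h) \<le> fact L / (2 ^ h * fact h) - c"
      by (simp only: divide_le_cancel) simp
    then show False using c by simp
  qed
  ultimately show thesis
    using that[OF r N] conv by (simp add: v_def o_def)
qed

text \<open>The convergent sub-subsequence is recorded by its range T; being strictly increasing, it
  is also the enumeration of T.\<close>

lemma every_subsequence:
  fixes T0 :: "nat set"
  assumes "infinite T0"
  shows "\<exists>T \<subseteq> T0. infinite T \<and> (\<exists>N :: real measure. real_distribution N \<and> nondegenerate N \<and> non_normal N \<and>
      weak_conv_m (\<lambda>i. distr W.\<mu> borel (\<lambda>\<omega>. S_sum (\<lambda>k \<omega>. \<omega> k) (enumerate T i) \<omega> / sqrt (real (enumerate T i)))) N)"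
proof -
  have s: "strict_mono (enumerate T0)" using assms by (simp add: strict_mono_def)
  obtain r N where r: "strict_mono r" and N: "real_distribution N" "nondegenerate N" "non_normal N"
    and conv: "weak_conv_m (sum_law \<circ> enumerate T0 \<circ> r) N"
    by (rule subsequential_limit[OF s])
  define T where "T = range (enumerate T0 \<circ> r)"
  have mono: "strict_mono (enumerate T0 \<circ> r)" using s r by (rule strict_mono_o)
  have "T \<subseteq> T0" using enumerate_in_set[OF assms] by (auto simp: T_def)
  moreover have "infinite T"
    unfolding T_def by (rule range_inj_infinite[OF strict_mono_imp_inj_on[OF mono]])
  moreover have "(\<lambda>i. distr W.\<mu> borel (\<lambda>\<omega>. S_sum (\<lambda>k \<omega>. \<omega> k) (enumerate T i) \<omega> / sqrt (real (enumerate T i))))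
      = sum_law \<circ> enumerate T0 \<circ> r"
    unfolding T_def enumerate_range[OF mono] by (simp add: sum_law_def fun_eq_iff)
  ultimately show ?thesis using N conv by (intro exI[of _ T]) auto
qed

lemma tuplewise:
  assumes "0 < K" "K < L"
  shows "tuplewise_indep K W.\<mu> (\<lambda>k \<omega>. \<omega> k)"
  unfolding tuplewise_indep_def
proof (intro allI impI)
  fix S :: "int set" assume K: "card S = K"
  then have "finite S" using assms(1) by (simp add: card_ge_0_finite)
  then have "card J < L" if "J \<subseteq> S" for J
    using card_mono[OF _ that] K assms(2) by simp
  then show "W.indep_vars (\<lambda>_. borel) (\<lambda>k \<omega>. \<omega> k) S"
    by (intro indep_vars_coordinates[of "\<lambda>x. x"]) auto
qed

lemma abs_indep: "W.indep_vars (\<lambda>_. borel) (\<lambda>k \<omega>. \<bar>\<omega> k\<bar>) UNIV"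
  by (rule indep_vars_coordinates) auto

lemma abs_distr: "distr W.\<mu> borel (\<lambda>\<omega>. \<bar>\<omega> k\<bar>) = distr W.\<mu> borel (\<lambda>\<omega>. \<bar>\<omega> 0\<bar>)"
proof -
  have m: "(\<lambda>\<eta>. \<bar>\<eta> 0\<bar>) \<in> borel_measurable path_space"
    unfolding path_space_def by measurable
  have "distr W.\<mu> borel (\<lambda>\<omega>. \<bar>\<omega> (0 + c)\<bar>) = distr (distr W.\<mu> path_space (\<lambda>\<omega> k. \<omega> (k + c))) borel (\<lambda>\<eta>. \<bar>\<eta> 0\<bar>)" for c
    by (subst distr_distr[OF m W.shift_measurable]) (simp add: o_def)
  from this[of k] this[of 0] show ?thesis
    using W.stationary by (simp add: strictly_stationary_def)
qed

end

theorem theorem1p1: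
  fixes M :: nat
  assumes "M \<ge> 2"
  shows "\<exists>(P :: (int \<Rightarrow> real) measure) (X :: int \<Rightarrow> (int \<Rightarrow> real) \<Rightarrow> real).
    prob_space P \<and>
    (\<forall>k. X k \<in> borel_measurable P) \<and>
    strictly_stationary P X \<and>
    integrable P (X 0) \<and> integrable P (\<lambda>\<omega>. (X 0 \<omega>)\<^sup>2) \<and>
    (\<integral>\<omega>. X 0 \<omega> \<partial>P) = 0 \<and> (\<integral>\<omega>. (X 0 \<omega>)\<^sup>2 \<partial>P) = 1/2 \<and>
    tuplewise_indep M P X \<and>
    mixing P X \<and>
    prob_space.indep_vars P (\<lambda>_. borel) (\<lambda>k \<omega>. \<bar>X k \<omega>\<bar>) UNIV \<and>
    (\<forall>k. distr P borel (\<lambda>\<omega>. \<bar>X k \<omega>\<bar>) = distr P borel (\<lambda>\<omega>. \<bar>X 0 \<omega>\<bar>)) \<and>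
    (\<forall>Q :: nat set. infinite Q \<longrightarrow>
       (\<exists>T \<subseteq> Q. infinite T \<and>
          (\<exists>\<mu> :: real measure. real_distribution \<mu> \<and> nondegenerate \<mu> \<and> non_normal \<mu> \<and>
             weak_conv_m (\<lambda>i. distr P borel
                (\<lambda>\<omega>. S_sum X (enumerate T i) \<omega> / sqrt (real (enumerate T i)))) \<mu>)))"
proof -
  \<comment> \<open>Taking h = M + 1 gives h \<ge> 3 because M \<ge> 2, and L = 2 (M + 1) exceeds
    M.\<close>
  interpret hierarchy "2 * (M + 1)" "M + 1"
    by unfold_locales (use assms in auto)
  let ?X = "\<lambda>(k :: int) (\<omega> :: int \<Rightarrow> real). \<omega> k"
  show ?thesis
  proof (intro exI[of _ W.\<mu>] exI[of _ ?X] conjI allI impI)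
    show "prob_space W.\<mu>" by (rule W.prob_space_axioms)
    show "(\<lambda>\<omega>. \<omega> k) \<in> borel_measurable W.\<mu>" for k by (rule W.coordinate_measurable)
    show "strictly_stationary W.\<mu> ?X" by (rule W.stationary)
    show "integrable W.\<mu> (\<lambda>\<omega>. \<omega> 0)" using coordinate_power(1)[of 0 1] by simp
    show "integrable W.\<mu> (\<lambda>\<omega>. (\<omega> 0)\<^sup>2)" by (rule coordinate_power(1))
    show "(\<integral>\<omega>. \<omega> 0 \<partial>W.\<mu>) = 0"
      using coordinate_power(2)[of 1 0] walk_pow_odd[of 1] by simp
    show "(\<integral>\<omega>. (\<omega> 0)\<^sup>2 \<partial>W.\<mu>) = 1/2"
      using coordinate_power(2)[of 2 0] walk_pow_2[of "1/2" 1] assms by simp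
    show "tuplewise_indep M W.\<mu> ?X" by (rule tuplewise) (use assms in auto)
    show "mixing W.\<mu> ?X" by (rule coordinate_mixing)
    show "W.indep_vars (\<lambda>_. borel) (\<lambda>k \<omega>. \<bar>\<omega> k\<bar>) UNIV" by (rule abs_indep)
    show "distr W.\<mu> borel (\<lambda>\<omega>. \<bar>\<omega> k\<bar>) = distr W.\<mu> borel (\<lambda>\<omega>. \<bar>\<omega> 0\<bar>)" for k by (rule abs_distr)
  next
    fix T0 :: "nat set" assume "infinite T0"
    then show "\<exists>T \<subseteq> T0. infinite T \<and> (\<exists>N :: real measure. real_distribution N \<and> nondegenerate N \<and> non_normal N \<and>
        weak_conv_m (\<lambda>i. distr W.\<mu> borel (\<lambda>\<omega>. S_sum ?X (enumerate T i) \<omega> / sqrt (real (enumerate T i)))) N)"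
      by (rule every_subsequence)
  qed
qed

end
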